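(* Let $G$ be a countable group and let $\mathbf{Z}=(Z,\mathcal{Z},\kappa,\mathbf{R})\in\mathbb{A}(G)$, $\mathbf{R}=\{R_g\}_{g\in G}$, be a fixed ergodic system. Let $\mathbf{X}=(X,\mathcal{B},\mu,\mathbf{T})$, with $\mathbf{T}=\{T_g\}_{g\in G}$, be an element of $\mathbb{A}_{\mathbf{Z}}(G)$ such that the factor map $\pi:\mathbf{X}\to\mathbf{Z}$ is $\kappa$-a.e. infinite to one. Let $\mu=\int_{\bar X}\mu_{\bar x}\,d\bar\mu(\bar x)$ be the ergodic decomposition of $\mathbf{X}$, let $\mathbf{T}_{\bar x}$ denote the ergodic component corresponding to $\bar x\in\bar X$ (an element of $\mathbb{A}_{\mathbf{Z}}(G)$ via $\pi$ for $\bar\mu$-a.e. $\bar x$), and let $$D=\{(\bar x_1,\bar x_2)\in\bar X\times\bar X:\ \mathbf{T}_{\bar x_1}\underset{\mathbf{Z}}{\perp}\mathbf{T}_{\bar x_2}\}.$$ (1) If $\mathbf{X}$ is disjoint over $\mathbf{Z}$ from every ergodic $\mathbf{S}$ in $\mathbb{A}_{\mathbf{Z}}(G)$, then $(\bar\mu\times\bar\mu)(D)=1$. (2) Conversely, if $(\bar\mu\times\bar\mu)(D)=1$, then $\mathbf{X}$ is disjoint over $\mathbf{Z}$ from every ergodic system $\mathbf{Y}=(Y,\mathcal{C},\eta,\mathbf{S})\in\mathbb{A}_{\mathbf{Z}}(G)$.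
   Context: $\mathbb{A}(G)$ is the space of probability measure preserving actions of $G$ on the standard nonatomic probability space ($[0,1]$ with Lebesgue measure, up to isomorphism of the underlying space). $\mathbb{A}_{\mathbf{Z}}(G)$ is the collection of systems in $\mathbb{A}(G)$ that admit $\mathbf{Z}$ as a factor, each considered together with its factor map to $\mathbf{Z}$. For $\mathbf{X},\mathbf{Y}\in\mathbb{A}_{\mathbf{Z}}(G)$ with factor maps $\pi_X,\pi_Y$, a joining of $\mathbf{X}$ and $\mathbf{Y}$ over $\mathbf{Z}$ is a probability measure $\lambda$ on $X\times Y$ with marginals $\mu$ and $\eta$, invariant under $T_g\times S_g$ for every $g\in G$, and such that $\pi_X(x)=\pi_Y(y)$ for $\lambda$-a.e. $(x,y)$. The systems are (relatively) disjoint over $\mathbf{Z}$, written $\mathbf{X}\underset{\mathbf{Z}}{\perp}\mathbf{Y}$, if the relatively independent joining $\mu\underset{\kappa}{\times}\eta=\int_Z\mu_z\times\eta_z\,d\kappa(z)$ is their unique joining over $\mathbf{Z}$, where $\mu=\int\mu_z\,d\kappa(z)$ and $\eta=\int\eta_z\,d\kappa(z)$ are the disintegrations over $\mathbf{Z}$. The map $\pi$ is $\kappa$-a.e. infinite to one if for $\kappa$-a.e. $z$ the fiber measure $\mu_z$ is not supported on a finite set. The ergodic decomposition of $\mu$ is $\mu=\int_{\bar X}\mu_{\bar x}\,d\bar\mu(\bar x)$, where $(\bar X,\bar\mu)$ is the standard probability space of ergodic components (the factor corresponding to the $\sigma$-algebra of $G$-invariant sets) and the $\mu_{\bar x}$ are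 $G$-invariant, ergodic, and carried by disjoint invariant sets for distinct $\bar x$. The component $\mathbf{T}_{\bar x}$ is the action $\mathbf{T}$ with the measure $\mu_{\bar x}$; since $\kappa$ is ergodic, $\pi_*\mu_{\bar x}=\kappa$ for $\bar\mu$-a.e. $\bar x$. *)

theory Defs
  imports "HOL-Probability.Probability" "HOL-Algebra.Group"
begin

definition measurable_iso :: "('a \<Rightarrow> 'b) \<Rightarrow> 'a measure \<Rightarrow> 'b measure \<Rightarrow> bool" where
  "measurable_iso f M N \<longleftrightarrow>
     bij_betw f (space M) (space N) \<and> f \<in> M \<rightarrow>\<^sub>M N \<and> the_inv_into (space M) f \<in> N \<rightarrow>\<^sub>M M"

text \<open>Standard Borel spaces, presented as the measurable spaces isomorphic to a Borel subset of the
  real line. Atoms are allowed; this is used for the space of ergodic components.\<close>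

definition standard_borel :: "'a measure \<Rightarrow> bool" where
  "standard_borel M \<longleftrightarrow>
     (\<exists>B \<in> sets (borel :: real measure). \<exists>f. measurable_iso f M (restrict_space borel B))"

text \<open>The unit interval carries its Borel sets, so that the disintegrations below are families of
  measures on the \<open>\<sigma>\<close>-algebra of the space itself. By the isomorphism theorem for measures, every
  atomless probability measure on a standard Borel space is covered.\<close>

definition standard_nonatomic :: "'a measure \<Rightarrow> bool" where
  "standard_nonatomic M \<longleftrightarrow>
     (\<exists>f. measurable_iso f M (restrict_space lborel {0..1::real}) \<and>
          distr M (restrict_space lborel {0..1}) f = restrict_space lborel {0..1})"

definition pmp_action ::
  "('g, 'm) monoid_scheme \<Rightarrow> 'x measure \<Rightarrow> ('g \<Rightarrow> 'x \<Rightarrow> 'x) \<Rightarrow> bool" where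
  "pmp_action G M T \<longleftrightarrow>
     prob_space M \<and>
     (\<forall>g \<in> carrier G. T g \<in> M \<rightarrow>\<^sub>M M \<and> distr M M (T g) = M) \<and>
     (\<forall>x \<in> space M. T \<one>\<^bsub>G\<^esub> x = x) \<and>
     (\<forall>g \<in> carrier G. \<forall>h \<in> carrier G. \<forall>x \<in> space M. T (g \<otimes>\<^bsub>G\<^esub> h) x = T g (T h x))"

definition invariant_set ::
  "('g, 'm) monoid_scheme \<Rightarrow> 'x measure \<Rightarrow> ('g \<Rightarrow> 'x \<Rightarrow> 'x) \<Rightarrow> 'x set \<Rightarrow> bool" where
  "invariant_set G M T A \<longleftrightarrow>
     A \<in> sets M \<and> (\<forall>g \<in> carrier G. T g -` A \<inter> space M = A)"

definition ergodic_action ::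
  "('g, 'm) monoid_scheme \<Rightarrow> 'x measure \<Rightarrow> ('g \<Rightarrow> 'x \<Rightarrow> 'x) \<Rightarrow> bool" where
  "ergodic_action G M T \<longleftrightarrow>
     (\<forall>A. invariant_set G M T A \<longrightarrow> emeasure M A = 0 \<or> emeasure M A = 1)"

text \<open>Membership of a system in \<open>\<A>(G)\<close>.\<close>

definition system ::
  "('g, 'm) monoid_scheme \<Rightarrow> 'x measure \<Rightarrow> ('g \<Rightarrow> 'x \<Rightarrow> 'x) \<Rightarrow> bool" where
  "system G M T \<longleftrightarrow> standard_nonatomic M \<and> pmp_action G M T"

definition factor_map ::
  "('g, 'm) monoid_scheme \<Rightarrow> 'z measure \<Rightarrow> ('g \<Rightarrow> 'z \<Rightarrow> 'z) \<Rightarrow>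
   'x measure \<Rightarrow> ('g \<Rightarrow> 'x \<Rightarrow> 'x) \<Rightarrow> ('x \<Rightarrow> 'z) \<Rightarrow> bool" where
  "factor_map G K R M T \<pi> \<longleftrightarrow>
     \<pi> \<in> M \<rightarrow>\<^sub>M K \<and> distr M K \<pi> = K \<and>
     (\<forall>g \<in> carrier G. AE x in M. \<pi> (T g x) = R g (\<pi> x))"

text \<open>Membership in \<open>\<A>\<^sub>Z(G)\<close>, where \<open>Z\<close> is the system \<open>(K, R)\<close>; the factor map is part of the
  data.\<close>

definition system_over ::
  "('g, 'm) monoid_scheme \<Rightarrow> 'z measure \<Rightarrow> ('g \<Rightarrow> 'z \<Rightarrow> 'z) \<Rightarrow>
   'x measure \<Rightarrow> ('g \<Rightarrow> 'x \<Rightarrow> 'x) \<Rightarrow> ('x \<Rightarrow> 'z) \<Rightarrow> bool" where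
  "system_over G K R M T \<pi> \<longleftrightarrow> system G M T \<and> factor_map G K R M T \<pi>"

definition disintegration ::
  "'z measure \<Rightarrow> 'x measure \<Rightarrow> ('x \<Rightarrow> 'z) \<Rightarrow> ('z \<Rightarrow> 'x measure) \<Rightarrow> bool" where
  "disintegration K M \<pi> m \<longleftrightarrow>
     m \<in> K \<rightarrow>\<^sub>M prob_algebra M \<and> M = K \<bind> m \<and>
     (AE z in K. AE x in m z. \<pi> x = z)"

text \<open>On standard spaces the disintegration over a factor exists and is unique up to a null set, so
  in the next two uses the existential quantifier over disintegrations could equally well be a
  universal one.\<close>

definition infinite_to_one :: "'z measure \<Rightarrow> 'x measure \<Rightarrow> ('x \<Rightarrow> 'z) \<Rightarrow> bool" where
  "infinite_to_one K M \<pi> \<longleftrightarrow>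
     (\<exists>m. disintegration K M \<pi> m \<and>
          (AE z in K. \<not> (\<exists>F. finite F \<and> (AE x in m z. x \<in> F))))"

definition joining_over ::
  "('g, 'm) monoid_scheme \<Rightarrow>
   'x measure \<Rightarrow> ('g \<Rightarrow> 'x \<Rightarrow> 'x) \<Rightarrow> ('x \<Rightarrow> 'z) \<Rightarrow>
   'y measure \<Rightarrow> ('g \<Rightarrow> 'y \<Rightarrow> 'y) \<Rightarrow> ('y \<Rightarrow> 'z) \<Rightarrow> ('x \<times> 'y) measure \<Rightarrow> bool" where
  "joining_over G M T \<pi> N S \<rho> J \<longleftrightarrow>
     prob_space J \<and> sets J = sets (M \<Otimes>\<^sub>M N) \<and>
     distr J M fst = M \<and> distr J N snd = N \<and>
     (\<forall>g \<in> carrier G. distr J J (map_prod (T g) (S g)) = J) \<and>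
     (AE (x, y) in J. \<pi> x = \<rho> y)"

definition relatively_independent_joining ::
  "'z measure \<Rightarrow> ('z \<Rightarrow> 'x measure) \<Rightarrow> ('z \<Rightarrow> 'y measure) \<Rightarrow> ('x \<times> 'y) measure" where
  "relatively_independent_joining K m n = K \<bind> (\<lambda>z. m z \<Otimes>\<^sub>M n z)"

definition disjoint_over ::
  "('g, 'm) monoid_scheme \<Rightarrow> 'z measure \<Rightarrow>
   'x measure \<Rightarrow> ('g \<Rightarrow> 'x \<Rightarrow> 'x) \<Rightarrow> ('x \<Rightarrow> 'z) \<Rightarrow>
   'y measure \<Rightarrow> ('g \<Rightarrow> 'y \<Rightarrow> 'y) \<Rightarrow> ('y \<Rightarrow> 'z) \<Rightarrow> bool" where
  "disjoint_over G K M T \<pi> N S \<rho> \<longleftrightarrow>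
     (\<exists>m n. disintegration K M \<pi> m \<and> disintegration K N \<rho> n \<and>
        {J. joining_over G M T \<pi> N S \<rho> J} = {relatively_independent_joining K m n})"

text \<open>\<open>B\<close> is the space of ergodic components with its measure, \<open>p\<close> the projection onto it and \<open>c b\<close>
  the component over \<open>b\<close>. The two clauses after the one on \<open>distr\<close> say that, modulo null sets, \<open>p\<close> is
  the factor of the \<open>\<sigma>\<close>-algebra of invariant sets.\<close>

definition ergodic_decomposition ::
  "('g, 'm) monoid_scheme \<Rightarrow> 'x measure \<Rightarrow> ('g \<Rightarrow> 'x \<Rightarrow> 'x) \<Rightarrow>
   'b measure \<Rightarrow> ('x \<Rightarrow> 'b) \<Rightarrow> ('b \<Rightarrow> 'x measure) \<Rightarrow> bool" where
  "ergodic_decomposition G M T B p c \<longleftrightarrow>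
     prob_space B \<and> standard_borel B \<and>
     p \<in> M \<rightarrow>\<^sub>M B \<and> distr M B p = B \<and>
     (\<forall>g \<in> carrier G. AE x in M. p (T g x) = p x) \<and>
     (\<forall>A. invariant_set G M T A \<longrightarrow>
        (\<exists>C \<in> sets B. AE x in M. x \<in> A \<longleftrightarrow> p x \<in> C)) \<and>
     disintegration B M p c \<and>
     (\<forall>b \<in> space B. pmp_action G (c b) T \<and> ergodic_action G (c b) T) \<and>
     (\<exists>E. (\<forall>b \<in> space B. invariant_set G M T (E b) \<and> emeasure (c b) (E b) = 1) \<and>
          disjoint_family_on E (space B))"

definition disjoint_component_pairs ::
  "('g, 'm) monoid_scheme \<Rightarrow> 'z measure \<Rightarrow> ('g \<Rightarrow> 'x \<Rightarrow> 'x) \<Rightarrow> ('x \<Rightarrow> 'z) \<Rightarrow>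
   'b measure \<Rightarrow> ('b \<Rightarrow> 'x measure) \<Rightarrow> ('b \<times> 'b) set" where
  "disjoint_component_pairs G K T \<pi> B c =
     {(b1, b2) \<in> space B \<times> space B. disjoint_over G K (c b1) T \<pi> (c b2) T \<pi>}"

end

theory Submission
  imports Defs
begin

text \<open>
  If \<open>J\<close> joins the system with an ergodic \<open>Y\<close>, then the component \<open>b\<close> and the point \<open>y\<close> are independent
  under \<open>J\<close>, so \<open>J\<close> disintegrates into measures \<open>j (b, y)\<close>, and for almost all \<open>b1, b2\<close> the measure
  \<open>\<integral> j (b1, y) \<times> j (b2, y) dy\<close> joins the two components over \<open>Z\<close>. If it is always the relatively
  independent joining, integration over \<open>b1, b2\<close> shows that \<open>J (A | y)\<close> has the same \<open>L\<^sup>2\<close> norm as its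
  conditional expectation on \<open>Z\<close>, hence equals it, and \<open>J\<close> is relatively independent.

  Conversely, suppose that the pairs of non-disjoint components do not form a null set, and fix a suitable
  component \<open>b'\<close>. By compactness, a nontrivial joining of \<open>b\<close> and \<open>b'\<close> exists iff approximate ones with
  rational data exist at every stage. Hence the set of these pairs is measurable, the approximations can be
  chosen measurably in \<open>b\<close>, and a limit of their averages over \<open>b\<close> is a nontrivial joining of the
  whole system with \<open>b'\<close>, which is isomorphic to an ergodic system on the unit interval.
\<close>

section \<open>Conditional laws\<close>

text \<open>An invariant component is independent of every ergodic factor, hence also of Z. So a
  single kernel on components times Z disintegrates almost all components at once, and Fubini
  applies to them. Pairs of components suffice because the square of an average over b is an average
  over independent pairs.

  In the other direction the obstacle is measurability. Disjointness quantifies over all joinings,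
  so the set of disjoint pairs is not visibly measurable, and a joining has to depend measurably on
  b before it can be averaged. Each non-disjoint pair of good components therefore gets a witness
  from a countable list: a test rectangle, a sign and a gap 1/(k+1). Once the sign is fixed,
  averaging cannot cancel the gaps. For pairs without the given witness the relatively independent
  mass is used, which keeps the marginals right. The limit is controlled on rectangles only, along a
  filter rather than a subsequence since there may be uncountably many rectangles; conditional
  distribution functions turn it into a measure.\<close>

definition real_retract :: "'a measure \<Rightarrow> ('a \<Rightarrow> real) \<Rightarrow> (real \<Rightarrow> 'a) \<Rightarrow> bool" where
  "real_retract M \<phi> \<psi> \<longleftrightarrow>
     \<phi> \<in> borel_measurable M \<and> \<psi> \<in> borel \<rightarrow>\<^sub>M M \<and> (\<forall>x\<in>space M. \<psi> (\<phi> x) = x)"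

lemma real_retractD:
  assumes "real_retract M \<phi> \<psi>"
  shows "\<phi> \<in> borel_measurable M" "\<psi> \<in> borel \<rightarrow>\<^sub>M M" "\<And>x. x \<in> space M \<Longrightarrow> \<psi> (\<phi> x) = x"
  using assms by (auto simp: real_retract_def)

lemma real_retract_cong: "sets M = sets N \<Longrightarrow> real_retract M \<phi> \<psi> = real_retract N \<phi> \<psi>"
  unfolding real_retract_def using sets_eq_imp_space_eq[of M N] measurable_cong_sets[of M N]
    measurable_cong_sets[of borel borel M N] by auto

text \<open>This is the form in which standardness is used: laws are pushed to the line by
  \<open>\<phi>\<close> and back by \<open>\<psi>\<close>, and since \<open>\<psi>\<close> is total
  no case distinction on the range of \<open>\<phi>\<close> arises. Off \<open>S\<close> the inverse
  is extended by a constant point, which is where nonemptiness enters.\<close>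

lemma measurable_iso_imp_real_retract:
  assumes iso: "measurable_iso f M (restrict_space borel S)" and S: "S \<in> sets borel"
    and ne: "space M \<noteq> {}"
  shows "\<exists>\<psi>. real_retract M f \<psi>"
proof -
  from ne obtain x0 where x0: "x0 \<in> space M" by auto
  let ?g = "the_inv_into (space M) f"
  have bij: "bij_betw f (space M) S" and f: "f \<in> M \<rightarrow>\<^sub>M restrict_space borel S"
    and g: "?g \<in> restrict_space borel S \<rightarrow>\<^sub>M M"
    using iso by (auto simp: measurable_iso_def space_restrict_space)
  let ?\<psi> = "\<lambda>r. if r \<in> S then ?g r else x0"
  have "?\<psi> \<in> borel \<rightarrow>\<^sub>M M"
    using S by (intro measurable_If_restrict_space_iff[THEN iffD2]) (auto simp: g x0)
  moreover have "f \<in> borel_measurable M"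
    using f by (simp add: measurable_restrict_space2_iff)
  moreover have "?\<psi> (f x) = x" if "x \<in> space M" for x
    using that bij by (auto simp: bij_betw_def the_inv_into_f_f)
  ultimately show ?thesis
    unfolding real_retract_def by blast
qed

lemma standard_nonatomic_imp_real_retract:
  assumes "standard_nonatomic M"
  shows "\<exists>\<phi> \<psi>. real_retract M \<phi> \<psi>"
proof -
  obtain f where f: "measurable_iso f M (restrict_space lborel {0..1::real})"
    using assms by (auto simp: standard_nonatomic_def)
  have "sets (restrict_space lborel {0..1::real}) = sets (restrict_space borel {0..1})"
    by (simp add: sets_restrict_space)
  then have "measurable_iso f M (restrict_space borel {0..1::real})"
    using f measurable_cong_sets[of M M "restrict_space lborel {0..1::real}" "restrict_space borel {0..1}"]
      measurable_cong_sets[of "restrict_space lborel {0..1::real}" "restrict_space borel {0..1}" M M]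
    by (simp add: measurable_iso_def space_restrict_space)
  moreover have "space M \<noteq> {}"
  proof
    assume "space M = {}"
    then have "bij_betw f {} {0..1::real}" using f by (simp add: measurable_iso_def space_restrict_space)
    then show False by (auto simp: bij_betw_def)
  qed
  ultimately show ?thesis
    using measurable_iso_imp_real_retract[of f M "{0..1}"] by auto
qed

section \<open>Rational sublevel sets as a countable generator\<close>

definition sublevel :: "'a measure \<Rightarrow> ('a \<Rightarrow> real) \<Rightarrow> rat \<Rightarrow> 'a set" where
  "sublevel M \<phi> r = {x \<in> space M. \<phi> x \<le> of_rat r}"

lemma sublevel_measurable [measurable]: "\<phi> \<in> borel_measurable M \<Longrightarrow> sublevel M \<phi> r \<in> sets M"
  unfolding sublevel_def by measurable

lemma sublevel_Int: "sublevel M \<phi> r \<inter> sublevel M \<phi> s = sublevel M \<phi> (min r s)"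
  by (auto simp: sublevel_def min_def of_rat_less_eq) (meson of_rat_less_eq order_trans linear)+

lemma Int_stable_sublevel: "Int_stable (range (sublevel M \<phi>))"
  by (auto simp: Int_stable_def sublevel_Int)

lemma sets_borel_rat_atMost: "sets borel = sigma_sets UNIV (range (\<lambda>q::rat. {..of_rat q::real}))"
proof -
  have "(borel :: real measure) = sigma UNIV (range (\<lambda>q::rat. {..of_rat q}))"
  proof (rule borel_eq_sigmaI1[OF borel_eq_atMost])
    fix X assume "X \<in> range (atMost :: real \<Rightarrow> _)"
    then obtain a :: real where X: "X = {..a}" by auto
    have "X = (\<Inter>q\<in>{q::rat. a < of_rat q}. {..of_rat q})"
      unfolding X by (auto intro: less_imp_le) (meson linorder_not_le of_rat_dense)
    moreover have "{q::rat. a < of_rat q} \<noteq> {}"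
      using of_rat_dense[of a "a + 1"] by auto
    then have "(\<Inter>q\<in>{q::rat. a < of_rat q}. {..of_rat q}) \<in> sets (sigma UNIV (range (\<lambda>q::rat. {..of_rat q::real})))"
      by (intro sets.countable_INT') auto
    ultimately show "X \<in> sets (sigma UNIV (range (\<lambda>q::rat. {..of_rat q})))"
      by simp
  qed auto
  then show ?thesis by (metis sets_measure_of top_greatest subset_Pow_Union UNIV_I Pow_UNIV)
qed

lemma sets_eq_sigma_sets_sublevel:
  assumes "real_retract M \<phi> \<psi>"
  shows "sets M = sigma_sets (space M) (range (sublevel M \<phi>))"
proof
  note [measurable] = real_retractD(1,2)[OF assms]
  have "range (sublevel M \<phi>) \<subseteq> sets M" by auto
  then show "sigma_sets (space M) (range (sublevel M \<phi>)) \<subseteq> sets M"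
    by (rule sets.sigma_sets_subset)
  show "sets M \<subseteq> sigma_sets (space M) (range (sublevel M \<phi>))"
  proof
    fix A assume A: "A \<in> sets M"
    then have "\<psi> -` A \<in> sets borel"
      using measurable_sets[OF real_retractD(2)[OF assms] A] by simp
    then have "\<psi> -` A \<in> sigma_sets UNIV (range (\<lambda>q::rat. {..of_rat q::real}))"
      by (simp add: sets_borel_rat_atMost)
    moreover have "A = \<phi> -` (\<psi> -` A) \<inter> space M"
      using real_retractD(3)[OF assms] sets.sets_into_space[OF A] by force
    ultimately have "A \<in> {\<phi> -` S \<inter> space M |S. S \<in> sigma_sets UNIV (range (\<lambda>q::rat. {..of_rat q::real}))}"
      by blast
    also have "\<dots> = sigma_sets (space M) {\<phi> -` S \<inter> space M |S. S \<in> range (\<lambda>q::rat. {..of_rat q::real})}"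
      by (rule sigma_sets_vimage_commute) auto
    also have "{\<phi> -` S \<inter> space M |S. S \<in> range (\<lambda>q::rat. {..of_rat q::real})} = range (sublevel M \<phi>)"
      by (auto simp: sublevel_def) blast
    finally show "A \<in> sigma_sets (space M) (range (sublevel M \<phi>))" .
  qed
qed

lemma measure_eqI_sublevel:
  assumes "real_retract M \<phi> \<psi>" "finite_measure P" "sets P = sets M" "sets Q = sets M"
    and eq: "\<And>r. emeasure P (sublevel M \<phi> r) = emeasure Q (sublevel M \<phi> r)"
  shows "P = Q"
proof (rule measure_eqI_generator_eq[where E = "range (sublevel M \<phi>)" and \<Omega> = "space M" and A = "\<lambda>i. sublevel M \<phi> (of_nat i)"])
  show "(\<Union>i. sublevel M \<phi> (of_nat i)) = space M"
    by (auto simp: sublevel_def) (meson real_arch_simple)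
  show "emeasure P (sublevel M \<phi> (of_nat i)) \<noteq> \<infinity>" for i
    using assms(2) by (simp add: finite_measure.emeasure_eq_measure)
  show "range (sublevel M \<phi>) \<subseteq> Pow (space M)"
    by (auto simp: sublevel_def)
qed (use assms sets_eq_sigma_sets_sublevel[OF assms(1)] Int_stable_sublevel in auto)

lemma measure_eqI_rect:
  assumes "finite_measure P" "sets P = sets (M \<Otimes>\<^sub>M N)" "sets Q = sets (M \<Otimes>\<^sub>M N)"
    and eq: "\<And>A C. A \<in> sets M \<Longrightarrow> C \<in> sets N \<Longrightarrow> emeasure P (A \<times> C) = emeasure Q (A \<times> C)"
  shows "P = Q"
proof (rule measure_eqI_generator_eq[where E = "{a \<times> b | a b. a \<in> sets M \<and> b \<in> sets N}"
      and \<Omega> = "space M \<times> space N" and A = "\<lambda>i. space M \<times> space N"])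
  show "emeasure P (space M \<times> space N) \<noteq> \<infinity>"
    using assms(1) by (simp add: finite_measure.emeasure_eq_measure)
qed (use assms Int_stable_pair_measure_generator[of M N] sets.space_closed in
    \<open>auto simp: sets_pair_measure space_pair_measure dest: sets.sets_into_space\<close>)

text \<open>The uniqueness theorem for one factor is applied twice: with the second side a sublevel
  set, the mass is a measure in the first side, which frees the first side; then the roles are
  exchanged.\<close>

lemma measure_eqI_rect_sublevel:
  assumes M: "real_retract M \<phi> \<psi>" and N: "real_retract N \<phi>' \<psi>'"
    and fin: "finite_measure P" "finite_measure Q"
    and P: "sets P = sets (M \<Otimes>\<^sub>M N)" and Q: "sets Q = sets (M \<Otimes>\<^sub>M N)"
    and eq: "\<And>r s. emeasure P (sublevel M \<phi> r \<times> sublevel N \<phi>' s) = emeasure Q (sublevel M \<phi> r \<times> sublevel N \<phi>' s)"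
  shows "P = Q"
proof (rule measure_eqI_rect[OF fin(1) P Q])
  note [measurable] = real_retractD(1)[OF M] real_retractD(1)[OF N]
  have [measurable_cong]: "sets P = sets (M \<Otimes>\<^sub>M N)" "sets Q = sets (M \<Otimes>\<^sub>M N)" by fact+
  have sp: "space P = space M \<times> space N" "space Q = space M \<times> space N"
    using P Q by (auto dest!: sets_eq_imp_space_eq simp: space_pair_measure)
  \<comment> \<open>Restriction followed by projection makes the mass of \<open>A \<times> C\<close>
    a measure in \<open>A\<close> alone, and in the next line in \<open>C\<close> alone.\<close>
  let ?r = "\<lambda>P C. distr (restrict_space P (space M \<times> C)) M fst"
  let ?s = "\<lambda>P A. distr (restrict_space P (A \<times> space N)) N snd"
  have m: "fst \<in> restrict_space P S \<rightarrow>\<^sub>M M" "snd \<in> restrict_space P S \<rightarrow>\<^sub>M N"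
          "fst \<in> restrict_space Q S \<rightarrow>\<^sub>M M" "snd \<in> restrict_space Q S \<rightarrow>\<^sub>M N" for S
    by (auto intro!: measurable_restrict_space1)
  have er: "emeasure (?r L C) A = emeasure L (A \<times> C)"
    if "L \<in> {P, Q}" "A \<in> sets M" "C \<in> sets N" for L A C
  proof -
    have "fst -` A \<inter> (space M \<times> C) = A \<times> C" "(space M \<times> C) \<inter> (space M \<times> space N) = space M \<times> C"
      using sets.sets_into_space[OF that(2)] sets.sets_into_space[OF that(3)] by auto
    moreover have "space M \<times> C \<in> sets L" "A \<times> space N \<in> sets L" "space L = space M \<times> space N"
      "A \<times> C \<subseteq> space M \<times> C" "A \<times> C \<subseteq> A \<times> space N"
      using that P Q sp sets.sets_into_space[OF that(2)] sets.sets_into_space[OF that(3)] by auto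
    ultimately show ?thesis using that m
      by (auto simp: emeasure_distr emeasure_restrict_space space_restrict_space)
  qed
  have es: "emeasure (?s L A) C = emeasure L (A \<times> C)"
    if "L \<in> {P, Q}" "A \<in> sets M" "C \<in> sets N" for L A C
  proof -
    have "snd -` C \<inter> (A \<times> space N) = A \<times> C" "(A \<times> space N) \<inter> (space M \<times> space N) = A \<times> space N"
      using sets.sets_into_space[OF that(2)] sets.sets_into_space[OF that(3)] by auto
    moreover have "space M \<times> C \<in> sets L" "A \<times> space N \<in> sets L" "space L = space M \<times> space N"
      "A \<times> C \<subseteq> space M \<times> C" "A \<times> C \<subseteq> A \<times> space N"
      using that P Q sp sets.sets_into_space[OF that(2)] sets.sets_into_space[OF that(3)] by auto
    ultimately show ?thesis using that m
      by (auto simp: emeasure_distr emeasure_restrict_space space_restrict_space)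
  qed
  have fr: "finite_measure (?r P C)" if "C \<in> sets N" for C
    using fin(1) er[of P "space M" C] that
    by (auto intro!: finite_measureI simp: finite_measure.emeasure_eq_measure)
  have fs: "finite_measure (?s P A)" if "A \<in> sets M" for A
    using fin(1) es[of P A "space N"] that
    by (auto intro!: finite_measureI simp: finite_measure.emeasure_eq_measure)
  have 1: "emeasure P (A \<times> sublevel N \<phi>' s) = emeasure Q (A \<times> sublevel N \<phi>' s)" if A: "A \<in> sets M" for A s
  proof -
    have "?r P (sublevel N \<phi>' s) = ?r Q (sublevel N \<phi>' s)"
      by (rule measure_eqI_sublevel[OF M fr]) (simp_all add: er eq)
    then show ?thesis using er[of P A "sublevel N \<phi>' s"] er[of Q A "sublevel N \<phi>' s"] A by simp
  qed
  fix A C assume AC: "A \<in> sets M" "C \<in> sets N"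
  have "?s P A = ?s Q A"
    by (rule measure_eqI_sublevel[OF N fs]) (simp_all add: es AC 1)
  then show "emeasure P (A \<times> C) = emeasure Q (A \<times> C)"
    using es[of P A C] es[of Q A C] AC by simp
qed


section \<open>Marginals of a coupling\<close>

context
  fixes J :: "('a \<times> 'b) measure" and M :: "'a measure" and N :: "'b measure"
  assumes sJ: "sets J = sets (M \<Otimes>\<^sub>M N)"
begin

lemma space_coupling: "space J = space M \<times> space N"
  using sets_eq_imp_space_eq[OF sJ] by (simp add: space_pair_measure)

lemma measure_distr_fst:
  assumes "A \<in> sets M" shows "measure (distr J M fst) A = measure J (A \<times> space N)"
  using assms sets.sets_into_space[OF assms] measurable_cong_sets[OF sJ refl, of M]
  by (subst measure_distr) (auto simp: space_coupling intro!: arg_cong[where f = "measure J"])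

lemma measure_distr_snd:
  assumes "C \<in> sets N" shows "measure (distr J N snd) C = measure J (space M \<times> C)"
  using assms sets.sets_into_space[OF assms] measurable_cong_sets[OF sJ refl, of N]
  by (subst measure_distr) (auto simp: space_coupling intro!: arg_cong[where f = "measure J"])

lemma distr_fst_eqI:
  assumes J: "prob_space J" and M: "prob_space M"
    and eq: "\<And>A. A \<in> sets M \<Longrightarrow> measure J (A \<times> space N) = measure M A"
  shows "distr J M fst = M"
proof (rule measure_eqI)
  have "fst \<in> J \<rightarrow>\<^sub>M M" using measurable_cong_sets[OF sJ refl, of M] by simp
  then have D: "finite_measure (distr J M fst)"
    using J by (intro finite_measure.finite_measure_distr) (simp_all add: prob_space_def)
  fix A assume "A \<in> sets (distr J M fst)"
  then show "emeasure (distr J M fst) A = emeasure M A"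
    using M eq measure_distr_fst
    by (simp add: finite_measure.emeasure_eq_measure[OF D] finite_measure.emeasure_eq_measure prob_space_def)
qed simp

lemma distr_snd_eqI:
  assumes J: "prob_space J" and N: "prob_space N"
    and eq: "\<And>C. C \<in> sets N \<Longrightarrow> measure J (space M \<times> C) = measure N C"
  shows "distr J N snd = N"
proof (rule measure_eqI)
  have "snd \<in> J \<rightarrow>\<^sub>M N" using measurable_cong_sets[OF sJ refl, of N] by simp
  then have D: "finite_measure (distr J N snd)"
    using J by (intro finite_measure.finite_measure_distr) (simp_all add: prob_space_def)
  fix C assume "C \<in> sets (distr J N snd)"
  then show "emeasure (distr J N snd) C = emeasure N C"
    using N eq measure_distr_snd
    by (simp add: finite_measure.emeasure_eq_measure[OF D] finite_measure.emeasure_eq_measure prob_space_def)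
qed simp

end

section \<open>Set functions dominated by a finite measure\<close>

lemma dominated_additive_measure:
  fixes b :: "'a set \<Rightarrow> real"
  assumes P: "finite_measure P"
    and b: "\<And>A. A \<in> sets P \<Longrightarrow> 0 \<le> b A" "\<And>A. A \<in> sets P \<Longrightarrow> b A \<le> measure P A"
    and add: "\<And>A A'. A \<in> sets P \<Longrightarrow> A' \<in> sets P \<Longrightarrow> A \<inter> A' = {} \<Longrightarrow> b (A \<union> A') = b A + b A'"
  shows "\<exists>\<mu>. sets \<mu> = sets P \<and> (\<forall>A\<in>sets P. emeasure \<mu> A = ennreal (b A))"
proof -
  interpret finite_measure P by fact
  have pos: "positive (sets P) (\<lambda>A. ennreal (b A))"
    using b[of "{}"] by (auto simp: positive_def)
  have "additive (sets P) (\<lambda>A. ennreal (b A))"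
    using add b by (auto simp: additive_def simp flip: ennreal_plus)
  then have ca: "countably_additive (sets P) (\<lambda>A. ennreal (b A))"
  proof (rule sets.empty_continuous_imp_countably_additive[OF pos])
    fix A :: "nat \<Rightarrow> 'a set" assume A: "range A \<subseteq> sets P" "decseq A" "(\<Inter>i. A i) = {}"
    \<comment> \<open>Domination supplies continuity at the empty set, and this upgrades finite
      additivity to countable additivity.\<close>
    have "(\<lambda>i. measure P (A i)) \<longlonglongrightarrow> 0"
      using finite_Lim_measure_decseq[OF A(1,2)] A(3) by simp
    moreover have "norm (b (A i)) \<le> measure P (A i)" for i
      using A(1) b[of "A i"] by auto
    ultimately have "(\<lambda>i. b (A i)) \<longlonglongrightarrow> 0"
      by (intro Lim_null_comparison[of "\<lambda>i. b (A i)" "\<lambda>i. measure P (A i)"] always_eventually allI)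
    then show "(\<lambda>i. ennreal (b (A i))) \<longlonglongrightarrow> 0"
      by (metis tendsto_ennrealI ennreal_0)
  qed auto
  show ?thesis
    using emeasure_measure_of_sigma[OF sets.sigma_algebra_axioms pos ca]
    by (intro exI[of _ "measure_of (space P) (sets P) (\<lambda>A. ennreal (b A))"]) auto
qed

lemma dominated_additive_density:
  fixes b :: "'a set \<Rightarrow> real"
  assumes P: "finite_measure P"
    and b: "\<And>A. A \<in> sets P \<Longrightarrow> 0 \<le> b A" "\<And>A. A \<in> sets P \<Longrightarrow> b A \<le> measure P A"
    and add: "\<And>A A'. A \<in> sets P \<Longrightarrow> A' \<in> sets P \<Longrightarrow> A \<inter> A' = {} \<Longrightarrow> b (A \<union> A') = b A + b A'"
  shows "\<exists>f\<in>borel_measurable P. (\<forall>x. 0 \<le> f x \<and> f x \<le> 1) \<and>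
    (\<forall>A\<in>sets P. b A = (\<integral>x. indicator A x * f x \<partial>P))"
proof -
  interpret finite_measure P by fact
  have "\<exists>\<mu>. sets \<mu> = sets P \<and> (\<forall>A\<in>sets P. emeasure \<mu> A = ennreal (b A))"
    by (rule dominated_additive_measure[OF P]) (fact b add)+
  then obtain \<mu> where \<mu>: "sets \<mu> = sets P" "\<And>A. A \<in> sets P \<Longrightarrow> emeasure \<mu> A = ennreal (b A)"
    by blast
  have "absolutely_continuous P \<mu>"
  proof (unfold absolutely_continuous_def, safe)
    fix A assume A: "A \<in> null_sets P"
    then have "b A = 0" using b[of A] by (auto simp: null_sets_def emeasure_eq_measure)
    then show "A \<in> null_sets \<mu>" using A \<mu> by (auto simp: null_sets_def)
  qed
  then obtain f where f[measurable]: "f \<in> borel_measurable P" and d: "density P f = \<mu>"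
    using Radon_Nikodym[OF _ \<mu>(1)] by auto
  have int: "(\<integral>\<^sup>+x. f x * indicator A x \<partial>P) = ennreal (b A)" if "A \<in> sets P" for A
    using that \<mu>(2)[OF that] by (simp flip: d add: emeasure_density)
  have le1: "AE x in P. f x \<le> 1"
  proof -
    let ?A = "{x\<in>space P. 1 < f x}"
    \<comment> \<open>If the density exceeded 1 on a set of positive measure, its integral over
      \<open>?A\<close> would be larger than the mass of \<open>?A\<close>, against the
      domination.\<close>
    have "AE x in P. f x * indicator ?A x \<le> indicator ?A x"
    proof (rule ccontr)
      assume "\<not> ?thesis"
      then have "(\<integral>\<^sup>+x. indicator ?A x \<partial>P) < (\<integral>\<^sup>+x. f x * indicator ?A x \<partial>P)"
        by (intro nn_integral_less) (simp_all add: emeasure_eq_measure, auto simp: less_imp_le indicator_def)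
      then show False
        using int[of ?A] b(2)[of ?A] by (simp add: emeasure_eq_measure ennreal_leI flip: not_le)
    qed
    then show ?thesis
      using AE_space
    proof eventually_elim
      case (elim x)
      then show ?case by (cases "1 < f x") (auto simp: indicator_def)
    qed
  qed
  \<comment> \<open>The truncation changes \<open>f\<close> on a null set only and makes the bounds
    hold at every point.\<close>
  define g where "g x = min 1 (enn2real (f x))" for x
  have g[measurable]: "g \<in> borel_measurable P" unfolding g_def by measurable
  have g01: "0 \<le> g x" "g x \<le> 1" for x by (auto simp: g_def)
  have fg: "AE x in P. f x = ennreal (g x)"
    using le1
  proof eventually_elim
    case (elim x)
    then have "f x \<noteq> \<top>" by (auto simp: top_unique)
    moreover have "enn2real (f x) \<le> 1" using elim by (simp add: enn2real_leI)
    ultimately show ?case by (simp add: g_def min_def ennreal_enn2real_if)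
  qed
  have "b A = (\<integral>x. indicator A x * g x \<partial>P)" if A: "A \<in> sets P" for A
  proof -
    have "ennreal (b A) = (\<integral>\<^sup>+x. ennreal (indicator A x * g x) \<partial>P)"
      unfolding int[OF A, symmetric]
      by (rule nn_integral_cong_AE, rule AE_mp[OF fg]) (auto simp: indicator_def)
    also have "\<dots> = ennreal (\<integral>x. indicator A x * g x \<partial>P)"
      using A g01 by (intro nn_integral_eq_integral integrable_const_bound[where B=1])
        (auto intro!: AE_I2 mult_le_one simp: abs_mult split: split_indicator)
    finally show ?thesis
      using b(1)[OF A] g01 by (simp add: integral_nonneg_AE)
  qed
  then show ?thesis using g g01 by blast
qed


lemma AE_le_if_set_integral_le:
  fixes f g :: "'a \<Rightarrow> real"
  assumes [measurable]: "integrable P f" "integrable P g"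
    and le: "\<And>A. A \<in> sets P \<Longrightarrow> (\<integral>x. indicator A x * f x \<partial>P) \<le> (\<integral>x. indicator A x * g x \<partial>P)"
  shows "AE x in P. f x \<le> g x"
proof -
  let ?A = "{x\<in>space P. g x < f x}"
  have [measurable]: "f \<in> borel_measurable P" "g \<in> borel_measurable P" using assms by auto
  have A: "?A \<in> sets P" by measurable
  have i: "integrable P (\<lambda>x. indicator ?A x * f x)" "integrable P (\<lambda>x. indicator ?A x * g x)"
    using integrable_real_mult_indicator[OF A assms(1)] integrable_real_mult_indicator[OF A assms(2)]
    by (simp_all add: mult.commute)
  have nn: "AE x in P. 0 \<le> indicator ?A x * f x - indicator ?A x * g x"
    by (auto simp: indicator_def)
  have "(\<integral>x. indicator ?A x * f x - indicator ?A x * g x \<partial>P) = 0"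
    using le[OF A] i integral_nonneg_AE[OF nn] by simp
  then have "AE x in P. indicator ?A x * f x - indicator ?A x * g x = 0"
    using integral_nonneg_eq_0_iff_AE[OF Bochner_Integration.integrable_diff[OF i] nn] by simp
  then show ?thesis
    using AE_space
  proof eventually_elim
    case (elim x)
    then show ?case by (cases "g x < f x") (auto simp: indicator_def)
  qed
qed

lemma AE_eq_if_set_integral_eq:
  fixes f g :: "'a \<Rightarrow> real"
  assumes "integrable P f" "integrable P g"
    and "\<And>A. A \<in> sets P \<Longrightarrow> (\<integral>x. indicator A x * f x \<partial>P) = (\<integral>x. indicator A x * g x \<partial>P)"
  shows "AE x in P. f x = g x"
  using AE_le_if_set_integral_le[of P f g] AE_le_if_set_integral_le[of P g f] assms
  by (auto intro: order_antisym elim!: AE_mp)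

section \<open>Kernels from bimeasures\<close>

lemma prob_kernelD:
  assumes "k \<in> P \<rightarrow>\<^sub>M prob_algebra N" "x \<in> space P"
  shows "prob_space (k x)" "sets (k x) = sets N" "space (k x) = space N"
  using measurable_space[OF assms] by (auto simp: space_prob_algebra dest: sets_eq_imp_space_eq)

lemma integrable_kernel:
  assumes "finite_measure P" and k [measurable]: "k \<in> P \<rightarrow>\<^sub>M prob_algebra N"
    and [measurable]: "A \<in> sets P" "C \<in> sets N"
  shows "integrable P (\<lambda>x. measure (k x) C)" "integrable P (\<lambda>x. indicator A x * measure (k x) C)"
proof -
  interpret finite_measure P by fact
  have le: "measure (k x) C \<le> 1" if "x \<in> space P" for x
    using prob_space.prob_le_1[OF prob_kernelD(1)[OF k that]] .
  show "integrable P (\<lambda>x. measure (k x) C)"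
    using le by (intro integrable_const_bound[where B=1]) auto
  show "integrable P (\<lambda>x. indicator A x * measure (k x) C)"
    using le by (intro integrable_const_bound[where B=1]) (auto simp: indicator_def)
qed

lemma nn_integral_kernel:
  assumes "finite_measure P" and k [measurable]: "k \<in> P \<rightarrow>\<^sub>M prob_algebra N"
    and [measurable]: "A \<in> sets P" "C \<in> sets N"
  shows "(\<integral>\<^sup>+x. indicator A x * emeasure (k x) C \<partial>P) = ennreal (\<integral>x. indicator A x * measure (k x) C \<partial>P)"
proof -
  have "(\<integral>\<^sup>+x. indicator A x * emeasure (k x) C \<partial>P) = (\<integral>\<^sup>+x. ennreal (indicator A x * measure (k x) C) \<partial>P)"
    using prob_kernelD(1)[OF k]
    by (intro nn_integral_cong) (auto simp: indicator_def finite_measure.emeasure_eq_measure prob_space_def)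
  then show ?thesis
    using integrable_kernel[OF assms] by (simp add: nn_integral_eq_integral)
qed

text \<open>A coupling as seen on rectangles. Only finite additivity in each side is demanded; the
  upper bounds by the marginals replace countable additivity. All clauses are closed conditions on
  finitely many values, so they survive pointwise limits along a filter.\<close>

definition bimeasure :: "'p measure \<Rightarrow> 'a measure \<Rightarrow> ('p set \<Rightarrow> 'a set \<Rightarrow> real) \<Rightarrow> bool" where
  "bimeasure P N a \<longleftrightarrow>
     (\<forall>A\<in>sets P. \<forall>C\<in>sets N. 0 \<le> a A C \<and> a A C \<le> measure P A \<and> a A C \<le> measure N C) \<and>
     (\<forall>A\<in>sets P. \<forall>A'\<in>sets P. \<forall>C\<in>sets N. A \<inter> A' = {} \<longrightarrow> a (A \<union> A') C = a A C + a A' C) \<and>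
     (\<forall>A\<in>sets P. \<forall>C\<in>sets N. \<forall>C'\<in>sets N. C \<inter> C' = {} \<longrightarrow> a A (C \<union> C') = a A C + a A C') \<and>
     a (space P) (space N) = 1"

lemma bimeasureD:
  assumes "bimeasure P N a" "A \<in> sets P" "C \<in> sets N"
  shows "0 \<le> a A C" "a A C \<le> measure P A" "a A C \<le> measure N C"
    "\<And>A'. A' \<in> sets P \<Longrightarrow> A \<inter> A' = {} \<Longrightarrow> a (A \<union> A') C = a A C + a A' C"
    "\<And>C'. C' \<in> sets N \<Longrightarrow> C \<inter> C' = {} \<Longrightarrow> a A (C \<union> C') = a A C + a A C'"
  using assms by (auto simp: bimeasure_def)

text \<open>A deficit on a set would have to be made up on its complement, where the upper bound
  leaves no room, since the total mass is 1.\<close>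

lemma bimeasure_marginals:
  assumes a: "bimeasure P N a" and P: "prob_space P" and N: "prob_space N"
  shows "A \<in> sets P \<Longrightarrow> a A (space N) = measure P A"
    and "C \<in> sets N \<Longrightarrow> a (space P) C = measure N C"
proof -
  show "a A (space N) = measure P A" if A: "A \<in> sets P"
  proof -
    have "a (A \<union> (space P - A)) (space N) = a A (space N) + a (space P - A) (space N)"
      using A by (intro bimeasureD(4)[OF a]) auto
    moreover have "A \<union> (space P - A) = space P" using sets.sets_into_space[OF A] by auto
    moreover have "a (space P - A) (space N) \<le> 1 - measure P A"
      using bimeasureD(2)[OF a, of "space P - A" "space N"] A by (simp add: prob_space.prob_compl[OF P])
    ultimately show ?thesis using a bimeasureD(2)[OF a A, of "space N"] by (simp add: bimeasure_def)
  qed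
  show "a (space P) C = measure N C" if C: "C \<in> sets N"
  proof -
    have "a (space P) (C \<union> (space N - C)) = a (space P) C + a (space P) (space N - C)"
      using C by (intro bimeasureD(5)[OF a]) auto
    moreover have "C \<union> (space N - C) = space N" using sets.sets_into_space[OF C] by auto
    moreover have "a (space P) (space N - C) \<le> 1 - measure N C"
      using bimeasureD(3)[OF a, of "space P" "space N - C"] C by (simp add: prob_space.prob_compl[OF N])
    ultimately show ?thesis using a bimeasureD(3)[OF a _ C, of "space P"] by (simp add: bimeasure_def)
  qed
qed

text \<open>Monotone data at rational points become a distribution function. Taking the infimum over
  rationals strictly above \<open>r\<close> is what yields right continuity; the last two
  conclusions sandwich \<open>G\<close> between values of \<open>h\<close> and allow integrals of
  \<open>G\<close> to be compared with those of \<open>h\<close>.\<close>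

lemma right_continuous_INF_rat:
  fixes h :: "rat \<Rightarrow> real"
  assumes mono: "\<And>q q'. q \<le> q' \<Longrightarrow> h q \<le> h q'" and h01: "\<And>q. 0 \<le> h q" "\<And>q. h q \<le> 1"
    and top: "(SUP n::nat. h (of_nat n)) = 1" and bot: "(INF n::nat. h (- of_nat n)) = 0"
    and G_def: "\<And>r. G r = (INF q\<in>{q. r < real_of_rat q}. h q)"
  shows "\<And>r s. r \<le> s \<Longrightarrow> G r \<le> G s" "\<And>r. continuous (at_right r) G"
    "(G \<longlongrightarrow> 0) at_bot" "(G \<longlongrightarrow> 1) at_top"
    "\<And>q r. r < real_of_rat q \<Longrightarrow> G r \<le> h q" "\<And>q r. real_of_rat q \<le> r \<Longrightarrow> h q \<le> G r"
proof -
  have ne: "{q. r < real_of_rat q} \<noteq> {}" for r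
    using of_rat_dense[of r "r + 1"] by auto
  have bdd: "bdd_below (h ` S)" for S by (rule bdd_belowI[of _ 0]) (use h01 in auto)
  show up: "G r \<le> h q" if "r < real_of_rat q" for q r
    unfolding G_def using that by (intro cINF_lower bdd) auto
  show lo: "h q \<le> G r" if "real_of_rat q \<le> r" for q r
    unfolding G_def using that by (intro cINF_greatest ne mono) (auto simp: of_rat_less less_imp_le intro: mono dest: order_le_less_trans)
  show m: "G r \<le> G s" if "r \<le> s" for r s
    unfolding G_def using that by (intro cINF_superset_mono ne bdd) auto
  have G0: "0 \<le> G r" for r unfolding G_def by (intro cINF_greatest ne h01)
  have G1: "G r \<le> 1" for r
    using ne[of r] up[of r] h01(2) by (auto intro: order_trans)
  show "continuous (at_right r) G" for r
    unfolding continuous_within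
  proof (rule order_tendstoI)
    fix a assume "a < G r"
    then show "\<forall>\<^sub>F x in at_right r. a < G x"
      unfolding eventually_at_filter
      by (intro always_eventually) (meson m less_le_trans less_imp_le greaterThan_iff)
  next
    fix a assume "G r < a"
    then obtain q where q: "r < real_of_rat q" "h q < a"
      unfolding G_def using cINF_less_iff[OF ne bdd] by auto
    then have "G x < a" if "r < x" "x < real_of_rat q" for x
      using up[OF that(2)] by auto
    then show "\<forall>\<^sub>F x in at_right r. G x < a"
      using q(1) by (auto simp: eventually_at_right)
  qed
  show "(G \<longlongrightarrow> 0) at_bot"
  proof (rule order_tendstoI)
    fix a :: real assume "a < 0"
    then show "\<forall>\<^sub>F x in at_bot. a < G x" by (intro always_eventually allI) (meson G0 less_le_trans)
  next
    fix a :: real assume "0 < a"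
    then obtain n where n: "h (- of_nat n) < a"
      using bot cINF_less_iff[of UNIV "\<lambda>n::nat. h (- of_nat n)" a] bdd[of "range (\<lambda>n::nat. - of_nat n)"]
      by (auto simp: image_image)
    have "G x < a" if "x < real_of_rat (- of_nat n)" for x using up[OF that] n by auto
    then show "\<forall>\<^sub>F x in at_bot. G x < a"
      unfolding eventually_at_bot_dense by blast
  qed
  show "(G \<longlongrightarrow> 1) at_top"
  proof (rule order_tendstoI)
    fix a :: real assume "1 < a"
    then show "\<forall>\<^sub>F x in at_top. G x < a" by (intro always_eventually allI) (meson G1 le_less_trans)
  next
    fix a :: real assume a: "a < 1"
    have "bdd_above (range (\<lambda>n::nat. h (of_nat n)))" by (rule bdd_aboveI[of _ 1]) (use h01 in auto)
    then obtain n where n: "a < h (of_nat n)"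
      using top a less_cSUP_iff[of UNIV "\<lambda>n::nat. h (of_nat n)" a] by auto
    have "a < G x" if "real_of_rat (of_nat n) \<le> x" for x using lo[OF that] n by auto
    then show "\<forall>\<^sub>F x in at_top. a < G x"
      unfolding eventually_at_top_linorder by blast
  qed
qed

text \<open>The conditional distribution function at \<open>x\<close> is the right-continuous regularisation of the
  densities of \<open>a (\<cdot>) {..q}\<close> for rational \<open>q\<close>.\<close>

lemma bimeasure_kernel_real:
  fixes a :: "'p set \<Rightarrow> real set \<Rightarrow> real"
  assumes P: "prob_space P" and \<nu>: "real_distribution \<nu>" and a: "bimeasure P \<nu> a"
  shows "\<exists>k \<in> P \<rightarrow>\<^sub>M prob_algebra borel. \<forall>A\<in>sets P. \<forall>C\<in>sets borel.
    a A C = (\<integral>x. indicator A x * measure (k x) C \<partial>P)"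
proof -
  interpret P: prob_space P by fact
  interpret \<nu>: real_distribution \<nu> by fact
  note marg = bimeasure_marginals[OF a P \<nu>.prob_space_axioms]
  note aD = bimeasureD[OF a]
  have [simp]: "sets \<nu> = sets borel" "space \<nu> = UNIV" by auto
  let ?I = "\<lambda>q::rat. {..real_of_rat q}"
  have "\<exists>f\<in>borel_measurable P. (\<forall>x. 0 \<le> f x \<and> f x \<le> 1) \<and>
    (\<forall>A\<in>sets P. a A (?I q) = (\<integral>x. indicator A x * f x \<partial>P))" for q
    by (rule dominated_additive_density[OF P.finite_measure_axioms]) (simp_all add: aD(1,2), rule aD(4), simp_all)
  then obtain f where f [measurable]: "\<And>q. f q \<in> borel_measurable P"
    and f01: "\<And>q x. 0 \<le> f q x" "\<And>q x. f q x \<le> 1"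
    and fa: "\<And>q A. A \<in> sets P \<Longrightarrow> a A (?I q) = (\<integral>x. indicator A x * f q x \<partial>P)"
    by metis
  have fi: "integrable P (f q)" for q
    using f01 by (intro P.integrable_const_bound[where B=1]) auto
  have ma: "a A C \<le> a A C'" if "A \<in> sets P" "C \<in> sets borel" "C' \<in> sets borel" "C \<subseteq> C'" for A C C'
    using aD(5)[of A C "C' - C"] aD(1)[of A "C' - C"] that by (simp add: Un_absorb1)
  have mono: "AE x in P. f q x \<le> f q' x" if "q \<le> q'" for q q'
    using that by (intro AE_le_if_set_integral_le fi) (auto simp: fa[symmetric] of_rat_less_eq intro!: ma)
  let ?s = "\<lambda>x. SUP n::nat. f (of_nat n) x" and ?i = "\<lambda>x. INF n::nat. f (- of_nat n) x"
  have bdd: "bdd_above (range (\<lambda>n::nat. f (of_nat n) x))" "bdd_below (range (\<lambda>n::nat. f (- of_nat n) x))" for x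
    by (rule bdd_aboveI[of _ 1], use f01 in auto)[1] (rule bdd_belowI[of _ 0], use f01 in auto)
  have s_m [measurable]: "?s \<in> borel_measurable P" and i_m [measurable]: "?i \<in> borel_measurable P"
    using bdd by (auto intro!: borel_measurable_cSUP borel_measurable_cINF)
  have s_le: "?s x \<le> 1" and i_ge: "0 \<le> ?i x" and s_ge: "f (of_nat n) x \<le> ?s x" and i_le: "?i x \<le> f (- of_nat n) x" for n x
    using f01 bdd by (auto intro!: cSUP_least cINF_greatest cSUP_upper cINF_lower)
  have s_i: "integrable P ?s"
    using s_le order_trans[OF f01(1) s_ge] by (intro P.integrable_const_bound[where B=1]) auto
  have i_i: "integrable P ?i"
    using i_ge order_trans[OF i_le f01(2)] by (intro P.integrable_const_bound[where B=1]) auto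
  have ff: "(\<integral>x. f q x \<partial>P) = cdf \<nu> (of_rat q)" for q
  proof -
    have "(\<integral>x. f q x \<partial>P) = (\<integral>x. indicator (space P) x * f q x \<partial>P)"
      by (intro Bochner_Integration.integral_cong) auto
    then show ?thesis using marg(2)[of "?I q"] fa[of "space P" q] by (simp add: cdf_def)
  qed
  have s1: "AE x in P. ?s x = 1"
  proof -
    \<comment> \<open>The integral of the supremum dominates every \<open>cdf \<nu> n\<close>, and
      these tend to 1. As \<open>?s\<close> never exceeds 1, it equals 1 almost everywhere. The
      infimum at minus infinity is treated in the same way.\<close>
    have "1 \<le> (\<integral>x. ?s x \<partial>P)"
    proof (rule LIMSEQ_le_const2[OF \<nu>.cdf_lim_infty_prob])
      have "cdf \<nu> (real n) \<le> (\<integral>x. ?s x \<partial>P)" for n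
        using integral_mono[OF fi s_i s_ge, of n] by (simp add: ff)
      then show "\<exists>N. \<forall>n\<ge>N. cdf \<nu> (real n) \<le> (\<integral>x. ?s x \<partial>P)" by blast
    qed
    moreover have "(\<integral>x. 1 - ?s x \<partial>P) = 1 - (\<integral>x. ?s x \<partial>P)"
      using s_i by (simp add: P.prob_space)
    moreover have "0 \<le> (\<integral>x. 1 - ?s x \<partial>P)" using s_le by (intro integral_nonneg_AE) auto
    ultimately have "(\<integral>x. 1 - ?s x \<partial>P) = 0" by linarith
    then show ?thesis
      using integral_nonneg_eq_0_iff_AE[of P "\<lambda>x. 1 - ?s x"] s_i s_le by simp
  qed
  have i0: "AE x in P. ?i x = 0"
  proof -
    have "(\<integral>x. ?i x \<partial>P) \<le> 0"
    proof (rule LIMSEQ_le_const[OF \<nu>.cdf_lim_neg_infty])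
      have "(\<integral>x. ?i x \<partial>P) \<le> cdf \<nu> (- real n)" for n
        using integral_mono[OF i_i fi i_le, of n] by (simp add: ff of_rat_minus)
      then show "\<exists>N. \<forall>n\<ge>N. (\<integral>x. ?i x \<partial>P) \<le> cdf \<nu> (- real n)" by blast
    qed
    moreover have "0 \<le> (\<integral>x. ?i x \<partial>P)" using i_ge by (intro integral_nonneg_AE) auto
    ultimately show ?thesis
      using integral_nonneg_eq_0_iff_AE[of P ?i] i_i i_ge by simp
  qed
  have "AE x in P. (\<forall>q q'. q \<le> q' \<longrightarrow> f q x \<le> f q' x) \<and> ?s x = 1 \<and> ?i x = 0"
    using s1 i0 mono by (auto simp: AE_all_countable)
  then obtain Z where Z: "Z \<in> null_sets P"
    and good: "\<And>x. x \<in> space P - Z \<Longrightarrow> (\<forall>q q'. q \<le> q' \<longrightarrow> f q x \<le> f q' x) \<and> ?s x = 1 \<and> ?i x = 0"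
    unfolding eventually_ae_filter by auto
  \<comment> \<open>Default on the exceptional null set: the distribution function of the unit mass
    at 0. With it \<open>h x\<close> satisfies the requirements for every \<open>x\<close>, so that
    \<open>k x\<close> is a probability measure everywhere.\<close>
  let ?d = "\<lambda>q::rat. if 0 \<le> q then 1 else 0 :: real"
  define h where "h x q = (if x \<in> space P - Z then f q x else ?d q)" for x q
  have d: "(INF n::nat. ?d (- of_nat n)) = 0"
  proof (rule antisym)
    show "(INF n::nat. ?d (- of_nat n)) \<le> 0"
      by (rule cINF_lower2[where x = 1]) (auto intro!: bdd_belowI[of _ 0])
    show "0 \<le> (INF n::nat. ?d (- of_nat n))"
      by (rule cINF_greatest) auto
  qed
  have h_mono: "h x q \<le> h x q'" if "q \<le> q'" for x q q'
    using good[of x] that by (auto simp: h_def)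
  have h01: "0 \<le> h x q" "h x q \<le> 1" for x q
    using f01 by (auto simp: h_def)
  have h_top: "(SUP n::nat. h x (of_nat n)) = 1" for x
    using good[of x] by (cases "x \<in> space P - Z") (simp_all only: h_def if_True if_False, auto)
  have h_bot: "(INF n::nat. h x (- of_nat n)) = 0" for x
    using good[of x] d by (cases "x \<in> space P - Z") (simp_all only: h_def if_True if_False)
  define G where "G x r = (INF q\<in>{q. r < real_of_rat q}. h x q)" for x r
  have G_mono: "G x r \<le> G x s" if "r \<le> s" for x r s
    by (rule right_continuous_INF_rat(1)[of "h x" "G x"]) (fact h_mono h01 h_top h_bot G_def that)+
  have G_cont: "continuous (at_right r) (G x)" for x r
    by (rule right_continuous_INF_rat(2)[of "h x" "G x"]) (fact h_mono h01 h_top h_bot G_def)+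
  have G_bot: "(G x \<longlongrightarrow> 0) at_bot" for x
    by (rule right_continuous_INF_rat(3)[of "h x" "G x"]) (fact h_mono h01 h_top h_bot G_def)+
  have G_top: "(G x \<longlongrightarrow> 1) at_top" for x
    by (rule right_continuous_INF_rat(4)[of "h x" "G x"]) (fact h_mono h01 h_top h_bot G_def)+
  have G_le: "G x r \<le> h x q" if "r < real_of_rat q" for x r q
    by (rule right_continuous_INF_rat(5)[of "h x" "G x"]) (fact h_mono h01 h_top h_bot G_def that)+
  have G_ge: "h x q \<le> G x r" if "real_of_rat q \<le> r" for x r q
    by (rule right_continuous_INF_rat(6)[of "h x" "G x"]) (fact h_mono h01 h_top h_bot G_def that)+
  define k where "k x = interval_measure (G x)" for x
  have kp: "real_distribution (k x)" for x
    unfolding k_def by (rule real_distribution_interval_measure) (fact G_mono G_cont G_bot G_top)+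
  have kc: "measure (k x) {..r} = G x r" for x r
    unfolding k_def by (rule measure_interval_measure_Iic) (fact G_mono G_cont G_bot G_top)+
  have [measurable]: "Z \<in> sets P" using Z by auto
  have h_m [measurable]: "(\<lambda>x. h x q) \<in> borel_measurable P" for q
    unfolding h_def by measurable
  have G_m [measurable]: "(\<lambda>x. G x r) \<in> borel_measurable P" for r
    unfolding G_def using h01(1) by (intro borel_measurable_cINF) (auto intro: bdd_belowI[of _ 0])
  have k_m: "k \<in> P \<rightarrow>\<^sub>M prob_algebra borel"
  proof (rule measurable_prob_algebra_generated[where \<Omega> = UNIV and G = "range ?I"])
    show "Int_stable (range ?I)"
      using Int_stable_sublevel[of borel id] by (simp add: sublevel_def[abs_def] atMost_def)
    show "prob_space (k x)" "sets (k x) = sets borel" for x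
      using kp[of x] by (auto simp: real_distribution_def real_distribution_axioms_def)
    fix A assume "A \<in> range ?I"
    then show "(\<lambda>x. emeasure (k x) A) \<in> borel_measurable P"
      using kp kc by (auto simp: real_distribution_def prob_space_def finite_measure.emeasure_eq_measure)
  qed (auto simp: sets_borel_rat_atMost)
  have aG: "a A (?I q) = (\<integral>x. indicator A x * G x (of_rat q) \<partial>P)" if A [measurable]: "A \<in> sets P" for A q
  proof (rule antisym)
    have hf: "AE x in P. f q x = h x q" for q
      using Z unfolding h_def by (intro AE_I'[OF Z]) auto
    have Gi: "integrable P (\<lambda>x. indicator A x * G x r)" for r
      using integrable_kernel(2)[OF P.finite_measure_axioms k_m A, of "{..r}"] by (simp add: kc)
    have fi': "integrable P (\<lambda>x. indicator A x * f q x)" for q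
      using integrable_real_mult_indicator[OF A fi] by (simp add: mult.commute)
    show "a A (?I q) \<le> (\<integral>x. indicator A x * G x (of_rat q) \<partial>P)"
      unfolding fa[OF A]
      by (rule integral_mono_AE[OF fi' Gi], rule AE_mp[OF hf[of q]])
        (rule AE_I2, simp add: indicator_def G_ge)
    \<comment> \<open>Replacing \<open>G\<close> at \<open>q\<close> by \<open>f q'\<close> with a
      larger rational \<open>q'\<close> overshoots by at most the \<open>\<nu>\<close>-mass of the
      interval from \<open>q\<close> to \<open>q'\<close>. The bound of \<open>a\<close> by its
      second marginal enters here, and right continuity of the distribution function of
      \<open>\<nu>\<close> removes the error.\<close>
    have "(\<integral>x. indicator A x * G x (of_rat q) \<partial>P) \<le> a A (?I q) + (cdf \<nu> (of_rat q') - cdf \<nu> (of_rat q))"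
      if "q < q'" for q'
    proof -
      have "(\<integral>x. indicator A x * G x (of_rat q) \<partial>P) \<le> a A (?I q')"
        unfolding fa[OF A]
        by (rule integral_mono_AE[OF Gi fi'], rule AE_mp[OF hf[of q']])
          (rule AE_I2, simp add: indicator_def G_le of_rat_less that)
      also have "a A (?I q') = a A (?I q) + a A {of_rat q<..of_rat q'}"
      proof -
        have "?I q' = ?I q \<union> {of_rat q<..of_rat q'}" "?I q \<inter> {of_rat q<..of_rat q'} = {}"
          using of_rat_less_eq[of q q', where 'a = real] that by auto
        then show ?thesis
          using aD(5)[of A "?I q" "{of_rat q<..of_rat q'}"] A by simp
      qed
      also have "a A {of_rat q<..of_rat q'} \<le> measure \<nu> {of_rat q<..of_rat q'}"
        by (rule aD(3)[OF A]) simp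
      also have "\<dots> = cdf \<nu> (of_rat q') - cdf \<nu> (of_rat q)"
        using \<nu>.cdf_diff_eq[of "of_rat q" "of_rat q'"] that by (simp add: of_rat_less)
      finally show ?thesis by simp
    qed
    note * = this
    have *: "(\<integral>x. indicator A x * G x (of_rat q) \<partial>P) \<le> a A (?I q) + (cdf \<nu> (of_rat q + inverse (real (Suc n))) - cdf \<nu> (of_rat q))" for n
      using *[of "q + inverse (of_nat (Suc n))"]
      by (simp add: of_rat_add of_rat_inverse)
    have "(\<lambda>n. cdf \<nu> (of_rat q + inverse (real (Suc n)))) \<longlonglongrightarrow> cdf \<nu> (of_rat q)"
    proof (rule filterlim_compose[OF \<nu>.cdf_is_right_cont[of "of_rat q", unfolded continuous_within]])
      show "filterlim (\<lambda>n. of_rat q + inverse (real (Suc n))) (at_right (of_rat q)) sequentially"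
        using LIMSEQ_inverse_real_of_nat_add[of "of_rat q"] by (simp add: filterlim_at)
    qed
    then have "(\<lambda>n. a A (?I q) + (cdf \<nu> (of_rat q + inverse (real (Suc n))) - cdf \<nu> (of_rat q))) \<longlonglongrightarrow> a A (?I q) + (cdf \<nu> (of_rat q) - cdf \<nu> (of_rat q))"
      by (intro tendsto_intros)
    then have "(\<lambda>n. a A (?I q) + (cdf \<nu> (of_rat q + inverse (real (Suc n))) - cdf \<nu> (of_rat q))) \<longlonglongrightarrow> a A (?I q)"
      by simp
    then show "(\<integral>x. indicator A x * G x (of_rat q) \<partial>P) \<le> a A (?I q)"
      by (rule LIMSEQ_le_const) (use * in blast)
  qed
  have "a A C = (\<integral>x. indicator A x * measure (k x) C \<partial>P)" if A [measurable]: "A \<in> sets P" and C: "C \<in> sets borel" for A C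
  proof -
    have "\<exists>\<mu>. sets \<mu> = sets \<nu> \<and> (\<forall>C\<in>sets \<nu>. emeasure \<mu> C = ennreal (a A C))"
      by (rule dominated_additive_measure[OF \<nu>.finite_measure_axioms]) (simp_all add: aD(1,3) A, rule aD(5)[OF A], simp_all)
    then obtain \<mu> where \<mu>: "sets \<mu> = sets borel" "\<And>C. C \<in> sets borel \<Longrightarrow> emeasure \<mu> C = ennreal (a A C)"
      by (auto simp del: space_borel)
    have kA: "k \<in> density P (indicator A) \<rightarrow>\<^sub>M subprob_algebra borel"
      using measurable_prob_algebraD[OF k_m] by simp
    have e: "emeasure (density P (indicator A) \<bind> k) C = ennreal (\<integral>x. indicator A x * measure (k x) C \<partial>P)"
      if "C \<in> sets borel" for C
    proof -
      have "emeasure (density P (indicator A) \<bind> k) C = (\<integral>\<^sup>+x. emeasure (k x) C \<partial>density P (indicator A))"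
        using P.not_empty that by (intro emeasure_bind[OF _ kA]) auto
      also have "\<dots> = (\<integral>\<^sup>+x. indicator A x * emeasure (k x) C \<partial>P)"
        using that measurable_prob_algebraD[OF k_m] by (intro nn_integral_density) auto
      finally show ?thesis
        using nn_integral_kernel[OF P.finite_measure_axioms k_m A that] by simp
    qed
    \<comment> \<open>For fixed \<open>A\<close> both sides are finite measures in the second
      argument, and \<open>aG\<close> says that they agree on the rational half-lines.\<close>
    have "\<mu> = density P (indicator A) \<bind> k"
    proof (rule measure_eqI_sublevel[where M = borel and \<phi> = "\<lambda>x. x" and \<psi> = "\<lambda>x. x"])
      show "real_retract borel (\<lambda>x. x) (\<lambda>x::real. x)" by (simp add: real_retract_def)
      show "finite_measure \<mu>"
        using \<mu>(2)[of UNIV] sets_eq_imp_space_eq[OF \<mu>(1)] by (auto intro!: finite_measureI)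
      show "sets (density P (indicator A) \<bind> k) = sets borel"
        using P.not_empty by (intro sets_bind_measurable[OF kA]) auto
      fix q
      have "sublevel borel (\<lambda>x. x) q = ?I q" by (auto simp: sublevel_def)
      then show "emeasure \<mu> (sublevel borel (\<lambda>x. x) q) = emeasure (density P (indicator A) \<bind> k) (sublevel borel (\<lambda>x. x) q)"
        using aG[OF A, of q] by (simp add: \<mu> e kc)
    qed (fact \<mu>)
    then have "ennreal (a A C) = ennreal (\<integral>x. indicator A x * measure (k x) C \<partial>P)"
      using \<mu>(2)[OF C] e[OF C] by simp
    then show ?thesis
      using aD(1)[OF A, of C] C by (simp add: integral_nonneg_AE)
  qed
  then show ?thesis by (intro bexI[OF _ k_m]) simp
qed

lemma bimeasure_kernel:
  assumes retr: "real_retract N \<phi> \<psi>" and P: "prob_space P" and N: "prob_space N"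
    and a: "bimeasure P N a"
  shows "\<exists>k \<in> P \<rightarrow>\<^sub>M prob_algebra N. \<forall>A\<in>sets P. \<forall>C\<in>sets N.
    a A C = (\<integral>x. indicator A x * measure (k x) C \<partial>P)"
proof -
  note [measurable] = real_retractD(1,2)[OF retr]
  interpret N: prob_space N by fact
  let ?v = "\<lambda>C. \<phi> -` C \<inter> space N"
  have v: "?v C \<in> sets N" if "C \<in> sets borel" for C
    using that by measurable
  have v_Un: "?v (C \<union> C') = ?v C \<union> ?v C'" for C C' by auto
  have "bimeasure P (distr N borel \<phi>) (\<lambda>A C. a A (?v C))"
    unfolding bimeasure_def
  proof (intro conjI ballI impI)
    fix A C assume A: "A \<in> sets P" and "C \<in> sets (distr N borel \<phi>)"
    then have C: "C \<in> sets borel" by simp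
    show "0 \<le> a A (?v C)" "a A (?v C) \<le> measure P A"
      by (rule bimeasureD(1,2)[OF a A v[OF C]])+
    show "a A (?v C) \<le> measure (distr N borel \<phi>) C"
      using bimeasureD(3)[OF a A v[OF C]] C by (simp add: measure_distr)
    show "a (A \<union> A') (?v C) = a A (?v C) + a A' (?v C)" if "A' \<in> sets P" "A \<inter> A' = {}" for A'
      by (rule bimeasureD(4)[OF a A v[OF C]]) fact+
    show "a A (?v (C \<union> C')) = a A (?v C) + a A (?v C')"
      if "C' \<in> sets (distr N borel \<phi>)" "C \<inter> C' = {}" for C'
      unfolding v_Un using that by (intro bimeasureD(5)[OF a A v[OF C]] v) auto
  next
    show "a (space P) (?v (space (distr N borel \<phi>))) = 1"
      using a by (simp add: bimeasure_def)
  qed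
  moreover have "real_distribution (distr N borel \<phi>)"
    by (intro N.real_distribution_distr) simp
  ultimately obtain k where k [measurable]: "k \<in> P \<rightarrow>\<^sub>M prob_algebra borel"
    and ka: "\<And>A C. A \<in> sets P \<Longrightarrow> C \<in> sets borel \<Longrightarrow> a A (?v C) = (\<integral>x. indicator A x * measure (k x) C \<partial>P)"
    using bimeasure_kernel_real[OF P, of "distr N borel \<phi>" "\<lambda>A C. a A (?v C)"] by blast
  have "(\<lambda>x. distr (k x) N \<psi>) \<in> P \<rightarrow>\<^sub>M prob_algebra N" by measurable
  moreover have "a A C = (\<integral>x. indicator A x * measure (distr (k x) N \<psi>) C \<partial>P)"
    if A: "A \<in> sets P" and C: "C \<in> sets N" for A C
  proof -
    have b: "\<psi> -` C \<in> sets borel"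
      using measurable_sets[OF real_retractD(2)[OF retr] C] by simp
    have "?v (\<psi> -` C) = C"
      using real_retractD(3)[OF retr] sets.sets_into_space[OF C] by force
    then have "a A C = (\<integral>x. indicator A x * measure (k x) (\<psi> -` C) \<partial>P)"
      using ka[OF A b] by simp
    also have "\<dots> = (\<integral>x. indicator A x * measure (distr (k x) N \<psi>) C \<partial>P)"
    proof (intro Bochner_Integration.integral_cong refl)
      fix x assume "x \<in> space P"
      note kx = prob_kernelD[OF k this]
      have "\<psi> \<in> k x \<rightarrow>\<^sub>M N" using measurable_cong_sets[OF kx(2) refl] real_retractD(2)[OF retr] by blast
      then show "indicator A x * measure (k x) (\<psi> -` C) = indicator A x * measure (distr (k x) N \<psi>) C"
        using kx C by (simp add: measure_distr)
    qed
    finally show ?thesis .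
  qed
  ultimately show ?thesis by (intro bexI[where x = "\<lambda>x. distr (k x) N \<psi>"]) auto
qed

section \<open>The joint law of a point and of a second point drawn from a kernel\<close>

definition semidirect :: "'p measure \<Rightarrow> 'a measure \<Rightarrow> ('p \<Rightarrow> 'a measure) \<Rightarrow> ('p \<times> 'a) measure" where
  "semidirect P N k = P \<bind> (\<lambda>x. distr (k x) (P \<Otimes>\<^sub>M N) (Pair x))"

context
  fixes P :: "'p measure" and N :: "'a measure" and k
  assumes P: "prob_space P" and k [measurable]: "k \<in> P \<rightarrow>\<^sub>M prob_algebra N"
begin

lemma P_in_prob_algebra: "P \<in> space (prob_algebra P)"
  using P by (simp add: space_prob_algebra)

lemma semidirect_kernel [measurable]:
  "(\<lambda>x. distr (k x) (P \<Otimes>\<^sub>M N) (Pair x)) \<in> P \<rightarrow>\<^sub>M prob_algebra (P \<Otimes>\<^sub>M N)"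
  by measurable

lemma sets_semidirect [measurable_cong]: "sets (semidirect P N k) = sets (P \<Otimes>\<^sub>M N)"
  unfolding semidirect_def by (rule sets_bind'[OF P_in_prob_algebra semidirect_kernel])

lemma prob_space_semidirect: "prob_space (semidirect P N k)"
  unfolding semidirect_def by (rule prob_space_bind'[OF P_in_prob_algebra semidirect_kernel])

lemma Pair_measurable_kernel: "x \<in> space P \<Longrightarrow> Pair x \<in> k x \<rightarrow>\<^sub>M P \<Otimes>\<^sub>M N"
  using prob_kernelD(2)[OF k, of x] by (subst measurable_cong_sets[OF _ refl]) auto

lemma nn_integral_semidirect:
  assumes [measurable]: "f \<in> borel_measurable (P \<Otimes>\<^sub>M N)"
  shows "(\<integral>\<^sup>+w. f w \<partial>semidirect P N k) = (\<integral>\<^sup>+x. \<integral>\<^sup>+y. f (x, y) \<partial>k x \<partial>P)"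
proof -
  have "(\<integral>\<^sup>+w. f w \<partial>semidirect P N k) = (\<integral>\<^sup>+x. \<integral>\<^sup>+w. f w \<partial>distr (k x) (P \<Otimes>\<^sub>M N) (Pair x) \<partial>P)"
    unfolding semidirect_def
    by (rule nn_integral_bind[OF _ measurable_prob_algebraD[OF semidirect_kernel]]) simp
  also have "\<dots> = (\<integral>\<^sup>+x. \<integral>\<^sup>+y. f (x, y) \<partial>k x \<partial>P)"
    by (intro nn_integral_cong nn_integral_distr Pair_measurable_kernel) auto
  finally show ?thesis .
qed

lemma AE_semidirect:
  assumes [measurable]: "Measurable.pred (P \<Otimes>\<^sub>M N) Q"
  shows "(AE w in semidirect P N k. Q w) \<longleftrightarrow> (AE x in P. AE y in k x. Q (x, y))"
proof -
  have "(AE w in semidirect P N k. Q w) \<longleftrightarrow> (AE x in P. AE w in distr (k x) (P \<Otimes>\<^sub>M N) (Pair x). Q w)"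
    unfolding semidirect_def
    by (rule AE_bind[OF measurable_prob_algebraD[OF semidirect_kernel]]) simp
  also have "\<dots> \<longleftrightarrow> (AE x in P. AE y in k x. Q (x, y))"
    by (rule AE_cong) (auto simp: AE_distr_iff Pair_measurable_kernel)
  finally show ?thesis .
qed

lemma measure_semidirect:
  assumes [measurable]: "A \<in> sets P" "C \<in> sets N"
  shows "measure (semidirect P N k) (A \<times> C) = (\<integral>x. indicator A x * measure (k x) C \<partial>P)"
proof -
  interpret P: prob_space P by (rule P)
  have "emeasure (semidirect P N k) (A \<times> C) = (\<integral>\<^sup>+w. indicator (A \<times> C) w \<partial>semidirect P N k)"
    by (simp add: sets_semidirect)
  also have "\<dots> = (\<integral>\<^sup>+x. \<integral>\<^sup>+y. indicator (A \<times> C) (x, y) \<partial>k x \<partial>P)"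
    by (rule nn_integral_semidirect) simp
  also have "\<dots> = (\<integral>\<^sup>+x. indicator A x * emeasure (k x) C \<partial>P)"
    using prob_kernelD(2)[OF k]
    by (intro nn_integral_cong) (simp add: indicator_times nn_integral_cmult nn_integral_cmult_indicator)
  also have "\<dots> = ennreal (\<integral>x. indicator A x * measure (k x) C \<partial>P)"
    by (rule nn_integral_kernel[OF P.finite_measure_axioms k]) auto
  finally show ?thesis
    unfolding measure_def by (subst enn2real_ennreal[symmetric]) (auto simp: integral_nonneg_AE)
qed

lemma distr_snd_semidirect: "distr (semidirect P N k) N snd = P \<bind> k"
proof -
  have "distr (semidirect P N k) N snd = P \<bind> (\<lambda>x. distr (distr (k x) (P \<Otimes>\<^sub>M N) (Pair x)) N snd)"
    unfolding semidirect_def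
    by (rule distr_bind[OF measurable_prob_algebraD[OF semidirect_kernel]])
      (auto simp: prob_space.not_empty[OF P])
  also have "\<dots> = P \<bind> k"
  proof (rule bind_cong[OF refl])
    fix x assume x: "x \<in> space P"
    have "distr (distr (k x) (P \<Otimes>\<^sub>M N) (Pair x)) N snd = distr (k x) N (\<lambda>y. y)"
      by (subst distr_distr[OF measurable_snd Pair_measurable_kernel[OF x]]) (simp add: o_def)
    then show "distr (distr (k x) (P \<Otimes>\<^sub>M N) (Pair x)) N snd = k x"
      using distr_id2[of N "k x"] prob_kernelD(2)[OF k x] by simp
  qed
  finally show ?thesis .
qed

end

text \<open>A limit of approximate joinings is known on rectangles only. Its kernel produces a
  genuine measure on the product with these values.\<close>

lemma bimeasure_imp_measure:
  assumes "real_retract N \<phi> \<psi>" and P: "prob_space P" and N: "prob_space N" and a: "bimeasure P N a"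
  shows "\<exists>J. prob_space J \<and> sets J = sets (P \<Otimes>\<^sub>M N) \<and>
    (\<forall>A\<in>sets P. \<forall>C\<in>sets N. measure J (A \<times> C) = a A C)"
proof -
  obtain k where k: "k \<in> P \<rightarrow>\<^sub>M prob_algebra N"
    and "\<And>A C. A \<in> sets P \<Longrightarrow> C \<in> sets N \<Longrightarrow> a A C = (\<integral>x. indicator A x * measure (k x) C \<partial>P)"
    using bimeasure_kernel[OF assms] by blast
  then show ?thesis
    using prob_space_semidirect[OF P k] sets_semidirect[OF P k] measure_semidirect[OF P k] by metis
qed

section \<open>Regular conditional laws and disintegrations\<close>

definition conditional_law ::
  "'p measure \<Rightarrow> 'a measure \<Rightarrow> 'w measure \<Rightarrow> ('w \<Rightarrow> 'p) \<Rightarrow> ('w \<Rightarrow> 'a) \<Rightarrow> ('p \<Rightarrow> 'a measure) \<Rightarrow> bool" where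
  "conditional_law P N J q \<xi> k \<longleftrightarrow>
     k \<in> P \<rightarrow>\<^sub>M prob_algebra N \<and> distr J (P \<Otimes>\<^sub>M N) (\<lambda>w. (q w, \<xi> w)) = semidirect P N k"

lemma conditional_law_iff:
  assumes P: "prob_space P" and J: "prob_space J" and [measurable]: "q \<in> J \<rightarrow>\<^sub>M P" "\<xi> \<in> J \<rightarrow>\<^sub>M N"
    and k: "k \<in> P \<rightarrow>\<^sub>M prob_algebra N"
  shows "conditional_law P N J q \<xi> k \<longleftrightarrow> (\<forall>A\<in>sets P. \<forall>C\<in>sets N.
    measure J {w \<in> space J. q w \<in> A \<and> \<xi> w \<in> C} = (\<integral>x. indicator A x * measure (k x) C \<partial>P))"
proof -
  interpret J: prob_space J by fact
  let ?D = "distr J (P \<Otimes>\<^sub>M N) (\<lambda>w. (q w, \<xi> w))"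
  have D: "prob_space ?D" by (intro J.prob_space_distr) simp
  interpret D: prob_space ?D by fact
  interpret S: prob_space "semidirect P N k" by (rule prob_space_semidirect[OF P k])
  have eD: "measure ?D (A \<times> C) = measure J {w \<in> space J. q w \<in> A \<and> \<xi> w \<in> C}"
    if "A \<in> sets P" "C \<in> sets N" for A C
    using that by (subst measure_distr) (auto intro!: arg_cong[where f = "measure J"])
  have "?D = semidirect P N k \<longleftrightarrow>
    (\<forall>A\<in>sets P. \<forall>C\<in>sets N. measure ?D (A \<times> C) = measure (semidirect P N k) (A \<times> C))"
  proof safe
    assume *: "\<forall>A\<in>sets P. \<forall>C\<in>sets N. measure ?D (A \<times> C) = measure (semidirect P N k) (A \<times> C)"
    show "?D = semidirect P N k"
      by (rule measure_eqI_rect[of _ P N])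
        (use * D.finite_measure_axioms sets_semidirect[OF P k] in \<open>auto simp: D.emeasure_eq_measure S.emeasure_eq_measure\<close>)
  qed simp
  then show ?thesis
    using k by (simp add: conditional_law_def eD measure_semidirect[OF P k])
qed

lemma conditional_law_exists:
  assumes retr: "real_retract N \<phi> \<psi>" and P: "prob_space P" and J: "prob_space J"
    and q [measurable]: "q \<in> J \<rightarrow>\<^sub>M P" and \<xi> [measurable]: "\<xi> \<in> J \<rightarrow>\<^sub>M N" and dq: "distr J P q = P"
  shows "\<exists>k. conditional_law P N J q \<xi> k"
proof -
  interpret J: prob_space J by fact
  let ?N = "distr J N \<xi>"
  have N: "prob_space ?N" by (intro J.prob_space_distr) simp
  let ?a = "\<lambda>A C. measure J {w \<in> space J. q w \<in> A \<and> \<xi> w \<in> C}"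
  have mP: "measure P A = measure J (q -` A \<inter> space J)" if "A \<in> sets P" for A
    using that measure_distr[OF q that] by (simp add: dq)
  have "bimeasure P ?N ?a"
    unfolding bimeasure_def
  proof (intro conjI ballI impI)
    fix A C assume [measurable]: "A \<in> sets P" and "C \<in> sets ?N"
    then have [measurable]: "C \<in> sets N" by simp
    show "0 \<le> ?a A C" by simp
    show "?a A C \<le> measure P A"
      by (subst mP) (auto intro!: J.finite_measure_mono)
    show "?a A C \<le> measure ?N C"
      by (subst measure_distr) (auto intro!: J.finite_measure_mono)
    show "?a (A \<union> A') C = ?a A C + ?a A' C" if [measurable]: "A' \<in> sets P" and "A \<inter> A' = {}" for A'
      using that(2) by (subst J.finite_measure_Union[symmetric]) (auto intro!: arg_cong[where f = "measure J"])
    show "?a A (C \<union> C') = ?a A C + ?a A C'" if "C' \<in> sets ?N" and "C \<inter> C' = {}" for C'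
    proof -
      have [measurable]: "C' \<in> sets N" using that by simp
      show ?thesis
        using that(2) by (subst J.finite_measure_Union[symmetric]) (auto intro!: arg_cong[where f = "measure J"])
    qed
  next
    have "{w \<in> space J. q w \<in> space P \<and> \<xi> w \<in> space ?N} = space J"
      using measurable_space[OF q] measurable_space[OF \<xi>] by auto
    then show "?a (space P) (space ?N) = 1" by (simp only: J.prob_space)
  qed
  moreover have "real_retract ?N \<phi> \<psi>" using retr real_retract_cong[of ?N N] by simp
  ultimately obtain k where "k \<in> P \<rightarrow>\<^sub>M prob_algebra ?N"
    and k: "\<And>A C. A \<in> sets P \<Longrightarrow> C \<in> sets ?N \<Longrightarrow> ?a A C = (\<integral>x. indicator A x * measure (k x) C \<partial>P)"
    using bimeasure_kernel[OF _ P N, of \<phi> \<psi> ?a] by blast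
  then have km: "k \<in> P \<rightarrow>\<^sub>M prob_algebra N"
    using subprob_algebra_cong[of ?N N] by (simp add: prob_algebra_def)
  then show ?thesis
    using conditional_law_iff[OF P J q \<xi> km] k by auto
qed

text \<open>For each fixed set the two masses agree almost everywhere, with an exceptional null set
  depending on the set. Countably many sublevel sets determine a measure, so a single null set is
  enough.\<close>

lemma kernel_AE_eqI:
  assumes retr: "real_retract N \<phi> \<psi>" and P: "prob_space P"
    and k: "k \<in> P \<rightarrow>\<^sub>M prob_algebra N" and k': "k' \<in> P \<rightarrow>\<^sub>M prob_algebra N"
    and eq: "\<And>A C. A \<in> sets P \<Longrightarrow> C \<in> sets N \<Longrightarrow>
      (\<integral>x. indicator A x * measure (k x) C \<partial>P) = (\<integral>x. indicator A x * measure (k' x) C \<partial>P)"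
  shows "AE x in P. k x = k' x"
proof -
  interpret P: prob_space P by fact
  note [measurable] = real_retractD(1)[OF retr]
  have "AE x in P. measure (k x) (sublevel N \<phi> r) = measure (k' x) (sublevel N \<phi> r)" for r
    by (rule AE_eq_if_set_integral_eq) (auto intro!: integrable_kernel[OF P.finite_measure_axioms] k k' eq)
  then have "AE x in P. \<forall>r. measure (k x) (sublevel N \<phi> r) = measure (k' x) (sublevel N \<phi> r)"
    by (simp add: AE_all_countable)
  then show ?thesis
    using AE_space
  proof eventually_elim
    case (elim x)
    interpret kx: prob_space "k x" by (rule prob_kernelD(1)[OF k elim(2)])
    interpret kx': prob_space "k' x" by (rule prob_kernelD(1)[OF k' elim(2)])
    show ?case
      using elim prob_kernelD(2)[OF k elim(2)] prob_kernelD(2)[OF k' elim(2)]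
      by (intro measure_eqI_sublevel[OF retr kx.finite_measure_axioms])
        (auto simp: kx.emeasure_eq_measure kx'.emeasure_eq_measure)
  qed
qed

lemma conditional_law_AE:
  assumes P: "prob_space P" and [measurable]: "q \<in> J \<rightarrow>\<^sub>M P" "\<xi> \<in> J \<rightarrow>\<^sub>M N"
    and cl: "conditional_law P N J q \<xi> k" and [measurable]: "Measurable.pred (P \<Otimes>\<^sub>M N) Q"
  shows "(AE w in J. Q (q w, \<xi> w)) \<longleftrightarrow> (AE x in P. AE y in k x. Q (x, y))"
proof -
  have "(AE w in J. Q (q w, \<xi> w)) \<longleftrightarrow> (AE w in distr J (P \<Otimes>\<^sub>M N) (\<lambda>w. (q w, \<xi> w)). Q w)"
    by (subst AE_distr_iff) auto
  also have "\<dots> \<longleftrightarrow> (AE x in P. AE y in k x. Q (x, y))"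
  proof -
    have k: "k \<in> P \<rightarrow>\<^sub>M prob_algebra N"
      and D: "distr J (P \<Otimes>\<^sub>M N) (\<lambda>w. (q w, \<xi> w)) = semidirect P N k"
      using cl by (auto simp: conditional_law_def)
    show ?thesis unfolding D by (rule AE_semidirect[OF P k]) fact
  qed
  finally show ?thesis .
qed

text \<open>Composing with \<open>\<zeta>\<close> turns an equation in \<open>Z\<close> into an
  equation between real measurable functions, hence into a measurable predicate to which the change
  of variables applies. Injectivity of \<open>\<zeta>\<close> on the space returns the original
  equation.\<close>

lemma conditional_law_AE_eq:
  assumes P: "prob_space P" and q [measurable]: "q \<in> J \<rightarrow>\<^sub>M P" "\<xi> \<in> J \<rightarrow>\<^sub>M N"
    and retr: "real_retract Z \<zeta> \<theta>" and [measurable]: "u \<in> P \<rightarrow>\<^sub>M Z" "v \<in> N \<rightarrow>\<^sub>M Z"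
    and cl: "conditional_law P N J q \<xi> k" and ae: "AE w in J. u (q w) = v (\<xi> w)"
  shows "AE x in P. AE y in k x. u x = v y"
proof -
  note [measurable] = real_retractD(1)[OF retr]
  have k: "k \<in> P \<rightarrow>\<^sub>M prob_algebra N" using cl by (simp add: conditional_law_def)
  have "AE w in J. \<zeta> (u (fst (q w, \<xi> w))) = \<zeta> (v (snd (q w, \<xi> w)))"
    using ae by eventually_elim simp
  then have "AE x in P. AE y in k x. \<zeta> (u (fst (x, y))) = \<zeta> (v (snd (x, y)))"
    by (subst (asm) conditional_law_AE[OF P q cl]) measurable
  then show ?thesis
    using AE_space
  proof eventually_elim
    case (elim x)
    from elim(1) AE_space[of "k x"] show ?case
    proof eventually_elim
      case (elim y)
      then have "u x \<in> space Z" "v y \<in> space Z"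
        using \<open>x \<in> space P\<close> prob_kernelD(3)[OF k \<open>x \<in> space P\<close>]
        by (auto intro: measurable_space[OF \<open>u \<in> P \<rightarrow>\<^sub>M Z\<close>] measurable_space[OF \<open>v \<in> N \<rightarrow>\<^sub>M Z\<close>])
      then show ?case using elim real_retractD(3)[OF retr] by (metis fst_conv snd_conv)
    qed
  qed
qed

text \<open>Where \<open>m z\<close> lives on the fibre over \<open>z\<close>, the condition on
  \<open>\<pi> x\<close> under the integral is a condition on \<open>z\<close>, so the mixture
  \<open>K \<bind> m\<close> already fixes the joint law of \<open>\<pi> x\<close> and
  \<open>x\<close>. Disintegrations thereby inherit existence, uniqueness and equivariance from
  conditional laws.\<close>

lemma disintegration_iff_conditional_law:
  assumes retr: "real_retract K \<zeta> \<theta>" and M: "prob_space M"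
    and \<pi> [measurable]: "\<pi> \<in> M \<rightarrow>\<^sub>M K" and d: "distr M K \<pi> = K"
  shows "disintegration K M \<pi> m \<longleftrightarrow> conditional_law K M M \<pi> (\<lambda>x. x) m"
proof
  have K: "prob_space K" using prob_space.prob_space_distr[OF M \<pi>] d by simp
  {
    assume cl: "conditional_law K M M \<pi> (\<lambda>x. x) m"
    then have m: "m \<in> K \<rightarrow>\<^sub>M prob_algebra M" by (simp add: conditional_law_def)
    have "M = distr (distr M (K \<Otimes>\<^sub>M M) (\<lambda>w. (\<pi> w, w))) M snd"
      by (subst distr_distr) (auto simp: o_def distr_id)
    also have "\<dots> = K \<bind> m"
      using cl distr_snd_semidirect[OF K m] by (simp add: conditional_law_def)
    finally have "M = K \<bind> m" .
    moreover have "AE z in K. AE x in m z. z = \<pi> x"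
      by (rule conditional_law_AE_eq[OF K \<pi> _ retr _ _ cl]) auto
    then have "AE z in K. AE x in m z. \<pi> x = z"
      by (simp add: eq_commute)
    ultimately show "disintegration K M \<pi> m" using m by (simp add: disintegration_def)
  }
  assume dis: "disintegration K M \<pi> m"
  then have m: "m \<in> K \<rightarrow>\<^sub>M prob_algebra M" and b: "M = K \<bind> m" and ae: "AE z in K. AE x in m z. \<pi> x = z"
    by (auto simp: disintegration_def)
  interpret K: prob_space K by fact
  interpret M: prob_space M by fact
  show "conditional_law K M M \<pi> (\<lambda>x. x) m"
  proof (subst conditional_law_iff[OF K M \<pi> _ m], safe)
    fix A C assume [measurable]: "A \<in> sets K" "C \<in> sets M"
    let ?S = "{x \<in> space M. \<pi> x \<in> A \<and> x \<in> C}"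
    have "emeasure M ?S = emeasure (K \<bind> m) ?S" using b by simp
    also have "\<dots> = (\<integral>\<^sup>+z. emeasure (m z) ?S \<partial>K)"
      by (rule emeasure_bind[OF _ measurable_prob_algebraD[OF m]]) (auto simp: K.not_empty)
    also have "\<dots> = (\<integral>\<^sup>+z. indicator A z * emeasure (m z) C \<partial>K)"
    proof (rule nn_integral_cong_AE)
      show "AE z in K. emeasure (m z) ?S = indicator A z * emeasure (m z) C"
        using ae AE_space
      proof eventually_elim
        case (elim z)
        note mz = prob_kernelD[OF m elim(2)]
        have "emeasure (m z) ?S = emeasure (m z) (if z \<in> A then C else {})"
        proof (rule emeasure_eq_AE)
          show "AE x in m z. (x \<in> ?S) = (x \<in> (if z \<in> A then C else {}))"
            using elim(1) AE_space by eventually_elim (use mz in auto)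
        qed (auto simp: mz)
        then show ?case by simp
      qed
    qed
    also have "\<dots> = ennreal (\<integral>z. indicator A z * measure (m z) C \<partial>K)"
      by (rule nn_integral_kernel[OF K.finite_measure_axioms m]) auto
    finally show "measure M ?S = (\<integral>z. indicator A z * measure (m z) C \<partial>K)"
      by (simp add: M.emeasure_eq_measure integral_nonneg_AE)
  qed simp
qed

section \<open>Ergodic systems and relative products\<close>

lemma pmp_actionD:
  assumes "pmp_action G M T"
  shows "prob_space M" "\<And>g. g \<in> carrier G \<Longrightarrow> T g \<in> M \<rightarrow>\<^sub>M M"
    "\<And>g. g \<in> carrier G \<Longrightarrow> distr M M (T g) = M"
    "\<And>x. x \<in> space M \<Longrightarrow> T \<one>\<^bsub>G\<^esub> x = x"
    "\<And>g h x. g \<in> carrier G \<Longrightarrow> h \<in> carrier G \<Longrightarrow> x \<in> space M \<Longrightarrow> T (g \<otimes>\<^bsub>G\<^esub> h) x = T g (T h x)"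
  using assms by (auto simp: pmp_action_def)

lemma pmp_action_inv:
  assumes "pmp_action G M T" "group G" "g \<in> carrier G" "x \<in> space M"
  shows "T (inv\<^bsub>G\<^esub> g) (T g x) = x" "T g (T (inv\<^bsub>G\<^esub> g) x) = x"
proof -
  interpret group G by fact
  have "inv\<^bsub>G\<^esub> g \<in> carrier G" using assms(3) by simp
  note D = pmp_actionD(4,5)[OF assms(1)]
  show "T (inv\<^bsub>G\<^esub> g) (T g x) = x"
    using D(2)[of "inv\<^bsub>G\<^esub> g" g x] D(1)[of x] assms(3,4) by simp
  show "T g (T (inv\<^bsub>G\<^esub> g) x) = x"
    using D(2)[of g "inv\<^bsub>G\<^esub> g" x] D(1)[of x] assms(3,4) by simp
qed

lemma measure_invariant_AE:
  assumes J: "prob_space J" and \<tau>: "\<tau> \<in> J \<rightarrow>\<^sub>M J" "distr J J \<tau> = J"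
    and Q: "Measurable.pred J Q" and Q': "Measurable.pred J Q'" and ae: "AE w in J. Q (\<tau> w) \<longleftrightarrow> Q' w"
  shows "measure J {w \<in> space J. Q w} = measure J {w \<in> space J. Q' w}"
proof -
  note [measurable] = \<tau>(1) Q Q'
  interpret J: prob_space J by fact
  have "measure J {w \<in> space J. Q w} = measure (distr J J \<tau>) {w \<in> space J. Q w}"
    using \<tau>(2) by simp
  also have "\<dots> = measure J (\<tau> -` {w \<in> space J. Q w} \<inter> space J)"
    by (rule measure_distr) auto
  also have "\<dots> = measure J {w \<in> space J. Q (\<tau> w)}"
    using measurable_space[OF \<tau>(1)] by (auto intro!: arg_cong[where f = "measure J"])
  also have "\<dots> = measure J {w \<in> space J. Q' w}"
    by (rule J.finite_measure_eq_AE) (use ae in \<open>auto elim: AE_mp\<close>)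
  finally show ?thesis .
qed

lemma pred_countable_Ball:
  assumes "countable X" and P: "\<And>i. i \<in> X \<Longrightarrow> Measurable.pred M (P i)"
  shows "Measurable.pred M (\<lambda>x. \<forall>i\<in>X. P i x)"
proof (cases "X = {}")
  case False
  have "{x \<in> space M. \<forall>i\<in>X. P i x} = (\<Inter>i\<in>X. {x \<in> space M. P i x})"
    using False by auto
  also have "\<dots> \<in> sets M"
    using assms False by (intro sets.countable_INT') (auto simp: pred_def)
  finally show ?thesis by (simp add: pred_def)
qed simp

lemma ergodic_AE_const:
  fixes f :: "'y \<Rightarrow> real"
  assumes G: "group G" "countable (carrier G)" and N: "pmp_action G N S" and erg: "ergodic_action G N S"
    and f: "integrable N f" and inv: "\<And>g. g \<in> carrier G \<Longrightarrow> AE y in N. f (S g y) = f y"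
  shows "AE y in N. f y = (\<integral>y. f y \<partial>N)"
proof -
  interpret G: group G by fact
  interpret N: prob_space N by (rule pmp_actionD(1)[OF N])
  let ?c = "\<integral>y. f y \<partial>N"
  have fm [measurable]: "f \<in> borel_measurable N" using f by auto
  have S [measurable]: "g \<in> carrier G \<Longrightarrow> S g \<in> N \<rightarrow>\<^sub>M N" for g by (rule pmp_actionD(2)[OF N])
  \<comment> \<open>Ergodicity is stated for strictly invariant sets, whereas \<open>f\<close> is
    invariant only almost everywhere. Quantifying over the whole orbit makes \<open>A\<close>
    strictly invariant; since the group is countable, \<open>A\<close> is measurable and differs
    from the set where \<open>f\<close> exceeds its mean by a null set.\<close>
  define A where "A = {y \<in> space N. \<forall>g\<in>carrier G. ?c < f (S g y)}"
  have A: "A \<in> sets N"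
  proof -
    have "Measurable.pred N (\<lambda>y. \<forall>g\<in>carrier G. ?c < f (S g y))"
      by (rule pred_countable_Ball[OF G(2)]) measurable
    then show ?thesis unfolding A_def by (simp add: pred_def)
  qed
  have "S h -` A \<inter> space N = A" if h: "h \<in> carrier G" for h
  proof (intro equalityI subsetI)
    fix y assume y: "y \<in> S h -` A \<inter> space N"
    have "?c < f (S g y)" if g: "g \<in> carrier G" for g
    proof -
      have "S g y = S (g \<otimes>\<^bsub>G\<^esub> inv\<^bsub>G\<^esub> h) (S h y)"
        using pmp_actionD(5)[OF N, of "g \<otimes>\<^bsub>G\<^esub> inv\<^bsub>G\<^esub> h" h y] g h y by (simp add: G.m_assoc)
      then show ?thesis using y g h by (auto simp: A_def)
    qed
    then show "y \<in> A" using y by (auto simp: A_def)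
  next
    fix y assume y: "y \<in> A"
    then have ys: "y \<in> space N" by (auto simp: A_def)
    have "?c < f (S g (S h y))" if g: "g \<in> carrier G" for g
    proof -
      have "?c < f (S (g \<otimes>\<^bsub>G\<^esub> h) y)" using y g h by (auto simp: A_def)
      then show ?thesis using pmp_actionD(5)[OF N g h ys] by simp
    qed
    then show "y \<in> S h -` A \<inter> space N"
      using measurable_space[OF S[OF h] ys] ys by (auto simp: A_def)
  qed
  then have "invariant_set G N S A" using A by (simp add: invariant_set_def)
  then have "emeasure N A = 0 \<or> emeasure N A = 1" using erg by (simp add: ergodic_action_def)
  then have A01: "(AE y in N. y \<notin> A) \<or> (AE y in N. y \<in> A)"
    using A N.AE_in_set_eq_1[OF A] AE_iff_null_sets[OF A] by (auto simp: N.emeasure_eq_measure null_sets_def)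
  have "AE y in N. \<forall>g\<in>carrier G. f (S g y) = f y"
    using inv G(2) by (simp add: AE_ball_countable)
  then have fA: "AE y in N. y \<in> A \<longleftrightarrow> ?c < f y"
    using AE_space by eventually_elim (use G.one_closed in \<open>auto simp: A_def\<close>)
  have int0: "(\<integral>y. f y - ?c \<partial>N) = 0" using f by (simp add: N.prob_space)
  \<comment> \<open>A function cannot lie strictly above its mean almost everywhere, so
    \<open>A\<close> must be the null alternative. A function that stays below its mean is then
    almost everywhere equal to it.\<close>
  have "AE y in N. f y \<le> ?c"
  proof (rule ccontr)
    assume *: "\<not> ?thesis"
    have "\<not> (AE y in N. y \<notin> A)"
    proof
      assume "AE y in N. y \<notin> A"
      then have "AE y in N. f y \<le> ?c" using fA by eventually_elim auto
      with * show False ..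
    qed
    then have "AE y in N. y \<in> A" using A01 by blast
    then have gt: "AE y in N. ?c < f y" using fA by eventually_elim auto
    then have "AE y in N. 0 \<le> f y - ?c" by eventually_elim auto
    then have "AE y in N. f y - ?c = 0"
      using integral_nonneg_eq_0_iff_AE[of N "\<lambda>y. f y - ?c"] int0 f by simp
    with gt have "AE y in N. False" by eventually_elim auto
    then show False by simp
  qed
  then have nn: "AE y in N. 0 \<le> ?c - f y" by eventually_elim auto
  have "(\<integral>y. ?c - f y \<partial>N) = 0" using f by (simp add: N.prob_space)
  then have "AE y in N. ?c - f y = 0"
    using integral_nonneg_eq_0_iff_AE[of N "\<lambda>y. ?c - f y"] nn f by simp
  then show ?thesis by eventually_elim auto
qed

text \<open>Conditioning on an invariant event gives an invariant density on the ergodic factor.\<close>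

lemma invariant_independent_of_ergodic:
  assumes G: "group G" "countable (carrier G)" and N: "pmp_action G N S" and erg: "ergodic_action G N S"
    and J: "prob_space J" and u [measurable]: "u \<in> J \<rightarrow>\<^sub>M B" and v [measurable]: "v \<in> J \<rightarrow>\<^sub>M N"
    and dv: "distr J N v = N"
    and \<tau>: "\<And>g. g \<in> carrier G \<Longrightarrow> \<tau> g \<in> J \<rightarrow>\<^sub>M J" "\<And>g. g \<in> carrier G \<Longrightarrow> distr J J (\<tau> g) = J"
    and u\<tau>: "\<And>g. g \<in> carrier G \<Longrightarrow> AE w in J. u (\<tau> g w) = u w"
    and v\<tau>: "\<And>g. g \<in> carrier G \<Longrightarrow> AE w in J. v (\<tau> g w) = S g (v w)"
    and E [measurable]: "E \<in> sets B" and C: "C \<in> sets N"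
  shows "measure J {w \<in> space J. u w \<in> E \<and> v w \<in> C} = measure J {w \<in> space J. u w \<in> E} * measure N C"
proof -
  interpret J: prob_space J by fact
  interpret N: prob_space N by (rule pmp_actionD(1)[OF N])
  interpret G: group G by fact
  let ?b = "\<lambda>C. measure J {w \<in> space J. u w \<in> E \<and> v w \<in> C}"
  have mN: "measure N C = measure J (v -` C \<inter> space J)" if "C \<in> sets N" for C
    using measure_distr[OF v that] by (simp add: dv)
  have "\<exists>f\<in>borel_measurable N. (\<forall>x. 0 \<le> f x \<and> f x \<le> 1) \<and>
    (\<forall>C\<in>sets N. ?b C = (\<integral>x. indicator C x * f x \<partial>N))"
  proof (rule dominated_additive_density[OF N.finite_measure_axioms])
    show "?b C \<le> measure N C" if [measurable]: "C \<in> sets N" for C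
      by (subst mN) (auto intro!: J.finite_measure_mono)
    show "?b (C \<union> C') = ?b C + ?b C'" if [measurable]: "C \<in> sets N" "C' \<in> sets N" and "C \<inter> C' = {}" for C C'
      using that(3) by (subst J.finite_measure_Union[symmetric]) (auto intro!: arg_cong[where f = "measure J"])
  qed simp
  then obtain f where f [measurable]: "f \<in> borel_measurable N" and f01: "\<And>x. 0 \<le> f x" "\<And>x. f x \<le> 1"
    and fb: "\<And>C. C \<in> sets N \<Longrightarrow> ?b C = (\<integral>x. indicator C x * f x \<partial>N)" by blast
  have fi: "integrable N f" using f01 by (intro N.integrable_const_bound[where B=1]) auto
  have "AE y in N. f (S g y) = f y" if g: "g \<in> carrier G" for g
  proof (rule AE_eq_if_set_integral_eq)
    have Sg [measurable]: "S g \<in> N \<rightarrow>\<^sub>M N" and Sg' [measurable]: "S (inv\<^bsub>G\<^esub> g) \<in> N \<rightarrow>\<^sub>M N"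
      using pmp_actionD(2)[OF N] g by auto
    show "integrable N (\<lambda>y. f (S g y))"
      using f01 by (intro N.integrable_const_bound[where B=1]) auto
    show "integrable N f" by fact
    fix C assume C [measurable]: "C \<in> sets N"
    \<comment> \<open>With the inverse element, \<open>C\<close> becomes the preimage of
      \<open>?C'\<close> under \<open>S g\<close>, so the integral is a change of variables by a
      measure preserving map.\<close>
    let ?C' = "S (inv\<^bsub>G\<^esub> g) -` C \<inter> space N"
    have C': "?C' \<in> sets N" by measurable
    have "(\<integral>y. indicator C y * f (S g y) \<partial>N) = (\<integral>y. indicator ?C' (S g y) * f (S g y) \<partial>N)"
      using pmp_action_inv[OF N G(1) g] measurable_space[OF Sg]
      by (intro Bochner_Integration.integral_cong) (auto simp: indicator_def)
    also have "\<dots> = (\<integral>y. indicator ?C' y * f y \<partial>distr N N (S g))"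
      by (rule integral_distr[symmetric]) auto
    also have "\<dots> = ?b ?C'" using fb[OF C'] pmp_actionD(3)[OF N g] by simp
    also have "\<dots> = ?b C"
    proof (rule measure_invariant_AE[OF J \<tau>[OF g]])
      show "AE w in J. (u (\<tau> g w) \<in> E \<and> v (\<tau> g w) \<in> ?C') \<longleftrightarrow> (u w \<in> E \<and> v w \<in> C)"
        using u\<tau>[OF g] v\<tau>[OF g] AE_space
      proof eventually_elim
        case (elim w)
        then show ?case
          using pmp_action_inv[OF N G(1) g, of "v w"] measurable_space[OF v, of w] measurable_space[OF Sg, of "v w"] by auto
      qed
    qed measurable
    also have "\<dots> = (\<integral>y. indicator C y * f y \<partial>N)" by (rule fb[OF C])
    finally show "(\<integral>y. indicator C y * f (S g y) \<partial>N) = (\<integral>y. indicator C y * f y \<partial>N)" .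
  qed
  then have const: "AE y in N. f y = (\<integral>y. f y \<partial>N)"
    by (rule ergodic_AE_const[OF G N erg fi])
  have "(\<integral>y. f y \<partial>N) = (\<integral>y. indicator (space N) y * f y \<partial>N)"
    by (intro Bochner_Integration.integral_cong) auto
  also have "\<dots> = ?b (space N)" by (rule fb[symmetric]) auto
  also have "\<dots> = measure J {w \<in> space J. u w \<in> E}"
    using measurable_space[OF v] by (auto intro!: arg_cong[where f = "measure J"])
  finally have m: "(\<integral>y. f y \<partial>N) = measure J {w \<in> space J. u w \<in> E}" .
  have "?b C = (\<integral>y. indicator C y * (\<integral>y. f y \<partial>N) \<partial>N)"
    unfolding fb[OF C] using C
    by (intro integral_cong_AE, simp, simp) (rule AE_mp[OF const], simp)
  then show ?thesis using C by (simp add: m mult.commute)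
qed

lemma distr_pair_eq_product:
  assumes J: "prob_space J" and P: "prob_space P" and Q: "prob_space Q"
    and u [measurable]: "u \<in> J \<rightarrow>\<^sub>M P" and v [measurable]: "v \<in> J \<rightarrow>\<^sub>M Q"
    and eq: "\<And>E C. E \<in> sets P \<Longrightarrow> C \<in> sets Q \<Longrightarrow>
      measure J {w \<in> space J. u w \<in> E \<and> v w \<in> C} = measure P E * measure Q C"
  shows "distr J (P \<Otimes>\<^sub>M Q) (\<lambda>w. (u w, v w)) = P \<Otimes>\<^sub>M Q"
proof -
  interpret J: prob_space J by fact
  interpret P: prob_space P by fact
  interpret Q: prob_space Q by fact
  interpret PQ: pair_prob_space P Q ..
  interpret D: prob_space "distr J (P \<Otimes>\<^sub>M Q) (\<lambda>w. (u w, v w))"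
    by (rule J.prob_space_distr) measurable
  show ?thesis
  proof (rule measure_eqI_rect[OF D.finite_measure_axioms, of P Q])
    fix E C assume [measurable]: "E \<in> sets P" "C \<in> sets Q"
    have "measure (distr J (P \<Otimes>\<^sub>M Q) (\<lambda>w. (u w, v w))) (E \<times> C) = measure J {w \<in> space J. u w \<in> E \<and> v w \<in> C}"
      by (subst measure_distr) (auto intro!: arg_cong[where f = "measure J"])
    also have "\<dots> = measure P E * measure Q C" by (rule eq) auto
    also have "\<dots> = measure (P \<Otimes>\<^sub>M Q) (E \<times> C)"
      by (simp add: measure_def Q.emeasure_pair_measure_Times enn2real_mult)
    finally show "emeasure (distr J (P \<Otimes>\<^sub>M Q) (\<lambda>w. (u w, v w))) (E \<times> C) = emeasure (P \<Otimes>\<^sub>M Q) (E \<times> C)"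
      by (simp add: D.emeasure_eq_measure PQ.emeasure_eq_measure)
  qed auto
qed

text \<open>Both kernels describe the same masses, because \<open>J\<close> is invariant under
  \<open>\<tau>\<close>; uniqueness of kernels does the rest. The left inverse
  \<open>\<sigma>'\<close> serves to write a set \<open>A\<close> as a preimage under
  \<open>\<sigma>\<close>.\<close>

lemma conditional_law_equivariant:
  assumes retr: "real_retract N \<phi> \<psi>" and P: "prob_space P" and J: "prob_space J"
    and q [measurable]: "q \<in> J \<rightarrow>\<^sub>M P" and \<xi> [measurable]: "\<xi> \<in> J \<rightarrow>\<^sub>M N"
    and cl: "conditional_law P N J q \<xi> k"
    and \<tau>: "\<tau> \<in> J \<rightarrow>\<^sub>M J" "distr J J \<tau> = J"
    and \<sigma> [measurable]: "\<sigma> \<in> P \<rightarrow>\<^sub>M P" and d\<sigma>: "distr P P \<sigma> = P"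
    and \<sigma>' [measurable]: "\<sigma>' \<in> P \<rightarrow>\<^sub>M P" and inv: "\<And>x. x \<in> space P \<Longrightarrow> \<sigma>' (\<sigma> x) = x"
    and T [measurable]: "T \<in> N \<rightarrow>\<^sub>M N"
    and q\<tau>: "AE w in J. q (\<tau> w) = \<sigma> (q w)" and \<xi>\<tau>: "AE w in J. \<xi> (\<tau> w) = T (\<xi> w)"
  shows "AE x in P. k (\<sigma> x) = distr (k x) N T"
proof (rule kernel_AE_eqI[OF retr P])
  have k [measurable]: "k \<in> P \<rightarrow>\<^sub>M prob_algebra N" using cl by (simp add: conditional_law_def)
  note law = conditional_law_iff[OF P J q \<xi> k, THEN iffD1, OF cl, rule_format]
  show "(\<lambda>x. k (\<sigma> x)) \<in> P \<rightarrow>\<^sub>M prob_algebra N" "(\<lambda>x. distr (k x) N T) \<in> P \<rightarrow>\<^sub>M prob_algebra N"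
    by measurable
  fix A C assume A [measurable]: "A \<in> sets P" and C [measurable]: "C \<in> sets N"
  let ?A' = "\<sigma>' -` A \<inter> space P" and ?C' = "T -` C \<inter> space N"
  have A' [measurable]: "?A' \<in> sets P" and C' [measurable]: "?C' \<in> sets N" by measurable
  have "(\<integral>x. indicator A x * measure (k (\<sigma> x)) C \<partial>P) = (\<integral>x. indicator ?A' (\<sigma> x) * measure (k (\<sigma> x)) C \<partial>P)"
    using inv measurable_space[OF \<sigma>] by (intro Bochner_Integration.integral_cong) (auto simp: indicator_def)
  also have "\<dots> = (\<integral>x. indicator ?A' x * measure (k x) C \<partial>distr P P \<sigma>)"
    by (rule integral_distr[symmetric]) auto
  also have "\<dots> = measure J {w \<in> space J. q w \<in> ?A' \<and> \<xi> w \<in> C}"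
    using law[OF A' C] d\<sigma> by simp
  also have "\<dots> = measure J {w \<in> space J. q w \<in> A \<and> \<xi> w \<in> ?C'}"
  proof (rule measure_invariant_AE[OF J \<tau>])
    show "AE w in J. (q (\<tau> w) \<in> ?A' \<and> \<xi> (\<tau> w) \<in> C) \<longleftrightarrow> (q w \<in> A \<and> \<xi> w \<in> ?C')"
      using q\<tau> \<xi>\<tau> AE_space
    proof eventually_elim
      case (elim w)
      then show ?case
        using inv[of "q w"] measurable_space[OF q, of w] measurable_space[OF \<sigma>, of "q w"] measurable_space[OF \<xi>, of w] by auto
    qed
  qed measurable
  also have "\<dots> = (\<integral>x. indicator A x * measure (k x) ?C' \<partial>P)" by (rule law[OF A C'])
  also have "\<dots> = (\<integral>x. indicator A x * measure (distr (k x) N T) C \<partial>P)"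
  proof (intro Bochner_Integration.integral_cong refl)
    fix x assume "x \<in> space P"
    note kx = prob_kernelD[OF k this]
    have "T \<in> k x \<rightarrow>\<^sub>M N" using measurable_cong_sets[OF kx(2) refl] T by blast
    then show "indicator A x * measure (k x) ?C' = indicator A x * measure (distr (k x) N T) C"
      using kx C by (simp add: measure_distr)
  qed
  finally show "(\<integral>x. indicator A x * measure (k (\<sigma> x)) C \<partial>P) = (\<integral>x. indicator A x * measure (distr (k x) N T) C \<partial>P)" .
qed

lemma measure_bind_kernel:
  assumes L: "prob_space L" and k: "k \<in> L \<rightarrow>\<^sub>M prob_algebra M" and C: "C \<in> sets M"
  shows "measure (L \<bind> k) C = (\<integral>y. measure (k y) C \<partial>L)"
proof -
  interpret L: prob_space L by fact
  have "emeasure (L \<bind> k) C = (\<integral>\<^sup>+y. emeasure (k y) C \<partial>L)"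
    by (rule emeasure_bind_prob_algebra[OF _ k C]) (simp add: space_prob_algebra L)
  also have "\<dots> = (\<integral>\<^sup>+y. indicator (space L) y * emeasure (k y) C \<partial>L)"
    by (intro nn_integral_cong) simp
  also have "\<dots> = ennreal (\<integral>y. indicator (space L) y * measure (k y) C \<partial>L)"
    by (rule nn_integral_kernel[OF L.finite_measure_axioms k]) (use C in auto)
  also have "(\<integral>y. indicator (space L) y * measure (k y) C \<partial>L) = (\<integral>y. measure (k y) C \<partial>L)"
    by (intro Bochner_Integration.integral_cong) auto
  finally show ?thesis by (simp add: measure_def[of _ C] integral_nonneg_AE)
qed

text \<open>The base of \<open>j\<close> is the product measure, so \<open>u\<close> and
  \<open>v\<close> are independent. Integrating out \<open>y\<close> with the unconditional law
  \<open>L\<close> therefore leaves the conditional law given \<open>u\<close>, which is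
  unique.\<close>

lemma conditional_law_slice:
  assumes retr: "real_retract M \<phi> \<psi>" and B: "prob_space B" and L: "prob_space L" and J: "prob_space J"
    and u [measurable]: "u \<in> J \<rightarrow>\<^sub>M B" and v [measurable]: "v \<in> J \<rightarrow>\<^sub>M L" and \<xi> [measurable]: "\<xi> \<in> J \<rightarrow>\<^sub>M M"
    and j: "conditional_law (B \<Otimes>\<^sub>M L) M J (\<lambda>w. (u w, v w)) \<xi> j" and c: "conditional_law B M J u \<xi> c"
  shows "AE b in B. c b = L \<bind> (\<lambda>y. j (b, y))"
proof (rule kernel_AE_eqI[OF retr B])
  interpret B: prob_space B by fact
  interpret L: prob_space L by fact
  interpret BL: pair_prob_space B L ..
  have jm [measurable]: "j \<in> B \<Otimes>\<^sub>M L \<rightarrow>\<^sub>M prob_algebra M" and cm [measurable]: "c \<in> B \<rightarrow>\<^sub>M prob_algebra M"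
    using j c by (simp_all add: conditional_law_def)
  have L': "L \<in> space (prob_algebra L)" using L by (simp add: space_prob_algebra)
  show "c \<in> B \<rightarrow>\<^sub>M prob_algebra M" by fact
  show bm: "(\<lambda>b. L \<bind> (\<lambda>y. j (b, y))) \<in> B \<rightarrow>\<^sub>M prob_algebra M"
    by (rule measurable_bind_prob_space2[where N = L]) (use L' in \<open>simp_all add: measurable_const\<close>)
  fix E C assume E [measurable]: "E \<in> sets B" and C [measurable]: "C \<in> sets M"
  have slice: "measure (L \<bind> (\<lambda>y. j (b, y))) C = (\<integral>y. measure (j (b, y)) C \<partial>L)" if b: "b \<in> space B" for b
    using b by (intro measure_bind_kernel[OF L _ C]) measurable
  have "(\<integral>b. indicator E b * measure (c b) C \<partial>B) = measure J {w \<in> space J. u w \<in> E \<and> \<xi> w \<in> C}"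
    using conditional_law_iff[OF B J u \<xi> cm, THEN iffD1, OF c] E C by auto
  also have "\<dots> = measure J {w \<in> space J. (u w, v w) \<in> E \<times> space L \<and> \<xi> w \<in> C}"
    using measurable_space[OF v] by (auto intro!: arg_cong[where f = "measure J"])
  also have "\<dots> = (\<integral>x. indicator (E \<times> space L) x * measure (j x) C \<partial>(B \<Otimes>\<^sub>M L))"
    using conditional_law_iff[OF BL.prob_space_axioms J _ \<xi> jm, THEN iffD1, OF _ j, rule_format, of "E \<times> space L" C] C
    by simp
  also have "\<dots> = (\<integral>b. \<integral>y. indicator (E \<times> space L) (b, y) * measure (j (b, y)) C \<partial>L \<partial>B)"
    by (rule BL.integral_fst'[symmetric]) (rule integrable_kernel[OF BL.finite_measure_axioms jm], auto)
  also have "\<dots> = (\<integral>b. indicator E b * measure (L \<bind> (\<lambda>y. j (b, y))) C \<partial>B)"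
  proof (intro Bochner_Integration.integral_cong refl)
    fix b assume b: "b \<in> space B"
    have "(\<integral>y. indicator (E \<times> space L) (b, y) * measure (j (b, y)) C \<partial>L) = (\<integral>y. indicator E b * measure (j (b, y)) C \<partial>L)"
      by (intro Bochner_Integration.integral_cong) (auto simp: indicator_def)
    then show "(\<integral>y. indicator (E \<times> space L) (b, y) * measure (j (b, y)) C \<partial>L) = indicator E b * measure (L \<bind> (\<lambda>y. j (b, y))) C"
      using slice[OF b] by simp
  qed
  finally show "(\<integral>b. indicator E b * measure (c b) C \<partial>B) = (\<integral>b. indicator E b * measure (L \<bind> (\<lambda>y. j (b, y))) C \<partial>B)" .
qed

section \<open>Relatively independent joinings over a base\<close>

context
  fixes L :: "'l measure" and M1 :: "'x measure" and M2 :: "'y measure" and k1 k2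
  assumes L: "prob_space L"
    and k1 [measurable]: "k1 \<in> L \<rightarrow>\<^sub>M prob_algebra M1" and k2 [measurable]: "k2 \<in> L \<rightarrow>\<^sub>M prob_algebra M2"
begin

lemma rij_kernel [measurable]: "(\<lambda>y. k1 y \<Otimes>\<^sub>M k2 y) \<in> L \<rightarrow>\<^sub>M prob_algebra (M1 \<Otimes>\<^sub>M M2)"
  by measurable

lemma sets_rij [measurable_cong]: "sets (relatively_independent_joining L k1 k2) = sets (M1 \<Otimes>\<^sub>M M2)"
  unfolding relatively_independent_joining_def
  by (rule sets_bind'[OF _ rij_kernel]) (simp add: space_prob_algebra L)

lemma prob_space_rij: "prob_space (relatively_independent_joining L k1 k2)"
  unfolding relatively_independent_joining_def
  by (rule prob_space_bind'[OF _ rij_kernel]) (simp add: space_prob_algebra L)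

lemma measure_rij:
  assumes A: "A \<in> sets M1" and C: "C \<in> sets M2"
  shows "measure (relatively_independent_joining L k1 k2) (A \<times> C) = (\<integral>y. measure (k1 y) A * measure (k2 y) C \<partial>L)"
proof -
  have "measure (relatively_independent_joining L k1 k2) (A \<times> C) = (\<integral>y. measure (k1 y \<Otimes>\<^sub>M k2 y) (A \<times> C) \<partial>L)"
    unfolding relatively_independent_joining_def
    by (rule measure_bind_kernel[OF L rij_kernel]) (use A C in auto)
  also have "\<dots> = (\<integral>y. measure (k1 y) A * measure (k2 y) C \<partial>L)"
  proof (intro Bochner_Integration.integral_cong refl)
    fix y assume y: "y \<in> space L"
    interpret k1: prob_space "k1 y" by (rule prob_kernelD(1)[OF k1 y])
    interpret k2: prob_space "k2 y" by (rule prob_kernelD(1)[OF k2 y])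
    show "measure (k1 y \<Otimes>\<^sub>M k2 y) (A \<times> C) = measure (k1 y) A * measure (k2 y) C"
      using A C prob_kernelD(2)[OF k1 y] prob_kernelD(2)[OF k2 y]
      by (simp add: measure_def k2.emeasure_pair_measure_Times enn2real_mult)
  qed
  finally show ?thesis .
qed

lemma AE_rij:
  assumes [measurable]: "Measurable.pred (M1 \<Otimes>\<^sub>M M2) Q"
    and ae: "AE y in L. AE x in k1 y. AE x' in k2 y. Q (x, x')"
  shows "AE w in relatively_independent_joining L k1 k2. Q w"
proof -
  have "AE y in L. AE w in k1 y \<Otimes>\<^sub>M k2 y. Q w"
    using ae AE_space
  proof eventually_elim
    case (elim y)
    interpret k1: prob_space "k1 y" by (rule prob_kernelD(1)[OF k1 elim(2)])
    interpret k2: prob_space "k2 y" by (rule prob_kernelD(1)[OF k2 elim(2)])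
    interpret pair_sigma_finite "k1 y" "k2 y" ..
    have "sets (k1 y \<Otimes>\<^sub>M k2 y) = sets (M1 \<Otimes>\<^sub>M M2)"
      by (intro sets_pair_measure_cong prob_kernelD(2)[OF k1 elim(2)] prob_kernelD(2)[OF k2 elim(2)])
    then have "Measurable.pred (k1 y \<Otimes>\<^sub>M k2 y) Q"
      using assms(1) measurable_cong_sets by blast
    then show ?case
      using elim(1) by (intro AE_pair_measure) (auto simp: pred_def)
  qed
  then show ?thesis
    unfolding relatively_independent_joining_def
    by (subst AE_bind[OF measurable_prob_algebraD[OF rij_kernel]]) auto
qed

text \<open>The base \<open>L\<close> need not be \<open>Z\<close>: it only carries a map
  \<open>r\<close> to \<open>Z\<close> through which both fibre families lie over the same point.
  With base \<open>Z\<close> this gives the relatively independent joining over \<open>Z\<close>;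
  with base an ergodic system \<open>Y\<close> it joins two components through their conditional
  laws given \<open>y\<close>.\<close>

lemma joining_rij:
  assumes S: "\<And>g. g \<in> carrier G \<Longrightarrow> S g \<in> L \<rightarrow>\<^sub>M L" "\<And>g. g \<in> carrier G \<Longrightarrow> distr L L (S g) = L"
    and T1: "\<And>g. g \<in> carrier G \<Longrightarrow> T1 g \<in> M1 \<rightarrow>\<^sub>M M1" and T2: "\<And>g. g \<in> carrier G \<Longrightarrow> T2 g \<in> M2 \<rightarrow>\<^sub>M M2"
    and eq1: "\<And>g. g \<in> carrier G \<Longrightarrow> AE y in L. k1 (S g y) = distr (k1 y) M1 (T1 g)"
    and eq2: "\<And>g. g \<in> carrier G \<Longrightarrow> AE y in L. k2 (S g y) = distr (k2 y) M2 (T2 g)"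
    and retr: "real_retract Z \<zeta> \<theta>" and \<pi>1 [measurable]: "\<pi>1 \<in> M1 \<rightarrow>\<^sub>M Z" and \<pi>2 [measurable]: "\<pi>2 \<in> M2 \<rightarrow>\<^sub>M Z"
    and ae1: "AE y in L. AE x in k1 y. \<pi>1 x = r y" and ae2: "AE y in L. AE x in k2 y. \<pi>2 x = r y"
    and c1: "c1 = L \<bind> k1" and c2: "c2 = L \<bind> k2"
  shows "joining_over G c1 T1 \<pi>1 c2 T2 \<pi>2 (relatively_independent_joining L k1 k2)"
proof -
  note [measurable] = real_retractD(1)[OF retr]
  let ?J = "relatively_independent_joining L k1 k2"
  interpret L: prob_space L by (rule L)
  interpret J: prob_space ?J by (rule prob_space_rij)
  have L': "L \<in> space (prob_algebra L)" by (simp add: space_prob_algebra L)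
  have sc [measurable_cong]: "sets c1 = sets M1" "sets c2 = sets M2"
    unfolding c1 c2 by (rule sets_bind'[OF L'], measurable)+
  have prob1: "measure (k1 y) (space M1) = 1" if "y \<in> space L" for y
    using prob_space.prob_space[OF prob_kernelD(1)[OF k1 that]] prob_kernelD(3)[OF k1 that] by simp
  have prob2: "measure (k2 y) (space M2) = 1" if "y \<in> space L" for y
    using prob_space.prob_space[OF prob_kernelD(1)[OF k2 that]] prob_kernelD(3)[OF k2 that] by simp
  have spJ: "space ?J = space M1 \<times> space M2"
    using sets_eq_imp_space_eq[OF sets_rij] by (simp add: space_pair_measure)
  interpret c1: prob_space c1 unfolding c1 by (rule prob_space_bind'[OF L' k1])
  interpret c2: prob_space c2 unfolding c2 by (rule prob_space_bind'[OF L' k2])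
  have sc12: "sets ?J = sets (c1 \<Otimes>\<^sub>M c2)"
    unfolding sets_rij by (rule sets_pair_measure_cong) (simp_all add: sc)
  have sp12: "space c1 = space M1" "space c2 = space M2"
    using sc by (auto dest: sets_eq_imp_space_eq)
  have fst: "distr ?J c1 fst = c1"
  proof (rule distr_fst_eqI[OF sc12 J.prob_space_axioms c1.prob_space_axioms])
    fix A assume "A \<in> sets c1"
    then have A: "A \<in> sets M1" by (simp add: sc)
    have "measure ?J (A \<times> space c2) = (\<integral>y. measure (k1 y) A * measure (k2 y) (space M2) \<partial>L)"
      unfolding sp12 by (rule measure_rij) (use A in auto)
    also have "\<dots> = (\<integral>y. measure (k1 y) A \<partial>L)" by (intro Bochner_Integration.integral_cong) (auto simp: prob2)
    also have "\<dots> = measure c1 A" unfolding c1 by (rule measure_bind_kernel[OF L k1 A, symmetric])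
    finally show "measure ?J (A \<times> space c2) = measure c1 A" .
  qed
  have snd: "distr ?J c2 snd = c2"
  proof (rule distr_snd_eqI[OF sc12 J.prob_space_axioms c2.prob_space_axioms])
    fix C assume "C \<in> sets c2"
    then have C: "C \<in> sets M2" by (simp add: sc)
    have "measure ?J (space c1 \<times> C) = (\<integral>y. measure (k1 y) (space M1) * measure (k2 y) C \<partial>L)"
      unfolding sp12 by (rule measure_rij) (use C in auto)
    also have "\<dots> = (\<integral>y. measure (k2 y) C \<partial>L)" by (intro Bochner_Integration.integral_cong) (auto simp: prob1)
    also have "\<dots> = measure c2 C" unfolding c2 by (rule measure_bind_kernel[OF L k2 C, symmetric])
    finally show "measure ?J (space c1 \<times> C) = measure c2 C" .
  qed
  have inv: "distr ?J ?J (map_prod (T1 g) (T2 g)) = ?J" if g: "g \<in> carrier G" for g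
  proof -
    note [measurable] = T1[OF g] T2[OF g] S(1)[OF g]
    have mp [measurable]: "map_prod (T1 g) (T2 g) \<in> ?J \<rightarrow>\<^sub>M ?J" by (simp add: map_prod_def) measurable
    interpret D: prob_space "distr ?J ?J (map_prod (T1 g) (T2 g))" by (rule J.prob_space_distr[OF mp])
    have mk: "measure (distr (k y) N V) A = measure (k y) (V -` A \<inter> space N)"
      if "k \<in> L \<rightarrow>\<^sub>M prob_algebra N" "V \<in> N \<rightarrow>\<^sub>M N" "A \<in> sets N" "y \<in> space L" for k :: "'l \<Rightarrow> 'z measure" and N V A y
    proof -
      note ky = prob_kernelD[OF that(1,4)]
      have "V \<in> k y \<rightarrow>\<^sub>M N" using measurable_cong_sets[OF ky(2) refl] that(2) by blast
      then show ?thesis using ky that(3) by (simp add: measure_distr)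
    qed
    show ?thesis
    proof (rule measure_eqI_rect[OF D.finite_measure_axioms, of M1 M2])
      fix A C assume A [measurable]: "A \<in> sets M1" and C [measurable]: "C \<in> sets M2"
      let ?A = "T1 g -` A \<inter> space M1" and ?C = "T2 g -` C \<inter> space M2"
      have "measure (distr ?J ?J (map_prod (T1 g) (T2 g))) (A \<times> C) = measure ?J (?A \<times> ?C)"
        by (subst measure_distr[OF mp]) (auto simp: sets_rij spJ intro!: arg_cong[where f = "measure ?J"])
      also have "\<dots> = (\<integral>y. measure (k1 y) ?A * measure (k2 y) ?C \<partial>L)" by (rule measure_rij) measurable
      \<comment> \<open>Equivariance moves the action from the fibres to the base, where it is
        absorbed by the invariance of \<open>L\<close>.\<close>
      also have "\<dots> = (\<integral>y. measure (k1 (S g y)) A * measure (k2 (S g y)) C \<partial>L)"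
      proof (rule integral_cong_AE)
        show "AE y in L. measure (k1 y) ?A * measure (k2 y) ?C = measure (k1 (S g y)) A * measure (k2 (S g y)) C"
          using eq1[OF g] eq2[OF g] AE_space
          by eventually_elim (simp add: mk[OF k1 T1[OF g] A] mk[OF k2 T2[OF g] C])
      qed measurable
      also have "\<dots> = (\<integral>y. measure (k1 y) A * measure (k2 y) C \<partial>distr L L (S g))"
        by (rule integral_distr[symmetric]) measurable
      also have "\<dots> = measure ?J (A \<times> C)"
        using S(2)[OF g] by (simp add: measure_rij)
      finally show "emeasure (distr ?J ?J (map_prod (T1 g) (T2 g))) (A \<times> C) = emeasure ?J (A \<times> C)"
        by (simp add: D.emeasure_eq_measure J.emeasure_eq_measure)
    qed (simp_all add: sets_rij)
  qed
  have "AE w in ?J. \<zeta> (\<pi>1 (fst w)) = \<zeta> (\<pi>2 (snd w))"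
  proof (rule AE_rij)
    show "AE y in L. AE x in k1 y. AE x' in k2 y. \<zeta> (\<pi>1 (fst (x, x'))) = \<zeta> (\<pi>2 (snd (x, x')))"
      using ae1 ae2
    proof eventually_elim
      case (elim y)
      from elim(1) show ?case
      proof eventually_elim
        case (elim x)
        from \<open>AE x in k2 y. \<pi>2 x = r y\<close> show ?case by eventually_elim (simp add: elim)
      qed
    qed
  qed measurable
  then have "AE w in ?J. \<pi>1 (fst w) = \<pi>2 (snd w)"
    using AE_space
  proof eventually_elim
    case (elim w)
    then have "\<pi>1 (fst w) \<in> space Z" "\<pi>2 (snd w) \<in> space Z"
      using measurable_space[OF \<pi>1] measurable_space[OF \<pi>2] by (auto simp: spJ)
    then show ?case using elim(1) real_retractD(3)[OF retr] by metis
  qed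
  then have "AE (x, y) in ?J. \<pi>1 x = \<pi>2 y" by (simp add: case_prod_beta)
  then show ?thesis
    using J.prob_space_axioms sc12 fst snd inv by (simp add: joining_over_def)
qed

end

section \<open>Disintegrations over the factor\<close>

lemma disintegration_equivariant:
  assumes G: "group G" and K: "pmp_action G K R" and M: "pmp_action G M T" and fm: "factor_map G K R M T \<pi>"
    and rK: "real_retract K \<zeta> \<theta>" and rM: "real_retract M \<phi> \<psi>"
    and m: "disintegration K M \<pi> m" and g: "g \<in> carrier G"
  shows "AE z in K. m (R g z) = distr (m z) M (T g)"
proof -
  interpret group G by fact
  have \<pi> [measurable]: "\<pi> \<in> M \<rightarrow>\<^sub>M K" and d: "distr M K \<pi> = K"
    and eq: "AE x in M. \<pi> (T g x) = R g (\<pi> x)"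
    using fm g by (auto simp: factor_map_def)
  have cl: "conditional_law K M M \<pi> (\<lambda>x. x) m"
    using m disintegration_iff_conditional_law[OF rK pmp_actionD(1)[OF M] \<pi> d] by simp
  have Kp: "prob_space K" and Mp: "prob_space M" using K M by (auto dest: pmp_actionD)
  have gi: "inv\<^bsub>G\<^esub> g \<in> carrier G" using g by simp
  show ?thesis
    by (rule conditional_law_equivariant[OF rM Kp Mp \<pi> _ cl
          pmp_actionD(2)[OF M g] pmp_actionD(3)[OF M g] pmp_actionD(2)[OF K g] pmp_actionD(3)[OF K g]
          pmp_actionD(2)[OF K gi] pmp_action_inv(1)[OF K G g] pmp_actionD(2)[OF M g]])
      (use eq in auto)
qed

lemma disintegration_unique:
  assumes rK: "real_retract K \<zeta> \<theta>" and rM: "real_retract M \<phi> \<psi>" and M: "prob_space M"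
    and \<pi>: "\<pi> \<in> M \<rightarrow>\<^sub>M K" "distr M K \<pi> = K"
    and m: "disintegration K M \<pi> m" and m': "disintegration K M \<pi> m'"
  shows "AE z in K. m z = m' z"
proof (rule kernel_AE_eqI[OF rM])
  show K: "prob_space K" using prob_space.prob_space_distr[OF M \<pi>(1)] \<pi>(2) by simp
  have cl: "conditional_law K M M \<pi> (\<lambda>x. x) m" "conditional_law K M M \<pi> (\<lambda>x. x) m'"
    using m m' disintegration_iff_conditional_law[OF rK M \<pi>] by auto
  show km: "m \<in> K \<rightarrow>\<^sub>M prob_algebra M" "m' \<in> K \<rightarrow>\<^sub>M prob_algebra M"
    using m m' by (auto simp: disintegration_def)
  note law = conditional_law_iff[OF K M \<pi>(1) measurable_ident_sets[OF refl], THEN iffD1, rule_format]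
  show "(\<integral>x. indicator A x * measure (m x) C \<partial>K) = (\<integral>x. indicator A x * measure (m' x) C \<partial>K)"
    if "A \<in> sets K" "C \<in> sets M" for A C
    using law[OF km(1) cl(1) that] law[OF km(2) cl(2) that] by simp
qed

lemma disintegration_exists:
  assumes rK: "real_retract K \<zeta> \<theta>" and rM: "real_retract M \<phi> \<psi>" and M: "prob_space M"
    and \<pi>: "\<pi> \<in> M \<rightarrow>\<^sub>M K" "distr M K \<pi> = K"
  shows "\<exists>m. disintegration K M \<pi> m"
proof -
  have K: "prob_space K" using prob_space.prob_space_distr[OF M \<pi>(1)] \<pi>(2) by simp
  show ?thesis
    using conditional_law_exists[OF rM K M \<pi>(1) measurable_ident_sets[OF refl] \<pi>(2)]
      disintegration_iff_conditional_law[OF rK M \<pi>] by blast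
qed

lemma joining_rij_disintegration:
  assumes G: "group G" and K: "pmp_action G K R" and M: "pmp_action G M T" and N: "pmp_action G N S"
    and f\<pi>: "factor_map G K R M T \<pi>" and f\<rho>: "factor_map G K R N S \<rho>"
    and rK: "real_retract K \<zeta> \<theta>" and rM: "real_retract M \<phi> \<psi>" and rN: "real_retract N \<phi>' \<psi>'"
    and m: "disintegration K M \<pi> m" and n: "disintegration K N \<rho> n"
  shows "joining_over G M T \<pi> N S \<rho> (relatively_independent_joining K m n)"
proof (rule joining_rij[OF pmp_actionD(1)[OF K], where ?M1.0 = M and ?M2.0 = N and S = R and r = "\<lambda>z. z"])
  show "AE z in K. m (R g z) = distr (m z) M (T g)" if "g \<in> carrier G" for g
    by (rule disintegration_equivariant[OF G K M f\<pi> rK rM m that])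
  show "AE z in K. n (R g z) = distr (n z) N (S g)" if "g \<in> carrier G" for g
    by (rule disintegration_equivariant[OF G K N f\<rho> rK rN n that])
qed (use m n f\<pi> f\<rho> rK K M N in \<open>auto simp: disintegration_def factor_map_def intro: pmp_actionD(2,3)\<close>)

lemma conditional_law_integral:
  assumes P: "prob_space P" and J: "prob_space J" and q [measurable]: "q \<in> J \<rightarrow>\<^sub>M P" and \<xi> [measurable]: "\<xi> \<in> J \<rightarrow>\<^sub>M N"
    and cl: "conditional_law P N J q \<xi> k" and C [measurable]: "C \<in> sets N"
    and g [measurable]: "g \<in> borel_measurable P" and g01: "\<And>x. x \<in> space P \<Longrightarrow> 0 \<le> g x" "\<And>x. x \<in> space P \<Longrightarrow> g x \<le> (1::real)"
  shows "(\<integral>w. indicator C (\<xi> w) * g (q w) \<partial>J) = (\<integral>x. g x * measure (k x) C \<partial>P)"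
proof -
  interpret P: prob_space P by fact
  interpret J: prob_space J by fact
  have k [measurable]: "k \<in> P \<rightarrow>\<^sub>M prob_algebra N"
    and D: "distr J (P \<Otimes>\<^sub>M N) (\<lambda>w. (q w, \<xi> w)) = semidirect P N k"
    using cl by (auto simp: conditional_law_def)
  have gq: "0 \<le> g (q w)" "g (q w) \<le> 1" if "w \<in> space J" for w
    using g01 measurable_space[OF q that] by auto
  have "ennreal (\<integral>w. indicator C (\<xi> w) * g (q w) \<partial>J) = (\<integral>\<^sup>+w. ennreal (indicator C (\<xi> w) * g (q w)) \<partial>J)"
    using gq by (intro nn_integral_eq_integral[symmetric] J.integrable_const_bound[where B=1]) (auto simp: indicator_def)
  also have "\<dots> = (\<integral>\<^sup>+w. ennreal (indicator C (snd w) * g (fst w)) \<partial>distr J (P \<Otimes>\<^sub>M N) (\<lambda>w. (q w, \<xi> w)))"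
    by (subst nn_integral_distr) auto
  also have "\<dots> = (\<integral>\<^sup>+x. \<integral>\<^sup>+y. ennreal (indicator C (snd (x, y)) * g (fst (x, y))) \<partial>k x \<partial>P)"
    unfolding D by (rule nn_integral_semidirect[OF P k]) measurable
  also have "\<dots> = (\<integral>\<^sup>+x. ennreal (g x * measure (k x) C) \<partial>P)"
  proof (rule nn_integral_cong)
    fix x assume x: "x \<in> space P"
    interpret kx: prob_space "k x" by (rule prob_kernelD(1)[OF k x])
    have "(\<integral>\<^sup>+y. ennreal (indicator C (snd (x, y)) * g (fst (x, y))) \<partial>k x) = (\<integral>\<^sup>+y. ennreal (g x) * indicator C y \<partial>k x)"
      by (intro nn_integral_cong) (auto simp: indicator_def)
    also have "\<dots> = ennreal (g x) * emeasure (k x) C"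
      using prob_kernelD(2)[OF k x] by (intro nn_integral_cmult_indicator) simp
    finally show "(\<integral>\<^sup>+y. ennreal (indicator C (snd (x, y)) * g (fst (x, y))) \<partial>k x) = ennreal (g x * measure (k x) C)"
      using g01(1)[OF x] by (simp add: kx.emeasure_eq_measure ennreal_mult)
  qed
  also have "\<dots> = ennreal (\<integral>x. g x * measure (k x) C \<partial>P)"
    using g01 prob_space.prob_le_1[OF prob_kernelD(1)[OF k]]
    by (intro nn_integral_eq_integral P.integrable_const_bound[where B=1]) (auto simp: abs_mult intro!: AE_I2 mult_le_one)
  finally show ?thesis
    using gq g01 by (subst (asm) ennreal_inj) (auto intro!: integral_nonneg_AE AE_I2)
qed

section \<open>Averages over components and over pairs of components\<close>

lemma conditional_law_marginal:
  assumes B: "prob_space B" and L: "prob_space L" and J: "prob_space J"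
    and u [measurable]: "u \<in> J \<rightarrow>\<^sub>M B" and v [measurable]: "v \<in> J \<rightarrow>\<^sub>M L" and \<xi> [measurable]: "\<xi> \<in> J \<rightarrow>\<^sub>M M"
    and j: "conditional_law (B \<Otimes>\<^sub>M L) M J (\<lambda>w. (u w, v w)) \<xi> j"
  shows "conditional_law L M J v \<xi> (\<lambda>y. B \<bind> (\<lambda>b. j (b, y)))"
proof -
  interpret B: prob_space B by fact
  interpret L: prob_space L by fact
  interpret BL: pair_prob_space B L ..
  have jm [measurable]: "j \<in> B \<Otimes>\<^sub>M L \<rightarrow>\<^sub>M prob_algebra M"
    using j by (simp add: conditional_law_def)
  have B': "B \<in> space (prob_algebra B)" using B by (simp add: space_prob_algebra)
  have bm: "(\<lambda>y. B \<bind> (\<lambda>b. j (b, y))) \<in> L \<rightarrow>\<^sub>M prob_algebra M"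
    by (rule measurable_bind_prob_space2[where N = B]) (use B' in \<open>simp_all add: measurable_const\<close>)
  show ?thesis
    unfolding conditional_law_iff[OF L J v \<xi> bm]
  proof safe
    fix E C assume E [measurable]: "E \<in> sets L" and C [measurable]: "C \<in> sets M"
    have "measure J {w \<in> space J. v w \<in> E \<and> \<xi> w \<in> C} = measure J {w \<in> space J. (u w, v w) \<in> space B \<times> E \<and> \<xi> w \<in> C}"
      using measurable_space[OF u] by (auto intro!: arg_cong[where f = "measure J"])
    also have "\<dots> = (\<integral>x. indicator (space B \<times> E) x * measure (j x) C \<partial>(B \<Otimes>\<^sub>M L))"
      using conditional_law_iff[OF BL.prob_space_axioms J _ \<xi> jm, THEN iffD1, OF _ j, rule_format, of "space B \<times> E" C] C
      by simp
    also have "\<dots> = (\<integral>y. \<integral>b. indicator (space B \<times> E) (b, y) * measure (j (b, y)) C \<partial>B \<partial>L)"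
      using BL.integral_snd[of "\<lambda>b y. indicator (space B \<times> E) (b, y) * measure (j (b, y)) C"]
        integrable_kernel(2)[OF BL.finite_measure_axioms jm, of "space B \<times> E" C]
      by (simp add: case_prod_unfold)
    also have "\<dots> = (\<integral>y. indicator E y * measure (B \<bind> (\<lambda>b. j (b, y))) C \<partial>L)"
    proof (intro Bochner_Integration.integral_cong refl)
      fix y assume y: "y \<in> space L"
      have "(\<integral>b. indicator (space B \<times> E) (b, y) * measure (j (b, y)) C \<partial>B) = (\<integral>b. indicator E y * measure (j (b, y)) C \<partial>B)"
        by (intro Bochner_Integration.integral_cong) (auto simp: indicator_def)
      also have "\<dots> = indicator E y * measure (B \<bind> (\<lambda>b. j (b, y))) C"
        using measure_bind_kernel[OF B _ C, of "\<lambda>b. j (b, y)"] y by simp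
      finally show "(\<integral>b. indicator (space B \<times> E) (b, y) * measure (j (b, y)) C \<partial>B) = indicator E y * measure (B \<bind> (\<lambda>b. j (b, y))) C" .
    qed
    finally show "measure J {w \<in> space J. v w \<in> E \<and> \<xi> w \<in> C} = (\<integral>y. indicator E y * measure (B \<bind> (\<lambda>b. j (b, y))) C \<partial>L)" .
  qed
qed

text \<open>The passage from one component to two: the squared average over \<open>b\<close> is the
  average of products over independent \<open>b1\<close> and \<open>b2\<close>, and for fixed
  \<open>b1\<close>, \<open>b2\<close> the inner integral is the mass of a rectangle under a joining
  of the two components.\<close>

lemma integral_pair_square:
  fixes h :: "'b \<Rightarrow> 'l \<Rightarrow> real"
  assumes B: "prob_space B" and L: "prob_space L"
    and h [measurable]: "(\<lambda>(b, y). h b y) \<in> borel_measurable (B \<Otimes>\<^sub>M L)"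
    and h01: "\<And>b y. b \<in> space B \<Longrightarrow> y \<in> space L \<Longrightarrow> 0 \<le> h b y" "\<And>b y. b \<in> space B \<Longrightarrow> y \<in> space L \<Longrightarrow> h b y \<le> 1"
  shows "(\<integral>w. \<integral>y. h (fst w) y * h (snd w) y \<partial>L \<partial>(B \<Otimes>\<^sub>M B)) = (\<integral>y. (\<integral>b. h b y \<partial>B)\<^sup>2 \<partial>L)"
proof -
  interpret B: prob_space B by fact
  interpret L: prob_space L by fact
  interpret BB: pair_prob_space B B ..
  interpret BBL: pair_prob_space "B \<Otimes>\<^sub>M B" L ..
  have "(\<lambda>(w, y). h (fst w) y * h (snd w) y) \<in> borel_measurable ((B \<Otimes>\<^sub>M B) \<Otimes>\<^sub>M L)"
    by measurable
  then have "integrable ((B \<Otimes>\<^sub>M B) \<Otimes>\<^sub>M L) (\<lambda>(w, y). h (fst w) y * h (snd w) y)"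
    using h01 by (intro BBL.integrable_const_bound[where B=1])
      (auto simp: abs_mult space_pair_measure intro!: AE_I2 mult_le_one)
  then have "(\<integral>w. \<integral>y. h (fst w) y * h (snd w) y \<partial>L \<partial>(B \<Otimes>\<^sub>M B)) =
      (\<integral>y. \<integral>w. h (fst w) y * h (snd w) y \<partial>(B \<Otimes>\<^sub>M B) \<partial>L)"
    by (rule BBL.Fubini_integral[symmetric])
  also have "\<dots> = (\<integral>y. (\<integral>b. h b y \<partial>B)\<^sup>2 \<partial>L)"
  proof (intro Bochner_Integration.integral_cong refl)
    fix y assume y [measurable]: "y \<in> space L"
    have hy [measurable]: "(\<lambda>b. h b y) \<in> borel_measurable B" by measurable
    have "integrable (B \<Otimes>\<^sub>M B) (\<lambda>w. h (fst w) y * h (snd w) y)"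
      using h01 y by (intro BB.integrable_const_bound[where B=1])
        (auto simp: abs_mult space_pair_measure intro!: AE_I2 mult_le_one)
    then have "(\<integral>w. h (fst w) y * h (snd w) y \<partial>(B \<Otimes>\<^sub>M B)) = (\<integral>b. \<integral>b'. h b y * h b' y \<partial>B \<partial>B)"
      using BB.integral_fst'[of "\<lambda>w. h (fst w) y * h (snd w) y"] by simp
    then show "(\<integral>w. h (fst w) y * h (snd w) y \<partial>(B \<Otimes>\<^sub>M B)) = (\<integral>b. h b y \<partial>B)\<^sup>2"
      by (simp add: power2_eq_square)
  qed
  finally show ?thesis .
qed

lemma AE_pair_both:
  assumes B: "prob_space B" and ae: "AE b in B. Q b"
  shows "AE w in B \<Otimes>\<^sub>M B. Q (fst w) \<and> Q (snd w)"
proof -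
  interpret B: prob_space B by fact
  interpret BB: pair_prob_space B B ..
  have times: "measure (B \<Otimes>\<^sub>M B) (A \<times> C) = measure B A * measure B C" if "A \<in> sets B" "C \<in> sets B" for A C
    using that by (simp add: measure_def B.emeasure_pair_measure_Times enn2real_mult)
  have fst: "distr (B \<Otimes>\<^sub>M B) B fst = B"
    by (rule distr_fst_eqI[OF refl BB.prob_space_axioms B]) (simp add: times B.prob_space)
  have snd: "distr (B \<Otimes>\<^sub>M B) B snd = B"
    by (rule distr_snd_eqI[OF refl BB.prob_space_axioms B]) (simp add: times B.prob_space)
  have "AE w in B \<Otimes>\<^sub>M B. Q (fst w)" by (rule AE_distrD[where M' = B]) (simp, unfold fst, rule ae)
  moreover have "AE w in B \<Otimes>\<^sub>M B. Q (snd w)" by (rule AE_distrD[where M' = B]) (simp, unfold snd, rule ae)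
  ultimately show ?thesis by eventually_elim simp
qed

section \<open>The components of an extension\<close>

locale decomposed_extension =
  fixes G :: "('g, 'm) monoid_scheme"
    and K :: "'z measure" and R :: "'g \<Rightarrow> 'z \<Rightarrow> 'z"
    and M :: "'x measure" and T :: "'g \<Rightarrow> 'x \<Rightarrow> 'x" and \<pi> :: "'x \<Rightarrow> 'z"
    and B :: "'b measure" and p :: "'x \<Rightarrow> 'b" and c :: "'b \<Rightarrow> 'x measure"
    and \<zeta> \<theta> \<phi> \<psi> \<beta> \<gamma>
  assumes G: "group G" "countable (carrier G)"
    and K: "pmp_action G K R" and ergK: "ergodic_action G K R"
    and M: "pmp_action G M T" and f\<pi>: "factor_map G K R M T \<pi>"
    and decomp: "ergodic_decomposition G M T B p c"
    and rK: "real_retract K \<zeta> \<theta>" and rM: "real_retract M \<phi> \<psi>" and rB: "real_retract B \<beta> \<gamma>"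
begin

lemma K_prob: "prob_space K" and M_prob: "prob_space M" and B_prob: "prob_space B"
  using K M decomp by (auto simp: ergodic_decomposition_def dest: pmp_actionD)

lemma \<pi>_measurable [measurable]: "\<pi> \<in> M \<rightarrow>\<^sub>M K" and \<pi>_distr: "distr M K \<pi> = K"
  and \<pi>_equivariant: "g \<in> carrier G \<Longrightarrow> AE x in M. \<pi> (T g x) = R g (\<pi> x)"
  using f\<pi> by (auto simp: factor_map_def)

lemma p_measurable [measurable]: "p \<in> M \<rightarrow>\<^sub>M B" and p_distr: "distr M B p = B"
  and p_invariant: "g \<in> carrier G \<Longrightarrow> AE x in M. p (T g x) = p x"
  and c_disintegration: "disintegration B M p c"
  and c_kernel [measurable]: "c \<in> B \<rightarrow>\<^sub>M prob_algebra M"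
  and c_pmp: "b \<in> space B \<Longrightarrow> pmp_action G (c b) T"
  and c_ergodic: "b \<in> space B \<Longrightarrow> ergodic_action G (c b) T"
  using decomp by (auto simp: ergodic_decomposition_def disintegration_def)

lemma sets_c: "b \<in> space B \<Longrightarrow> sets (c b) = sets M"
  by (rule prob_kernelD(2)[OF c_kernel])

lemma real_retract_c: "b \<in> space B \<Longrightarrow> real_retract (c b) \<phi> \<psi>"
  using rM real_retract_cong[OF sets_c] by blast

lemma c_law: "conditional_law B M M p (\<lambda>x. x) c"
  using disintegration_iff_conditional_law[OF rB M_prob p_measurable p_distr] c_disintegration by simp

lemma measure_c:
  assumes "E \<in> sets B" "A \<in> sets M"
  shows "measure M {x \<in> space M. p x \<in> E \<and> x \<in> A} = (\<integral>b. indicator E b * measure (c b) A \<partial>B)"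
  using conditional_law_iff[OF B_prob M_prob p_measurable _ c_kernel, THEN iffD1, OF _ c_law] assms by simp

lemma AE_c:
  assumes "Measurable.pred M Q" "AE x in M. Q x"
  shows "AE b in B. AE x in c b. Q x"
proof -
  have "M = B \<bind> c" using c_disintegration by (simp add: disintegration_def)
  then show ?thesis
    using assms(2) AE_bind[OF measurable_prob_algebraD[OF c_kernel] assms(1)] by metis
qed

lemma AE_c_equivariant:
  assumes g: "g \<in> carrier G"
  shows "AE b in B. AE x in c b. \<pi> (T g x) = R g (\<pi> x)"
proof -
  note [measurable] = real_retractD(1)[OF rK] pmp_actionD(2)[OF M g] pmp_actionD(2)[OF K g]
  have "AE b in B. AE x in c b. \<zeta> (\<pi> (T g x)) = \<zeta> (R g (\<pi> x))"
    using \<pi>_equivariant[OF g] by (intro AE_c) (measurable, auto elim: AE_mp)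
  then show ?thesis
    using AE_space
  proof eventually_elim
    case (elim b)
    from elim(1) AE_space show ?case
    proof eventually_elim
      case (elim x)
      then have x: "x \<in> space M" using prob_kernelD(3)[OF c_kernel \<open>b \<in> space B\<close>] by simp
      have "\<pi> (T g x) \<in> space K" "R g (\<pi> x) \<in> space K"
        using x measurable_space[OF \<pi>_measurable] measurable_space[OF pmp_actionD(2)[OF M g]]
          measurable_space[OF pmp_actionD(2)[OF K g]] by auto
      then show ?case using elim(1) real_retractD(3)[OF rK] by metis
    qed
  qed
qed

text \<open>The component map is invariant and \<open>Z\<close> is ergodic. Hence the product of
  \<open>B\<close> and \<open>K\<close> is the law of the pair, and knowing the component does not
  alter the law of the projection to \<open>Z\<close>.\<close>

lemma p_\<pi>_independent:
  assumes "E \<in> sets B" "C \<in> sets K"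
  shows "measure M {x \<in> space M. p x \<in> E \<and> \<pi> x \<in> C} = measure B E * measure K C"
proof -
  have "measure M {x \<in> space M. p x \<in> E \<and> \<pi> x \<in> C} = measure M {x \<in> space M. p x \<in> E} * measure K C"
    by (rule invariant_independent_of_ergodic[OF G K ergK M_prob p_measurable \<pi>_measurable \<pi>_distr
          pmp_actionD(2)[OF M] pmp_actionD(3)[OF M] p_invariant \<pi>_equivariant assms])
  moreover have "measure B E = measure M {x \<in> space M. p x \<in> E}"
    using measure_distr[OF p_measurable assms(1)] unfolding p_distr
    by (auto simp: vimage_def Int_def conj_commute)
  ultimately show ?thesis by simp
qed

text \<open>The law of \<open>\<pi>\<close> under \<open>c b\<close> is a kernel in
  \<open>b\<close>, and by independence it has the same integrals as the constant kernel
  \<open>K\<close>. Equivariance passes to almost every component for one \<open>g\<close> at a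
  time, and there are countably many.\<close>

lemma AE_factor_map_c: "AE b in B. factor_map G K R (c b) T \<pi>"
proof -
  interpret B: prob_space B by (rule B_prob)
  have "AE b in B. distr (c b) K \<pi> = K"
  proof (rule kernel_AE_eqI[OF rK B_prob])
    show "(\<lambda>b. distr (c b) K \<pi>) \<in> B \<rightarrow>\<^sub>M prob_algebra K" by measurable
    show "(\<lambda>b. K) \<in> B \<rightarrow>\<^sub>M prob_algebra K"
      by (rule measurable_const) (simp add: space_prob_algebra K_prob)
    fix E C assume E [measurable]: "E \<in> sets B" and C [measurable]: "C \<in> sets K"
    have "(\<integral>b. indicator E b * measure (distr (c b) K \<pi>) C \<partial>B) = (\<integral>b. indicator E b * measure (c b) (\<pi> -` C \<inter> space M) \<partial>B)"
    proof (intro Bochner_Integration.integral_cong refl)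
      fix b assume b: "b \<in> space B"
      have "\<pi> \<in> c b \<rightarrow>\<^sub>M K" using measurable_cong_sets[OF sets_c[OF b] refl] \<pi>_measurable by blast
      then show "indicator E b * measure (distr (c b) K \<pi>) C = indicator E b * measure (c b) (\<pi> -` C \<inter> space M)"
        using prob_kernelD(3)[OF c_kernel b] by (simp add: measure_distr)
    qed
    also have "\<dots> = measure M {x \<in> space M. p x \<in> E \<and> x \<in> \<pi> -` C \<inter> space M}"
      by (rule measure_c[symmetric]) measurable
    also have "\<dots> = measure M {x \<in> space M. p x \<in> E \<and> \<pi> x \<in> C}"
      by (auto intro!: arg_cong[where f = "measure M"])
    also have "\<dots> = (\<integral>b. indicator E b * measure K C \<partial>B)"
      by (simp add: p_\<pi>_independent)
    finally show "(\<integral>b. indicator E b * measure (distr (c b) K \<pi>) C \<partial>B) = (\<integral>b. indicator E b * measure K C \<partial>B)" .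
  qed
  moreover have "AE b in B. \<forall>g\<in>carrier G. AE x in c b. \<pi> (T g x) = R g (\<pi> x)"
    using AE_c_equivariant G(2) by (simp add: AE_ball_countable)
  ultimately show ?thesis
    using AE_space
    by eventually_elim (simp add: factor_map_def measurable_cong_sets[OF sets_c refl])
qed

text \<open>Choosing a disintegration for each component separately would give no measurability in
  \<open>b\<close>. Conditioning once on the pair of component and base point gives fibre measures
  jointly measurable in both, as needed for Fubini.\<close>

lemma joint_disintegration:
  "\<exists>m. conditional_law (B \<Otimes>\<^sub>M K) M M (\<lambda>x. (p x, \<pi> x)) (\<lambda>x. x) m \<and>
    (AE b in B. disintegration K (c b) \<pi> (\<lambda>z. m (b, z)))"
proof -
  interpret B: prob_space B by (rule B_prob)
  interpret K: prob_space K by (rule K_prob)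
  interpret BK: pair_prob_space B K ..
  have "distr M (B \<Otimes>\<^sub>M K) (\<lambda>x. (p x, \<pi> x)) = B \<Otimes>\<^sub>M K"
    by (rule distr_pair_eq_product[OF M_prob B_prob K_prob]) (auto simp: p_\<pi>_independent)
  then obtain m where m: "conditional_law (B \<Otimes>\<^sub>M K) M M (\<lambda>x. (p x, \<pi> x)) (\<lambda>x. x) m"
    using conditional_law_exists[OF rM BK.prob_space_axioms M_prob, of "\<lambda>x. (p x, \<pi> x)" "\<lambda>x. x"] by auto
  have mk [measurable]: "m \<in> B \<Otimes>\<^sub>M K \<rightarrow>\<^sub>M prob_algebra M" using m by (simp add: conditional_law_def)
  have 1: "AE b in B. c b = K \<bind> (\<lambda>z. m (b, z))"
    by (rule conditional_law_slice[OF rM B_prob K_prob M_prob _ _ _ m c_law]) auto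
  have "AE w in B \<Otimes>\<^sub>M K. AE x in m w. snd w = \<pi> x"
    by (rule conditional_law_AE_eq[OF BK.prob_space_axioms _ _ rK _ _ m]) auto
  then have 2: "AE b in B. AE z in K. AE x in m (b, z). snd (b, z) = \<pi> x"
    by (rule BK.AE_pair)
  have "AE b in B. disintegration K (c b) \<pi> (\<lambda>z. m (b, z))"
    using 1 2 AE_space
  proof eventually_elim
    case (elim b)
    have "prob_algebra (c b) = prob_algebra M"
      using subprob_algebra_cong[OF sets_c[OF elim(3)]] by (simp add: prob_algebra_def)
    moreover have "(\<lambda>z. m (b, z)) \<in> K \<rightarrow>\<^sub>M prob_algebra M" using elim(3) by measurable
    ultimately show ?case
      using elim by (simp add: disintegration_def eq_commute)
  qed
  with m show ?thesis by blast
qed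

end

section \<open>Almost sure statements under joinings\<close>

lemma joining_overD:
  assumes "joining_over G M T \<pi> N S \<rho> J"
  shows "prob_space J" "sets J = sets (M \<Otimes>\<^sub>M N)" "distr J M fst = M" "distr J N snd = N"
    "\<And>g. g \<in> carrier G \<Longrightarrow> distr J J (map_prod (T g) (S g)) = J"
    "AE w in J. \<pi> (fst w) = \<rho> (snd w)"
  using assms by (auto simp: joining_over_def case_prod_beta)

lemma AE_joining_over_fst:
  assumes J: "joining_over G M T \<pi> N S \<rho> J" and "AE x in M. Q x"
  shows "AE w in J. Q (fst w)"
proof (rule AE_distrD[where M' = M])
  show "fst \<in> J \<rightarrow>\<^sub>M M" by (subst measurable_cong_sets[OF joining_overD(2)[OF J] refl]) simp
  show "AE x in distr J M fst. Q x" unfolding joining_overD(3)[OF J] by fact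
qed

lemma AE_joining_over_snd:
  assumes J: "joining_over G M T \<pi> N S \<rho> J" and "AE y in N. Q y"
  shows "AE w in J. Q (snd w)"
proof (rule AE_distrD[where M' = N])
  show "snd \<in> J \<rightarrow>\<^sub>M N" by (subst measurable_cong_sets[OF joining_overD(2)[OF J] refl]) simp
  show "AE y in distr J N snd. Q y" unfolding joining_overD(4)[OF J] by fact
qed

text \<open>The square of the difference integrates to \<open>s - 2 * s + s\<close>. It is applied
  to the conditional probability of a set given \<open>y\<close> and to the one given the image of
  \<open>y\<close> in \<open>Z\<close>.\<close>

lemma AE_eq_if_L2_eq:
  fixes P Q :: "'a \<Rightarrow> real"
  assumes i: "integrable N (\<lambda>y. (P y)\<^sup>2)" "integrable N (\<lambda>y. P y * Q y)" "integrable N (\<lambda>y. (Q y)\<^sup>2)"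
    and eq: "(\<integral>y. (P y)\<^sup>2 \<partial>N) = s" "(\<integral>y. P y * Q y \<partial>N) = s" "(\<integral>y. (Q y)\<^sup>2 \<partial>N) = s"
  shows "AE y in N. P y = Q y"
proof -
  have *: "(P y - Q y)\<^sup>2 = (P y)\<^sup>2 - 2 * (P y * Q y) + (Q y)\<^sup>2" for y
    by (simp add: power2_diff)
  have i2: "integrable N (\<lambda>y. (P y - Q y)\<^sup>2)" unfolding * using i by auto
  have "(\<integral>y. (P y - Q y)\<^sup>2 \<partial>N) = 0" unfolding * using i eq by simp
  then have "AE y in N. (P y - Q y)\<^sup>2 = 0"
    using integral_nonneg_eq_0_iff_AE[OF i2] by simp
  then show ?thesis by simp
qed

section \<open>From disjoint pairs of components to disjointness\<close>

context decomposed_extension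
begin

lemma disjoint_over_if_AE_disjoint_pairs:
  fixes N :: "'y measure"
  assumes N: "pmp_action G N S" and ergN: "ergodic_action G N S" and f\<rho>: "factor_map G K R N S \<rho>"
    and rN: "real_retract N \<phi>' \<psi>'"
    and D: "AE w in B \<Otimes>\<^sub>M B. w \<in> disjoint_component_pairs G K T \<pi> B c"
  shows "disjoint_over G K M T \<pi> N S \<rho>"
proof -
  interpret K: prob_space K by (rule K_prob)
  interpret M: prob_space M by (rule M_prob)
  interpret B: prob_space B by (rule B_prob)
  interpret N: prob_space N by (rule pmp_actionD(1)[OF N])
  interpret BN: pair_prob_space B N ..
  interpret BK: pair_prob_space B K ..
  interpret BB: pair_prob_space B B ..
  have \<rho> [measurable]: "\<rho> \<in> N \<rightarrow>\<^sub>M K" and d\<rho>: "distr N K \<rho> = K" using f\<rho> by (auto simp: factor_map_def)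
  obtain m where m: "conditional_law (B \<Otimes>\<^sub>M K) M M (\<lambda>x. (p x, \<pi> x)) (\<lambda>x. x) m"
    and m_dis: "AE b in B. disintegration K (c b) \<pi> (\<lambda>z. m (b, z))"
    using joint_disintegration by blast
  have mk [measurable]: "m \<in> B \<Otimes>\<^sub>M K \<rightarrow>\<^sub>M prob_algebra M" using m by (simp add: conditional_law_def)
  \<comment> \<open>Averaging over \<open>b\<close> the fibre measures of the components above the
    same \<open>z\<close> gives the fibre measure of the whole system above
    \<open>z\<close>.\<close>
  define mm where "mm z = B \<bind> (\<lambda>b. m (b, z))" for z
  have mm_law: "conditional_law K M M \<pi> (\<lambda>x. x) mm"
    unfolding mm_def[abs_def] by (rule conditional_law_marginal[OF B_prob K_prob M_prob _ _ _ m]) auto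
  then have mm: "disintegration K M \<pi> mm"
    using disintegration_iff_conditional_law[OF rK M_prob \<pi>_measurable \<pi>_distr] by simp
  have mm_k [measurable]: "mm \<in> K \<rightarrow>\<^sub>M prob_algebra M" using mm_law by (simp add: conditional_law_def)
  obtain n where n: "disintegration K N \<rho> n"
    using disintegration_exists[OF rK rN N.prob_space_axioms \<rho> d\<rho>] by blast
  then have n_law: "conditional_law K N N \<rho> (\<lambda>x. x) n"
    using disintegration_iff_conditional_law[OF rK N.prob_space_axioms \<rho> d\<rho>] by simp
  have nk [measurable]: "n \<in> K \<rightarrow>\<^sub>M prob_algebra N" using n_law by (simp add: conditional_law_def)
  have "J = relatively_independent_joining K mm n" if J: "joining_over G M T \<pi> N S \<rho> J" for J
  proof -
    interpret J: prob_space J by (rule joining_overD(1)[OF J])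
    have sJ [measurable_cong]: "sets J = sets (M \<Otimes>\<^sub>M N)" by (rule joining_overD(2)[OF J])
    note spJ = space_coupling[OF sJ]
    have TS [measurable]: "map_prod (T g) (S g) \<in> J \<rightarrow>\<^sub>M J" if "g \<in> carrier G" for g
      using pmp_actionD(2)[OF M that] pmp_actionD(2)[OF N that] by (simp add: map_prod_def) measurable
    let ?u = "\<lambda>w. p (fst w)"
    have u [measurable]: "?u \<in> J \<rightarrow>\<^sub>M B" and sndJ [measurable]: "snd \<in> J \<rightarrow>\<^sub>M N" and fstJ [measurable]: "fst \<in> J \<rightarrow>\<^sub>M M"
      by measurable
    \<comment> \<open>Under \<open>J\<close> the component is an invariant function and
      \<open>snd\<close> maps onto an ergodic system.\<close>
    have ind: "measure J {w \<in> space J. ?u w \<in> E \<and> snd w \<in> C} = measure J {w \<in> space J. ?u w \<in> E} * measure N C"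
      if "E \<in> sets B" "C \<in> sets N" for E C
    proof (rule invariant_independent_of_ergodic[OF G N ergN J.prob_space_axioms u sndJ joining_overD(4)[OF J] TS joining_overD(5)[OF J] _ _ that])
      fix g assume g: "g \<in> carrier G"
      show "AE w in J. p (fst (map_prod (T g) (S g) w)) = p (fst w)"
        using AE_joining_over_fst[OF J p_invariant[OF g]] by simp
    qed simp_all
    have uB: "measure J {w \<in> space J. ?u w \<in> E} = measure B E" if E [measurable]: "E \<in> sets B" for E
    proof -
      have "measure B E = measure (distr (distr J M fst) B p) E"
        unfolding joining_overD(3)[OF J] p_distr ..
      also have "\<dots> = measure J {w \<in> space J. ?u w \<in> E}"
        by (simp add: distr_distr measure_distr vimage_def Int_def conj_commute)
      finally show ?thesis ..
    qed
    have dBN: "distr J (B \<Otimes>\<^sub>M N) (\<lambda>w. (?u w, snd w)) = B \<Otimes>\<^sub>M N"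
      by (rule distr_pair_eq_product[OF J.prob_space_axioms B_prob N.prob_space_axioms])
        (auto simp: ind uB)
    obtain j where j: "conditional_law (B \<Otimes>\<^sub>M N) M J (\<lambda>w. (?u w, snd w)) fst j"
      using conditional_law_exists[OF rM BN.prob_space_axioms J.prob_space_axioms _ fstJ dBN] by auto
    have jk [measurable]: "j \<in> B \<Otimes>\<^sub>M N \<rightarrow>\<^sub>M prob_algebra M" using j by (simp add: conditional_law_def)
    define jm where "jm y = B \<bind> (\<lambda>b. j (b, y))" for y
    have jm_law: "conditional_law N M J snd fst jm"
      unfolding jm_def[abs_def] by (rule conditional_law_marginal[OF B_prob N.prob_space_axioms J.prob_space_axioms u sndJ fstJ j])
    then have jm_k [measurable]: "jm \<in> N \<rightarrow>\<^sub>M prob_algebra M" by (simp add: conditional_law_def)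
    have cJ: "conditional_law B M J ?u fst c"
    proof -
      have "distr J (B \<Otimes>\<^sub>M M) (\<lambda>w. (?u w, fst w)) = distr (distr J M fst) (B \<Otimes>\<^sub>M M) (\<lambda>x. (p x, x))"
        by (subst distr_distr) (auto simp: o_def)
      then show ?thesis using c_law joining_overD(3)[OF J] by (simp add: conditional_law_def)
    qed
    have 1: "AE b in B. c b = N \<bind> (\<lambda>y. j (b, y))"
      by (rule conditional_law_slice[OF rM B_prob N.prob_space_axioms J.prob_space_axioms u sndJ fstJ j cJ])
    have 2: "AE b in B. AE y in N. AE x in j (b, y). \<pi> x = \<rho> y"
    proof -
      have "AE w in B \<Otimes>\<^sub>M N. AE x in j w. \<rho> (snd w) = \<pi> x"
        by (rule conditional_law_AE_eq[OF BN.prob_space_axioms _ fstJ rK _ _ j])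
          (use joining_overD(6)[OF J] in \<open>auto simp: eq_commute\<close>)
      then have "AE b in B. AE y in N. AE x in j (b, y). \<rho> (snd (b, y)) = \<pi> x"
        by (rule BN.AE_pair)
      then show ?thesis by (simp add: eq_commute)
    qed
    \<comment> \<open>Since \<open>p\<close> is invariant, the action on the base of
      \<open>j\<close> fixes the component and moves only \<open>y\<close>. So for almost every
      \<open>b\<close> the family \<open>j (b, y)\<close> is equivariant in \<open>y\<close>
      alone.\<close>
    have 3: "AE b in B. \<forall>g\<in>carrier G. AE y in N. j (b, S g y) = distr (j (b, y)) M (T g)"
    proof -
      have "AE b in B. AE y in N. j (b, S g y) = distr (j (b, y)) M (T g)" if g: "g \<in> carrier G" for g
      proof -
        have gi: "inv\<^bsub>G\<^esub> g \<in> carrier G" using group.inv_closed[OF G(1) g] .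
        note [measurable] = pmp_actionD(2)[OF N g] pmp_actionD(2)[OF N gi] pmp_actionD(2)[OF M g]
        let ?s = "\<lambda>h. map_prod (\<lambda>b. b) (S h)"
        have s_m [measurable]: "?s g \<in> B \<Otimes>\<^sub>M N \<rightarrow>\<^sub>M B \<Otimes>\<^sub>M N" "?s (inv\<^bsub>G\<^esub> g) \<in> B \<Otimes>\<^sub>M N \<rightarrow>\<^sub>M B \<Otimes>\<^sub>M N"
          by (simp_all add: map_prod_def) measurable
        have s_d: "distr (B \<Otimes>\<^sub>M N) (B \<Otimes>\<^sub>M N) (?s g) = B \<Otimes>\<^sub>M N"
          using pair_measure_distr[of "\<lambda>b. b" B B "S g" N N] pmp_actionD(3)[OF N g] N.sigma_finite_measure_axioms
          by (simp add: map_prod_def case_prod_beta' distr_id2)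
        have "AE w in B \<Otimes>\<^sub>M N. j (?s g w) = distr (j w) M (T g)"
        proof (rule conditional_law_equivariant[OF rM BN.prob_space_axioms J.prob_space_axioms _ fstJ j
              TS[OF g] joining_overD(5)[OF J g] s_m(1) s_d s_m(2)])
          show "?s (inv\<^bsub>G\<^esub> g) (?s g w) = w" if "w \<in> space (B \<Otimes>\<^sub>M N)" for w
            using that pmp_action_inv(1)[OF N G(1) g] by (cases w) (auto simp: space_pair_measure)
          show "AE w in J. (p (fst (map_prod (T g) (S g) w)), snd (map_prod (T g) (S g) w)) = ?s g (p (fst w), snd w)"
            using AE_joining_over_fst[OF J p_invariant[OF g]] by simp
        qed simp_all
        then have "AE b in B. AE y in N. j (?s g (b, y)) = distr (j (b, y)) M (T g)" by (rule BN.AE_pair)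
        then show ?thesis by simp
      qed
      then show ?thesis using G(2) by (simp add: AE_ball_countable)
    qed
    define good where "good b \<longleftrightarrow> b \<in> space B \<and> disintegration K (c b) \<pi> (\<lambda>z. m (b, z)) \<and> factor_map G K R (c b) T \<pi> \<and>
      c b = N \<bind> (\<lambda>y. j (b, y)) \<and> (AE y in N. AE x in j (b, y). \<pi> x = \<rho> y) \<and>
      (\<forall>g\<in>carrier G. AE y in N. j (b, S g y) = distr (j (b, y)) M (T g))" for b
    have "AE b in B. good b"
      using m_dis AE_factor_map_c 1 2 3 AE_space by eventually_elim (simp add: good_def)
    then have good: "AE w in B \<Otimes>\<^sub>M B. good (fst w) \<and> good (snd w)"
      by (rule AE_pair_both[OF B_prob])
    \<comment> \<open>The conditional probability of \<open>A\<close> given \<open>y\<close> depends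
      on \<open>y\<close> only through its image in \<open>Z\<close>. The proof computes the three
      integrals of \<open>AE_eq_if_L2_eq\<close>, each with value \<open>?s\<close>.\<close>
    have key: "AE y in N. measure (jm y) A = measure (mm (\<rho> y)) A" if A [measurable]: "A \<in> sets M" for A
    proof -
      have jA: "(\<lambda>(b, y). measure (j (b, y)) A) \<in> borel_measurable (B \<Otimes>\<^sub>M N)"
        and mA: "(\<lambda>(b, y). measure (m (b, y)) A) \<in> borel_measurable (B \<Otimes>\<^sub>M K)"
        by (simp_all add: case_prod_beta') measurable
      have j01: "measure (j (b, y)) A \<le> 1" if "b \<in> space B" "y \<in> space N" for b y
        using that prob_space.prob_le_1[OF prob_kernelD(1)[OF jk]] by (simp add: space_pair_measure)
      have m01: "measure (m (b, y)) A \<le> 1" if "b \<in> space B" "y \<in> space K" for b y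
        using that prob_space.prob_le_1[OF prob_kernelD(1)[OF mk]] by (simp add: space_pair_measure)
      have jmA: "measure (jm y) A = (\<integral>b. measure (j (b, y)) A \<partial>B)" if "y \<in> space N" for y
        unfolding jm_def using that by (intro measure_bind_kernel[OF B_prob _ A]) measurable
      have mmA: "measure (mm y) A = (\<integral>b. measure (m (b, y)) A \<partial>B)" if "y \<in> space K" for y
        unfolding mm_def using that by (intro measure_bind_kernel[OF B_prob _ A]) measurable
      let ?s = "\<integral>z. (measure (mm z) A)\<^sup>2 \<partial>K"
      have mm01: "measure (mm z) A \<le> 1" if "z \<in> space K" for z
        by (rule prob_space.prob_le_1[OF prob_kernelD(1)[OF mm_k that]])
      have jm01: "measure (jm y) A \<le> 1" if "y \<in> space N" for y
        by (rule prob_space.prob_le_1[OF prob_kernelD(1)[OF jm_k that]])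
      have \<rho>s: "\<rho> y \<in> space K" if "y \<in> space N" for y using measurable_space[OF \<rho> that] .
      have "(\<integral>y. (measure (jm y) A)\<^sup>2 \<partial>N) = (\<integral>y. (\<integral>b. measure (j (b, y)) A \<partial>B)\<^sup>2 \<partial>N)"
        by (intro Bochner_Integration.integral_cong) (auto simp: jmA)
      also have "\<dots> = (\<integral>w. \<integral>y. measure (j (fst w, y)) A * measure (j (snd w, y)) A \<partial>N \<partial>(B \<Otimes>\<^sub>M B))"
        by (rule integral_pair_square[symmetric, OF B_prob N.prob_space_axioms jA]) (auto simp: j01)
      \<comment> \<open>The hypothesis on pairs is used here: the joining of \<open>b1\<close> and
        \<open>b2\<close> through \<open>N\<close> must be the one through \<open>K\<close>, so both
        give the same mass to \<open>A \<times> A\<close>.\<close>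
      also have "\<dots> = (\<integral>w. \<integral>z. measure (m (fst w, z)) A * measure (m (snd w, z)) A \<partial>K \<partial>(B \<Otimes>\<^sub>M B))"
      proof (rule integral_cong_AE)
        show "AE w in B \<Otimes>\<^sub>M B. (\<integral>y. measure (j (fst w, y)) A * measure (j (snd w, y)) A \<partial>N) =
            (\<integral>z. measure (m (fst w, z)) A * measure (m (snd w, z)) A \<partial>K)"
          using good D
        proof eventually_elim
          case (elim w)
          obtain b1 b2 where w: "w = (b1, b2)" by (cases w)
          have g1: "good b1" and g2: "good b2" using elim(1) w by auto
          have b: "b1 \<in> space B" "b2 \<in> space B" using g1 g2 by (auto simp: good_def)
          note g1 = g1[unfolded good_def] and g2 = g2[unfolded good_def]
          have k1: "(\<lambda>y. j (b1, y)) \<in> N \<rightarrow>\<^sub>M prob_algebra M" and k2: "(\<lambda>y. j (b2, y)) \<in> N \<rightarrow>\<^sub>M prob_algebra M"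
            using b by measurable
          let ?l = "relatively_independent_joining N (\<lambda>y. j (b1, y)) (\<lambda>y. j (b2, y))"
          have "joining_over G (c b1) T \<pi> (c b2) T \<pi> ?l"
            by (rule joining_rij[OF N.prob_space_axioms k1 k2, where S = S and Z = K and r = \<rho>])
              (use g1 g2 rK in \<open>auto intro: pmp_actionD(2,3)[OF N] pmp_actionD(2)[OF M]\<close>)
          moreover obtain m1 m2 where d: "disintegration K (c b1) \<pi> m1" "disintegration K (c b2) \<pi> m2"
            and "{J. joining_over G (c b1) T \<pi> (c b2) T \<pi> J} = {relatively_independent_joining K m1 m2}"
            using elim(2) w by (auto simp: disjoint_component_pairs_def disjoint_over_def)
          ultimately have l: "?l = relatively_independent_joining K m1 m2" by blast
          \<comment> \<open>Disjointness of the pair comes with its own disintegrations; uniqueness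
            replaces them by the jointly measurable \<open>m\<close>.\<close>
          have "AE z in K. m1 z = m (b1, z)"
            by (rule disintegration_unique[OF rK real_retract_c[OF b(1)] pmp_actionD(1)[OF c_pmp[OF b(1)]] _ _ d(1)])
              (use g1 in \<open>auto simp: factor_map_def\<close>)
          moreover have "AE z in K. m2 z = m (b2, z)"
            by (rule disintegration_unique[OF rK real_retract_c[OF b(2)] pmp_actionD(1)[OF c_pmp[OF b(2)]] _ _ d(2)])
              (use g2 in \<open>auto simp: factor_map_def\<close>)
          ultimately have ae: "AE z in K. measure (m1 z) A * measure (m2 z) A = measure (m (b1, z)) A * measure (m (b2, z)) A"
            by eventually_elim simp
          have A': "A \<in> sets (c b1)" "A \<in> sets (c b2)" using A b by (simp_all add: sets_c)
          have km: "m1 \<in> K \<rightarrow>\<^sub>M prob_algebra (c b1)" "m2 \<in> K \<rightarrow>\<^sub>M prob_algebra (c b2)"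
            using d by (auto simp: disintegration_def)
          have "(\<integral>y. measure (j (b1, y)) A * measure (j (b2, y)) A \<partial>N) = measure ?l (A \<times> A)"
            by (rule measure_rij[OF N.prob_space_axioms k1 k2 A A, symmetric])
          also have "\<dots> = (\<integral>z. measure (m1 z) A * measure (m2 z) A \<partial>K)"
            unfolding l by (rule measure_rij[OF K_prob km A'])
          also have "\<dots> = (\<integral>z. measure (m (b1, z)) A * measure (m (b2, z)) A \<partial>K)"
          proof -
            note [measurable] = km A' b
            show ?thesis by (intro integral_cong_AE ae) measurable
          qed
          finally show ?case by (simp add: w)
        qed
      qed measurable
      also have "\<dots> = (\<integral>z. (\<integral>b. measure (m (b, z)) A \<partial>B)\<^sup>2 \<partial>K)"
        by (rule integral_pair_square[OF B_prob K_prob mA]) (auto simp: m01)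
      also have "\<dots> = ?s"
        by (intro Bochner_Integration.integral_cong) (auto simp: mmA)
      finally have e1: "(\<integral>y. (measure (jm y) A)\<^sup>2 \<partial>N) = ?s" .
      \<comment> \<open>Cross term: integrating against \<open>jm\<close> is integrating over
        \<open>J\<close>, and there \<open>\<rho> y\<close> may be replaced by
        \<open>\<pi> x\<close>. Only \<open>M\<close> remains, and conditioning on \<open>Z\<close>
        produces the second factor \<open>mm\<close>.\<close>
      have "(\<integral>y. measure (jm y) A * measure (mm (\<rho> y)) A \<partial>N) = (\<integral>w. indicator A (fst w) * measure (mm (\<rho> (snd w))) A \<partial>J)"
        using conditional_law_integral[OF N.prob_space_axioms J.prob_space_axioms sndJ fstJ jm_law A, of "\<lambda>y. measure (mm (\<rho> y)) A"]
        by (simp add: mm01 \<rho>s mult.commute)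
      also have "\<dots> = (\<integral>w. indicator A (fst w) * measure (mm (\<pi> (fst w))) A \<partial>J)"
        by (rule integral_cong_AE, measurable) (use joining_overD(6)[OF J] in \<open>auto elim: AE_mp\<close>)
      also have "\<dots> = (\<integral>x. indicator A x * measure (mm (\<pi> x)) A \<partial>distr J M fst)"
        by (rule integral_distr[symmetric]) measurable
      also have "\<dots> = (\<integral>x. indicator A x * measure (mm (\<pi> x)) A \<partial>M)"
        unfolding joining_overD(3)[OF J] ..
      also have "\<dots> = ?s"
        using conditional_law_integral[OF K_prob M_prob \<pi>_measurable _ mm_law A, of "\<lambda>y. measure (mm y) A"]
        by (simp add: mm01 power2_eq_square)
      finally have e2: "(\<integral>y. measure (jm y) A * measure (mm (\<rho> y)) A \<partial>N) = ?s" .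
      have "(\<integral>y. (measure (mm (\<rho> y)) A)\<^sup>2 \<partial>N) = (\<integral>z. (measure (mm z) A)\<^sup>2 \<partial>distr N K \<rho>)"
        by (rule integral_distr[symmetric]) measurable
      then have e3: "(\<integral>y. (measure (mm (\<rho> y)) A)\<^sup>2 \<partial>N) = ?s" by (simp only: d\<rho>)
      show ?thesis
      proof (rule AE_eq_if_L2_eq[OF _ _ _ e1 e2 e3])
        show "integrable N (\<lambda>y. (measure (jm y) A)\<^sup>2)" "integrable N (\<lambda>y. measure (jm y) A * measure (mm (\<rho> y)) A)"
          "integrable N (\<lambda>y. (measure (mm (\<rho> y)) A)\<^sup>2)"
          using mm01 jm01 \<rho>s
          by (auto intro!: N.integrable_const_bound[where B=1] AE_I2 mult_le_one simp: abs_mult power_le_one)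
      qed
    qed
    have nN: "measure J (A \<times> C) = (\<integral>z. measure (mm z) A * measure (n z) C \<partial>K)"
      if A [measurable]: "A \<in> sets M" and C [measurable]: "C \<in> sets N" for A C
    proof -
      have mm01: "measure (mm z) A \<le> 1" if "z \<in> space K" for z
        by (rule prob_space.prob_le_1[OF prob_kernelD(1)[OF mm_k that]])
      have "A \<times> C = {w \<in> space J. snd w \<in> C \<and> fst w \<in> A}"
        using sets.sets_into_space[OF A] sets.sets_into_space[OF C] by (auto simp: spJ)
      then have "measure J (A \<times> C) = (\<integral>y. indicator C y * measure (jm y) A \<partial>N)"
        using conditional_law_iff[OF N.prob_space_axioms J.prob_space_axioms sndJ fstJ jm_k, THEN iffD1, OF jm_law] A C
        by simp
      also have "\<dots> = (\<integral>y. indicator C y * measure (mm (\<rho> y)) A \<partial>N)"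
        by (rule integral_cong_AE, measurable) (use key[OF A] in \<open>auto elim: AE_mp\<close>)
      also have "\<dots> = (\<integral>z. measure (mm z) A * measure (n z) C \<partial>K)"
        using conditional_law_integral[OF K_prob N.prob_space_axioms \<rho> _ n_law C, of "\<lambda>y. measure (mm y) A"]
        by (simp add: mm01)
      finally show ?thesis .
    qed
    interpret r: prob_space "relatively_independent_joining K mm n" by (rule prob_space_rij[OF K_prob mm_k nk])
    show ?thesis
      by (rule measure_eqI_rect[OF J.finite_measure_axioms sJ sets_rij[OF K_prob mm_k nk]])
        (simp add: J.emeasure_eq_measure r.emeasure_eq_measure nN measure_rij[OF K_prob mm_k nk])
  qed
  moreover have "joining_over G M T \<pi> N S \<rho> (relatively_independent_joining K mm n)"
    by (rule joining_rij_disintegration[OF G(1) K M N f\<pi> f\<rho> rK rM rN mm n])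
  ultimately show ?thesis
    using mm n unfolding disjoint_over_def by blast
qed

end

section \<open>Models on the unit interval\<close>

text \<open>Its purpose is to exclude atoms in the components: pulled back along the projection to
  \<open>K\<close>, such an \<open>f\<close> puts every point into a null set.\<close>

lemma standard_nonatomic_null_level_sets:
  assumes K: "standard_nonatomic K" and "prob_space K"
  shows "\<exists>f\<in>borel_measurable K. \<forall>r::real. measure K {z \<in> space K. f z = r} = 0"
proof -
  let ?I = "restrict_space lborel {0..1::real}"
  obtain f where f: "measurable_iso f K ?I" and d: "distr K ?I f = ?I"
    using K by (auto simp: standard_nonatomic_def)
  have fm: "f \<in> K \<rightarrow>\<^sub>M ?I" using f by (simp add: measurable_iso_def)
  have fb: "f \<in> borel_measurable K"
    using measurable_restrict_space2_iff[of f K lborel "{0..1}"] fm by simp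
  have "measure K {z \<in> space K. f z = r} = 0" for r
  proof (cases "r \<in> {0..1}")
    case True
    then have r: "{r} \<in> sets ?I" by (auto simp: sets_restrict_space)
    have "measure ?I {r} = measure K {z \<in> space K. f z = r}"
      using measure_distr[OF fm r] unfolding d by (simp add: vimage_def Int_def conj_commute)
    then show ?thesis using True by (simp add: measure_restrict_space)
  next
    case False
    then have "{z \<in> space K. f z = r} = {}"
      using measurable_space[OF fm] by (auto simp: space_restrict_space)
    then show ?thesis by (metis measure_empty)
  qed
  with fb show ?thesis by blast
qed

text \<open>Without atoms the distribution function of \<open>\<phi>\<close> is continuous, so its
  value at \<open>\<phi> x\<close> is uniformly distributed. The quantile function
  \<open>D.I\<close> is a right inverse of it on the open interval, and also a left inverse at
  almost every value of \<open>\<phi>\<close>, since \<open>\<phi>\<close> has the law of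
  \<open>D.I\<close>.\<close>

lemma unit_interval_model:
  fixes \<mu> :: "'x measure"
  assumes \<mu>: "prob_space \<mu>" and retr: "real_retract \<mu> \<phi> \<psi>"
    and atomless: "\<And>r. measure \<mu> {x \<in> space \<mu>. \<phi> x = r} = 0"
  defines "N \<equiv> restrict_space lborel {0..1::real}"
  shows "\<exists>\<theta> h. \<theta> \<in> \<mu> \<rightarrow>\<^sub>M N \<and> h \<in> N \<rightarrow>\<^sub>M \<mu> \<and> distr \<mu> N \<theta> = N \<and> (AE x in \<mu>. h (\<theta> x) = x)"
proof -
  interpret \<mu>: prob_space \<mu> by fact
  note [measurable] = real_retractD(1,2)[OF retr]
  let ?D = "distr \<mu> borel \<phi>"
  interpret D: real_distribution ?D by (intro \<mu>.real_distribution_distr) simp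
  interpret D: cdf_distribution ?D ..
  let ?F = "cdf ?D" and ?U = "restrict_space lborel {0<..<1::real}"
  have Fc: "isCont ?F s" for s
  proof -
    have "measure ?D {s} = measure \<mu> {x \<in> space \<mu>. \<phi> x = s}"
      by (subst measure_distr) (auto intro!: arg_cong[where f = "measure \<mu>"])
    then show ?thesis using atomless D.isCont_cdf by simp
  qed
  have FI: "?F (D.I t) = t" if t: "0 < t" "t < 1" for t
  proof (rule antisym)
    show "t \<le> ?F (D.I t)" using D.pseudoinverse[OF t] by blast
    have "(?F \<longlongrightarrow> ?F (D.I t)) (at_left (D.I t))"
      using Fc[of "D.I t"] by (meson isContD tendsto_mono at_le subset_UNIV)
    moreover have "\<forall>\<^sub>F x in at_left (D.I t). ?F x \<le> t"
    proof -
      have "?F x \<le> t" if "x < D.I t" for x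
        using D.pseudoinverse[OF t, of x] that by linarith
      then show ?thesis by (simp add: eventually_at_filter)
    qed
    ultimately show "?F (D.I t) \<le> t"
      by (rule tendsto_upperbound) simp
  qed
  have F_m [measurable]: "?F \<in> borel_measurable borel" by (rule D.measurable_C)
  have I_m: "D.I \<in> borel_measurable ?U"
    using D.measurable_CI by (subst measurable_cong_sets[OF sets_restrict_space_cong[OF sets_lborel] refl])
  have dI: "distr ?U borel D.I = ?D" by (rule D.distr_I_eq_M)
  define \<theta> where "\<theta> x = ?F (\<phi> x)" for x
  \<comment> \<open>Quantiles are used inside the open interval only; the value 0 elsewhere is an
    arbitrary argument for \<open>\<psi>\<close> that keeps \<open>h\<close> total.\<close>
  define h where "h t = \<psi> (if t \<in> {0<..<1} then D.I t else 0)" for t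
  have \<theta>_b [measurable]: "\<theta> \<in> borel_measurable \<mu>" unfolding \<theta>_def by measurable
  have \<theta>01: "\<theta> x \<in> {0..1}" for x
    unfolding \<theta>_def using D.cdf_nonneg D.cdf_bounded_prob by auto
  have sN: "sets N = sets (restrict_space borel {0..1})" unfolding N_def by (simp add: sets_restrict_space)
  have \<theta>_m: "\<theta> \<in> \<mu> \<rightarrow>\<^sub>M N"
    unfolding measurable_cong_sets[OF refl sN] using \<theta>01 by (intro measurable_restrict_space2) auto
  have I'_m [measurable]: "(\<lambda>t. if t \<in> {0<..<1} then D.I t else 0) \<in> borel_measurable borel"
    using D.measurable_CI
    by (subst measurable_If_restrict_space_iff) (simp_all del: greaterThanLessThan_iff)
  have "h \<in> borel \<rightarrow>\<^sub>M \<mu>" unfolding h_def by measurable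
  then have h_m: "h \<in> N \<rightarrow>\<^sub>M \<mu>"
    unfolding measurable_cong_sets[OF sN refl] by (rule measurable_restrict_space1)
  have "distr \<mu> borel \<theta> = distr (distr ?U borel D.I) borel ?F"
    unfolding dI by (subst distr_distr) (auto simp: \<theta>_def[abs_def] o_def)
  also have "\<dots> = distr ?U borel (\<lambda>t. ?F (D.I t))"
    using I_m by (subst distr_distr) (auto simp: o_def)
  also have "\<dots> = distr ?U borel (\<lambda>t. t)"
    by (rule distr_cong) (auto simp: FI space_restrict_space)
  finally have d\<theta>: "distr \<mu> borel \<theta> = distr ?U borel (\<lambda>t. t)" .
  have U_id: "(\<lambda>t. t) \<in> ?U \<rightarrow>\<^sub>M borel" by (rule measurable_restrict_space1) simp
  have dN: "distr \<mu> N \<theta> = N"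
  proof (rule measure_eqI)
    fix A assume "A \<in> sets (distr \<mu> N \<theta>)"
    then have A: "A \<in> sets N" by simp
    then have Ab [measurable]: "A \<in> sets borel" and A01: "A \<subseteq> {0..1}"
      by (auto simp: N_def sets_restrict_space)
    have "emeasure (distr \<mu> N \<theta>) A = emeasure (distr \<mu> borel \<theta>) A"
      using A \<theta>_m by (simp add: emeasure_distr)
    also have "\<dots> = emeasure lborel (A \<inter> {0<..<1})"
      unfolding d\<theta> using U_id by (simp add: emeasure_distr space_restrict_space emeasure_restrict_space Int_commute)
    also have "\<dots> = emeasure lborel A"
    proof (rule emeasure_eq_AE)
      show "AE t in lborel. (t \<in> A \<inter> {0<..<1}) = (t \<in> A)"
        using AE_lborel_singleton[of 0] AE_lborel_singleton[of 1]
        by eventually_elim (use A01 in force)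
    qed auto
    also have "\<dots> = emeasure N A"
      unfolding N_def using A01 by (simp add: emeasure_restrict_space)
    finally show "emeasure (distr \<mu> N \<theta>) A = emeasure N A" .
  qed simp
  have U: "AE t in ?U. t \<in> {0<..<1}" by (rule AE_I2) (simp add: space_restrict_space)
  have "AE t in ?U. ?F (D.I t) \<in> {0<..<1} \<and> D.I (?F (D.I t)) = D.I t"
    using U by eventually_elim (simp add: FI)
  then have "AE t in ?U. ?F (D.I t) \<in> {0<..<1} \<and> (if ?F (D.I t) \<in> {0<..<1} then D.I (?F (D.I t)) else 0) = D.I t"
    by eventually_elim simp
  then have "AE s in distr ?U borel D.I. ?F s \<in> {0<..<1} \<and> (if ?F s \<in> {0<..<1} then D.I (?F s) else 0) = s"
    using measurable_compose[OF F_m I'_m] by (subst AE_distr_iff[OF I_m]) measurable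
  then have "AE x in \<mu>. ?F (\<phi> x) \<in> {0<..<1} \<and> (if ?F (\<phi> x) \<in> {0<..<1} then D.I (?F (\<phi> x)) else 0) = \<phi> x"
    unfolding dI by (rule AE_distrD[rotated]) simp
  then have "AE x in \<mu>. h (\<theta> x) = x"
    using AE_space
  proof eventually_elim
    case (elim x)
    then have "D.I (?F (\<phi> x)) = \<phi> x" "h (\<theta> x) = \<psi> (D.I (?F (\<phi> x)))"
      by (auto simp: h_def \<theta>_def)
    then show ?case using elim by (simp add: real_retractD(3)[OF retr])
  qed
  with \<theta>_m h_m dN show ?thesis by blast
qed

text \<open>On the invariant conull set where \<open>h\<close> inverts \<open>\<theta>\<close> along orbits the action is transported by
  \<open>\<theta>\<close>; elsewhere it is set to the identity, so that the action laws hold everywhere.\<close>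

lemma transport_action:
  fixes \<mu> :: "'x measure" and N :: "'y measure"
  assumes G: "group G" "countable (carrier G)" and \<mu>: "pmp_action G \<mu> T" and erg: "ergodic_action G \<mu> T"
    and r\<mu>: "real_retract \<mu> \<phi> \<psi>" and rN: "real_retract N \<phi>' \<psi>'" and f\<pi>: "factor_map G K R \<mu> T \<pi>"
    and \<theta>: "\<theta> \<in> \<mu> \<rightarrow>\<^sub>M N" and h: "h \<in> N \<rightarrow>\<^sub>M \<mu>" and d: "distr \<mu> N \<theta> = N" and ae: "AE x in \<mu>. h (\<theta> x) = x"
  shows "\<exists>S. pmp_action G N S \<and> ergodic_action G N S \<and> factor_map G K R N S (\<lambda>t. \<pi> (h t)) \<and>
    (\<forall>g\<in>carrier G. AE x in \<mu>. \<theta> (T g x) = S g (\<theta> x))"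
proof -
  interpret group G by fact
  interpret \<mu>: prob_space \<mu> by (rule pmp_actionD(1)[OF \<mu>])
  have Np: "prob_space N" using \<mu>.prob_space_distr[OF \<theta>] d by simp
  note [measurable] = \<theta> h real_retractD(1)[OF r\<mu>] real_retractD(1)[OF rN]
  have T [measurable]: "T g \<in> \<mu> \<rightarrow>\<^sub>M \<mu>" if "g \<in> carrier G" for g using pmp_actionD(2)[OF \<mu> that] .
  note T_mult = pmp_actionD(5)[OF \<mu>] and T_one = pmp_actionD(4)[OF \<mu>]
  note T_space = measurable_space[OF T] and \<theta>_space = measurable_space[OF \<theta>] and h_space = measurable_space[OF h]
  have \<phi>_eq: "\<phi> x = \<phi> y \<longleftrightarrow> x = y" if "x \<in> space \<mu>" "y \<in> space \<mu>" for x y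
    using that real_retractD(3)[OF r\<mu>] by metis
  have \<phi>'_eq: "\<phi>' x = \<phi>' y \<longleftrightarrow> x = y" if "x \<in> space N" "y \<in> space N" for x y
    using that real_retractD(3)[OF rN] by metis
  define X where "X = {x \<in> space \<mu>. \<forall>g\<in>carrier G. \<phi> (h (\<theta> (T g x))) = \<phi> (T g x)}"
  \<comment> \<open>\<open>U\<close> is the image of \<open>X\<close> under \<open>\<theta>\<close>,
    described through \<open>h\<close> so that its measurability is evident.\<close>
  define U where "U = {t \<in> space N. h t \<in> X \<and> \<phi>' (\<theta> (h t)) = \<phi>' t}"
  have "Measurable.pred \<mu> (\<lambda>x. \<forall>g\<in>carrier G. \<phi> (h (\<theta> (T g x))) = \<phi> (T g x))"
    by (rule pred_countable_Ball[OF G(2)]) measurable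
  then have X_m [measurable]: "X \<in> sets \<mu>" unfolding X_def by (simp add: pred_def)
  have U_m [measurable]: "U \<in> sets N" unfolding U_def by measurable
  have XD: "h (\<theta> (T g x)) = T g x" if "x \<in> X" "g \<in> carrier G" for x g
  proof -
    have "x \<in> space \<mu>" "\<phi> (h (\<theta> (T g x))) = \<phi> (T g x)" using that by (auto simp: X_def)
    then show ?thesis using \<phi>_eq h_space \<theta>_space T_space that(2) by metis
  qed
  have Xs: "x \<in> space \<mu>" if "x \<in> X" for x using that by (simp add: X_def)
  have X1: "h (\<theta> x) = x" if "x \<in> X" for x using XD[OF that one_closed] T_one[OF Xs[OF that]] by simp
  have XT: "T g x \<in> X" if "x \<in> X" "g \<in> carrier G" for x g
  proof -
    have "\<phi> (h (\<theta> (T k (T g x)))) = \<phi> (T k (T g x))" if k: "k \<in> carrier G" for k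
      using XD[OF \<open>x \<in> X\<close>, of "k \<otimes>\<^bsub>G\<^esub> g"] T_mult[OF k \<open>g \<in> carrier G\<close> Xs[OF \<open>x \<in> X\<close>]] k \<open>g \<in> carrier G\<close> by simp
    then show ?thesis using T_space[OF that(2) Xs[OF that(1)]] by (simp add: X_def)
  qed
  have UD: "t \<in> space N" "h t \<in> X" "\<theta> (h t) = t" if "t \<in> U" for t
    using that \<phi>'_eq[of "\<theta> (h t)" t] \<theta>_space h_space by (auto simp: U_def)
  have \<theta>U: "\<theta> x \<in> U" if "x \<in> X" for x
    using that X1[OF that] \<theta>_space[OF Xs[OF that]] by (simp add: U_def)
  have aeX: "AE x in \<mu>. x \<in> X"
  proof -
    have "AE x in \<mu>. h (\<theta> (T g x)) = T g x" if g: "g \<in> carrier G" for g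
    proof (rule AE_distrD[OF T[OF g], of "\<lambda>x. h (\<theta> x) = x"])
      show "AE x in distr \<mu> \<mu> (T g). h (\<theta> x) = x" unfolding pmp_actionD(3)[OF \<mu> g] by (rule ae)
    qed
    then have "AE x in \<mu>. \<forall>g\<in>carrier G. h (\<theta> (T g x)) = T g x"
      using G(2) by (simp add: AE_ball_countable)
    then show ?thesis using AE_space by eventually_elim (simp add: X_def)
  qed
  define S where "S g t = (if t \<in> U then \<theta> (T g (h t)) else t)" for g t
  have S_m [measurable]: "S g \<in> N \<rightarrow>\<^sub>M N" if g: "g \<in> carrier G" for g
  proof -
    note [measurable] = T[OF g]
    show ?thesis unfolding S_def by measurable
  qed
  have S\<theta>: "S g (\<theta> x) = \<theta> (T g x)" if "x \<in> X" for g x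
    using that \<theta>U X1 by (simp add: S_def)
  have aeS: "AE x in \<mu>. \<theta> (T g x) = S g (\<theta> x)" for g
    using aeX by eventually_elim (simp add: S\<theta>)
  have SU: "S g t \<in> U" if "g \<in> carrier G" "t \<in> U" for g t
    using that UD[OF that(2)] \<theta>U XT by (simp add: S_def)
  have "distr N N (S g) = N" if g: "g \<in> carrier G" for g
  proof -
    note [measurable] = T[OF g] S_m[OF g]
    have "distr N N (S g) = distr (distr \<mu> N \<theta>) N (S g)" unfolding d ..
    also have "\<dots> = distr \<mu> N (\<lambda>x. S g (\<theta> x))" by (subst distr_distr) (auto simp: o_def)
    also have "\<dots> = distr \<mu> N (\<lambda>x. \<theta> (T g x))"
      by (rule distr_cong_AE) (use aeS[of g] in \<open>auto simp: eq_commute\<close>)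
    also have "\<dots> = distr (distr \<mu> \<mu> (T g)) N \<theta>" by (subst distr_distr) (auto simp: o_def)
    also have "\<dots> = N" unfolding pmp_actionD(3)[OF \<mu> g] by (rule d)
    finally show ?thesis .
  qed
  moreover have "S \<one>\<^bsub>G\<^esub> t = t" if "t \<in> space N" for t
    using UD[of t] T_one[of "h t"] Xs by (auto simp: S_def)
  moreover have "S (g \<otimes>\<^bsub>G\<^esub> k) t = S g (S k t)" if g: "g \<in> carrier G" and k: "k \<in> carrier G" and "t \<in> space N" for g k t
  proof (cases "t \<in> U")
    case True
    have "S g (S k t) = \<theta> (T g (h (S k t)))" using SU[OF k True] by (simp add: S_def)
    also have "h (S k t) = T k (h t)" using True XD[OF UD(2)[OF True] k] by (simp add: S_def)
    finally show ?thesis using True T_mult[OF g k Xs[OF UD(2)[OF True]]] by (simp add: S_def)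
  qed (simp add: S_def)
  ultimately have pmp: "pmp_action G N S" using Np S_m by (simp add: pmp_action_def)
  have "ergodic_action G N S"
    unfolding ergodic_action_def
  proof (intro allI impI)
    fix A assume "invariant_set G N S A"
    then have A [measurable]: "A \<in> sets N" and inv: "\<And>g. g \<in> carrier G \<Longrightarrow> S g -` A \<inter> space N = A"
      by (auto simp: invariant_set_def)
    \<comment> \<open>The equation between \<open>\<theta> (T g x)\<close> and
      \<open>S g (\<theta> x)\<close> holds throughout \<open>X\<close>. Cutting down to this
      invariant conull set makes the pulled-back set strictly invariant without changing its
      measure.\<close>
    let ?A = "{x \<in> space \<mu>. x \<in> X \<and> \<theta> x \<in> A}"
    have "invariant_set G \<mu> T ?A"
      unfolding invariant_set_def
    proof (intro conjI ballI equalityI subsetI)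
      show "?A \<in> sets \<mu>" by measurable
      fix g x assume g: "g \<in> carrier G"
      {
        assume x: "x \<in> T g -` ?A \<inter> space \<mu>"
        then have Tx: "T g x \<in> X" "\<theta> (T g x) \<in> A" and xs: "x \<in> space \<mu>" by auto
        have xX: "x \<in> X"
          using XT[OF Tx(1), of "inv\<^bsub>G\<^esub> g"] pmp_action_inv(1)[OF \<mu> G(1) g xs] g by simp
        then have "S g (\<theta> x) \<in> A" using S\<theta> Tx by simp
        then have "\<theta> x \<in> A" using inv[OF g] \<theta>_space[OF xs] by blast
        then show "x \<in> ?A" using xX xs by simp
      }
      assume x: "x \<in> ?A"
      then have "S g (\<theta> x) \<in> A" using inv[OF g] by blast
      then show "x \<in> T g -` ?A \<inter> space \<mu>" using x XT[OF _ g] S\<theta> T_space[OF g] by auto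
    qed
    then have "emeasure \<mu> ?A = 0 \<or> emeasure \<mu> ?A = 1" using erg by (simp add: ergodic_action_def)
    moreover have "emeasure N A = emeasure \<mu> ?A"
    proof -
      have "emeasure N A = emeasure (distr \<mu> N \<theta>) A" unfolding d ..
      also have "\<dots> = emeasure \<mu> (\<theta> -` A \<inter> space \<mu>)" by (rule emeasure_distr) measurable
      also have "\<dots> = emeasure \<mu> ?A"
        by (rule emeasure_eq_AE) (use aeX in \<open>auto elim: AE_mp\<close>)
      finally show ?thesis .
    qed
    ultimately show "emeasure N A = 0 \<or> emeasure N A = 1" by simp
  qed
  moreover have "factor_map G K R N S (\<lambda>t. \<pi> (h t))"
  proof -
    have \<pi> [measurable]: "\<pi> \<in> \<mu> \<rightarrow>\<^sub>M K" and d\<pi>: "distr \<mu> K \<pi> = K" using f\<pi> by (auto simp: factor_map_def)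
    have "distr N K (\<lambda>t. \<pi> (h t)) = distr (distr \<mu> N \<theta>) K (\<lambda>t. \<pi> (h t))" unfolding d ..
    also have "\<dots> = distr \<mu> K (\<lambda>x. \<pi> (h (\<theta> x)))" by (subst distr_distr) (auto simp: o_def)
    also have "\<dots> = distr \<mu> K \<pi>" by (rule distr_cong_AE) (use ae in \<open>auto elim: AE_mp\<close>)
    finally have "distr N K (\<lambda>t. \<pi> (h t)) = K" using d\<pi> by simp
    moreover have "AE t in N. \<pi> (h (S g t)) = R g (\<pi> (h t))" if g: "g \<in> carrier G" for g
    proof -
      have aeU: "AE t in N. t \<in> U"
      proof -
        have "AE t in distr \<mu> N \<theta>. t \<in> U"
          by (subst AE_distr_iff) (use aeX \<theta>U in \<open>auto elim: AE_mp simp: U_def[symmetric]\<close>)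
        then show ?thesis unfolding d .
      qed
      \<comment> \<open>The set where equivariance fails is not known to be measurable, so a null
        set containing it is transported instead.\<close>
      obtain Z where Z: "Z \<in> null_sets \<mu>" "{x \<in> space \<mu>. \<pi> (T g x) \<noteq> R g (\<pi> x)} \<subseteq> Z"
      proof -
        have "AE x in \<mu>. \<pi> (T g x) = R g (\<pi> x)" using f\<pi> g by (simp add: factor_map_def)
        then show ?thesis by (auto elim!: AE_E intro: that)
      qed
      have "AE x in \<mu>. h (\<theta> x) \<notin> Z"
        using ae AE_not_in[OF Z(1)] by eventually_elim simp
      then have "AE t in distr \<mu> N \<theta>. h t \<notin> Z"
        using Z(1) by (subst AE_distr_iff) auto
      then have "AE t in N. h t \<notin> Z" unfolding d .
      then show ?thesis using aeU
      proof eventually_elim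
        case (elim t)
        have "h (S g t) = T g (h t)" using elim(2) XD[OF UD(2)[OF elim(2)] g] by (simp add: S_def)
        then show ?case using elim(1) Z(2) Xs[OF UD(2)[OF elim(2)]] by auto
      qed
    qed
    ultimately show ?thesis unfolding factor_map_def by auto
  qed
  ultimately show ?thesis using pmp aeS by blast
qed

section \<open>Transport of joinings to a model\<close>

lemma joining_over_push:
  assumes J: "joining_over G M T \<pi> \<mu> T' \<pi>' J"
    and rK: "real_retract K \<zeta> \<theta>K" and \<pi> [measurable]: "\<pi> \<in> M \<rightarrow>\<^sub>M K" and \<rho> [measurable]: "\<rho> \<in> N \<rightarrow>\<^sub>M K"
    and T: "\<And>g. g \<in> carrier G \<Longrightarrow> T g \<in> M \<rightarrow>\<^sub>M M" and T': "\<And>g. g \<in> carrier G \<Longrightarrow> T' g \<in> \<mu> \<rightarrow>\<^sub>M \<mu>"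
    and S: "\<And>g. g \<in> carrier G \<Longrightarrow> S g \<in> N \<rightarrow>\<^sub>M N"
    and \<theta> [measurable]: "\<theta> \<in> \<mu> \<rightarrow>\<^sub>M N" and d: "distr \<mu> N \<theta> = N"
    and eqv: "\<And>g. g \<in> carrier G \<Longrightarrow> AE x in \<mu>. \<theta> (T' g x) = S g (\<theta> x)" and ae: "AE x in \<mu>. \<rho> (\<theta> x) = \<pi>' x"
  shows "joining_over G M T \<pi> N S \<rho> (distr J (M \<Otimes>\<^sub>M N) (map_prod (\<lambda>x. x) \<theta>))" (is "joining_over _ _ _ _ _ _ _ ?J")
proof -
  note JD = joining_overD[OF J]
  interpret J: prob_space J by (rule JD(1))
  have [measurable_cong]: "sets J = sets (M \<Otimes>\<^sub>M \<mu>)" by (rule JD(2))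
  note [measurable] = real_retractD(1)[OF rK]
  have \<Theta> [measurable]: "map_prod (\<lambda>x. x) \<theta> \<in> J \<rightarrow>\<^sub>M M \<Otimes>\<^sub>M N" by (simp add: map_prod_def) measurable
  have "distr ?J M fst = distr J M fst" by (subst distr_distr) (auto simp: o_def)
  then have 1: "distr ?J M fst = M" using JD(3) by simp
  have "distr ?J N snd = distr J N (\<lambda>w. \<theta> (snd w))" by (subst distr_distr) (auto simp: o_def)
  also have "\<dots> = distr (distr J \<mu> snd) N \<theta>" by (subst distr_distr) (auto simp: o_def)
  finally have 2: "distr ?J N snd = N" unfolding JD(4) d .
  have 3: "distr ?J ?J (map_prod (T g) (S g)) = ?J" if g: "g \<in> carrier G" for g
  proof -
    note [measurable] = T[OF g] S[OF g] T'[OF g]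
    have TS [measurable]: "map_prod (T g) (S g) \<in> M \<Otimes>\<^sub>M N \<rightarrow>\<^sub>M M \<Otimes>\<^sub>M N"
      and TT [measurable]: "map_prod (T g) (T' g) \<in> J \<rightarrow>\<^sub>M J" by (simp_all add: map_prod_def) measurable
    have "distr ?J ?J (map_prod (T g) (S g)) = distr ?J (M \<Otimes>\<^sub>M N) (map_prod (T g) (S g))"
      by (rule distr_cong) auto
    also have "\<dots> = distr J (M \<Otimes>\<^sub>M N) (\<lambda>w. map_prod (T g) (S g) (map_prod (\<lambda>x. x) \<theta> w))"
      by (subst distr_distr) (auto simp: o_def)
    also have "\<dots> = distr J (M \<Otimes>\<^sub>M N) (\<lambda>w. map_prod (\<lambda>x. x) \<theta> (map_prod (T g) (T' g) w))"
    proof (rule distr_cong_AE)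
      show "AE w in J. map_prod (T g) (S g) (map_prod (\<lambda>x. x) \<theta> w) = map_prod (\<lambda>x. x) \<theta> (map_prod (T g) (T' g) w)"
        using AE_joining_over_snd[OF J eqv[OF g]] by eventually_elim (simp add: map_prod_def case_prod_beta)
    qed (simp_all, measurable)
    also have "\<dots> = distr (distr J J (map_prod (T g) (T' g))) (M \<Otimes>\<^sub>M N) (map_prod (\<lambda>x. x) \<theta>)"
      by (subst distr_distr) (auto simp: o_def)
    finally show ?thesis unfolding JD(5)[OF g] .
  qed
  have sp: "\<pi> (fst w) \<in> space K" "\<rho> (snd w) \<in> space K" if "w \<in> space ?J" for w
    using that measurable_space[OF \<pi>] measurable_space[OF \<rho>] by (auto simp: space_pair_measure)
  have "AE w in J. \<zeta> (\<pi> (fst (map_prod (\<lambda>x. x) \<theta> w))) = \<zeta> (\<rho> (snd (map_prod (\<lambda>x. x) \<theta> w)))"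
    using JD(6) AE_joining_over_snd[OF J ae] by eventually_elim (simp add: map_prod_def case_prod_beta)
  then have "AE w in ?J. \<zeta> (\<pi> (fst w)) = \<zeta> (\<rho> (snd w))"
    by (subst AE_distr_iff[OF \<Theta>]) measurable
  then have "AE w in ?J. \<pi> (fst w) = \<rho> (snd w)"
    using AE_space
  proof eventually_elim
    case (elim w)
    then show ?case using sp[OF elim(2)] real_retractD(3)[OF rK] by metis
  qed
  then show ?thesis
    using 1 2 3 J.prob_space_distr[OF \<Theta>] unfolding joining_over_def by (simp add: case_prod_beta)
qed

text \<open>Pushing by \<open>\<theta>\<close> on the second coordinate is injective on joinings,
  because \<open>h\<close> undoes it almost surely; the model admits only one joining.\<close>

lemma joinings_eq_if_disjoint_model:
  assumes disj: "disjoint_over G K M T \<pi> N S \<rho>"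
    and J1: "joining_over G M T \<pi> \<mu> T' \<pi>' J1" and J2: "joining_over G M T \<pi> \<mu> T' \<pi>' J2"
    and rK: "real_retract K \<zeta> \<theta>K" and \<pi>: "\<pi> \<in> M \<rightarrow>\<^sub>M K" and \<rho>: "\<rho> \<in> N \<rightarrow>\<^sub>M K"
    and T: "\<And>g. g \<in> carrier G \<Longrightarrow> T g \<in> M \<rightarrow>\<^sub>M M" and T': "\<And>g. g \<in> carrier G \<Longrightarrow> T' g \<in> \<mu> \<rightarrow>\<^sub>M \<mu>"
    and S: "\<And>g. g \<in> carrier G \<Longrightarrow> S g \<in> N \<rightarrow>\<^sub>M N"
    and \<theta> [measurable]: "\<theta> \<in> \<mu> \<rightarrow>\<^sub>M N" and d: "distr \<mu> N \<theta> = N"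
    and eqv: "\<And>g. g \<in> carrier G \<Longrightarrow> AE x in \<mu>. \<theta> (T' g x) = S g (\<theta> x)" and ae: "AE x in \<mu>. \<rho> (\<theta> x) = \<pi>' x"
    and h [measurable]: "h \<in> N \<rightarrow>\<^sub>M \<mu>" and h\<theta>: "AE x in \<mu>. h (\<theta> x) = x"
  shows "J1 = J2"
proof -
  let ?push = "\<lambda>J. distr J (M \<Otimes>\<^sub>M N) (map_prod (\<lambda>x. x) \<theta>)"
  have inv: "J = distr (?push J) (M \<Otimes>\<^sub>M \<mu>) (map_prod (\<lambda>x. x) h)"
    if J: "joining_over G M T \<pi> \<mu> T' \<pi>' J" for J
  proof -
    note JD = joining_overD[OF J]
    have [measurable_cong]: "sets J = sets (M \<Otimes>\<^sub>M \<mu>)" by (rule JD(2))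
    have [measurable]: "map_prod (\<lambda>x. x) \<theta> \<in> J \<rightarrow>\<^sub>M M \<Otimes>\<^sub>M N" "map_prod (\<lambda>x. x) h \<in> M \<Otimes>\<^sub>M N \<rightarrow>\<^sub>M M \<Otimes>\<^sub>M \<mu>"
      by (simp_all add: map_prod_def) measurable
    have "distr (?push J) (M \<Otimes>\<^sub>M \<mu>) (map_prod (\<lambda>x. x) h) = distr J (M \<Otimes>\<^sub>M \<mu>) (\<lambda>w. map_prod (\<lambda>x. x) h (map_prod (\<lambda>x. x) \<theta> w))"
      by (subst distr_distr) (auto simp: o_def)
    also have "\<dots> = distr J (M \<Otimes>\<^sub>M \<mu>) (\<lambda>w. w)"
    proof (rule distr_cong_AE)
      show "AE w in J. map_prod (\<lambda>x. x) h (map_prod (\<lambda>x. x) \<theta> w) = w"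
        using AE_joining_over_snd[OF J h\<theta>] by eventually_elim (simp add: map_prod_def case_prod_beta)
    qed (simp_all, measurable)
    also have "\<dots> = J" by (rule distr_id2) (simp add: JD(2))
    finally show ?thesis ..
  qed
  have "?push J1 = ?push J2"
    using disj joining_over_push[OF J1 rK \<pi> \<rho> T T' S \<theta> d eqv ae] joining_over_push[OF J2 rK \<pi> \<rho> T T' S \<theta> d eqv ae]
    unfolding disjoint_over_def by (metis mem_Collect_eq singletonD)
  then show ?thesis using inv[OF J1] inv[OF J2] by metis
qed

section \<open>Compactness of the space of joinings\<close>

text \<open>Tychonoff's theorem for a power of the unit interval. The exponent will be all pairs of
  sets, so a product of this size need not be sequentially compact. A filter finer than
  \<open>sequentially\<close> is enough, since limits along it still respect inequalities and
  sums.\<close>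

lemma exists_limit_filter:
  fixes \<alpha> :: "nat \<Rightarrow> 'i \<Rightarrow> real"
  assumes "\<And>n i. 0 \<le> \<alpha> n i" "\<And>n i. \<alpha> n i \<le> 1"
  shows "\<exists>H. H \<noteq> bot \<and> H \<le> sequentially \<and> (\<forall>i. \<exists>l. ((\<lambda>n. \<alpha> n i) \<longlongrightarrow> l) H)"
proof -
  let ?C = "PiE UNIV (\<lambda>_::'i. {0..1::real})"
  have "compactin (product_topology (\<lambda>_::'i. euclidean) UNIV) ?C"
    by (simp add: compactin_PiE)
  then have "compact ?C"
    by (simp add: euclidean_product_topology)
  moreover have "eventually (\<lambda>x. x \<in> ?C) (filtermap \<alpha> sequentially)"
    using assms unfolding eventually_filtermap by (intro always_eventually) auto
  moreover have "filtermap \<alpha> sequentially \<noteq> bot" by (simp add: filtermap_bot_iff)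
  ultimately obtain x where x: "inf (nhds x) (filtermap \<alpha> sequentially) \<noteq> bot"
    unfolding compact_filter by blast
  \<comment> \<open>The traces on the indices of the neighbourhoods of a cluster point, together
    with the tails; clustering is precisely the properness of this filter.\<close>
  define H where "H = inf sequentially (filtercomap \<alpha> (nhds x))"
  have "H \<noteq> bot"
  proof
    assume "H = bot"
    then have "eventually (\<lambda>_. False) H" by simp
    then obtain P Q where P: "eventually P sequentially" and Q: "eventually Q (filtercomap \<alpha> (nhds x))"
      and PQ: "\<And>n. P n \<Longrightarrow> Q n \<Longrightarrow> False"
      unfolding H_def eventually_inf by blast
    from Q obtain Q' where Q': "eventually Q' (nhds x)" "\<And>n. Q' (\<alpha> n) \<Longrightarrow> Q n"
      unfolding eventually_filtercomap by blast
    have "eventually (\<lambda>y. \<not> Q' y) (filtermap \<alpha> sequentially)"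
      unfolding eventually_filtermap using P by eventually_elim (use PQ Q' in blast)
    with Q'(1) have "eventually (\<lambda>_. False) (inf (nhds x) (filtermap \<alpha> sequentially))"
      unfolding eventually_inf by blast
    with x show False by (simp add: trivial_limit_def)
  qed
  moreover have "H \<le> sequentially" by (simp add: H_def)
  moreover have "((\<lambda>n. \<alpha> n i) \<longlongrightarrow> x i) H" for i
  proof -
    have "filterlim \<alpha> (nhds x) H"
      unfolding H_def filterlim_iff_le_filtercomap by simp
    then have lim: "eventually P (nhds x) \<Longrightarrow> eventually (\<lambda>n. P (\<alpha> n)) H" for P
      by (simp add: filterlim_iff)
    show ?thesis
    proof (rule topological_tendstoI)
      fix S :: "real set" assume S: "open S" "x i \<in> S"
      have "open ((\<lambda>y. y i) -` S)"
        by (rule open_vimage[OF S(1) continuous_on_product_coordinates])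
      then have "eventually (\<lambda>y. y \<in> (\<lambda>y. y i) -` S) (nhds x)"
        using S(2) by (intro eventually_nhds_in_open) auto
      then show "eventually (\<lambda>n. \<alpha> n i \<in> S) H" using lim by fastforce
    qed
  qed
  ultimately show ?thesis by blast
qed

text \<open>Couplings are approximated by members of a countable family: the coupling is prescribed, with
  rational weights \<open>f\<close>, on the rectangles of a finite partition and is a product of conditional
  measures inside each rectangle. Cells are indexed by their membership vectors.\<close>

definition cell :: "'x measure \<Rightarrow> (nat \<Rightarrow> 'x set) \<Rightarrow> nat \<Rightarrow> bool list \<Rightarrow> 'x set" where
  "cell M E n s = {x \<in> space M. map (\<lambda>i. x \<in> E i) [0..<n] = s}"

definition cell_indices :: "nat \<Rightarrow> bool list set" where
  "cell_indices n = {s. length s = n}"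

definition step_coupling ::
  "'x measure \<Rightarrow> (nat \<Rightarrow> 'x set) \<Rightarrow> nat \<Rightarrow> (bool list \<times> bool list \<Rightarrow> real) \<Rightarrow>
    'x measure \<Rightarrow> 'x measure \<Rightarrow> 'x set \<Rightarrow> 'x set \<Rightarrow> real" where
  "step_coupling M E n f \<mu> \<nu> A C =
     (\<Sum>s\<in>cell_indices n. \<Sum>t\<in>cell_indices n. f (s, t) *
       (measure \<mu> (A \<inter> cell M E n s) / measure \<mu> (cell M E n s)) *
       (measure \<nu> (C \<inter> cell M E n t) / measure \<nu> (cell M E n t)))"

text \<open>Inequalities instead of equalities, as rational weights cannot in general meet the real
  masses of the cells. The missing mass is bounded separately and disappears in the limit.\<close>

definition subcoupling ::
  "'x measure \<Rightarrow> (nat \<Rightarrow> 'x set) \<Rightarrow> nat \<Rightarrow> (bool list \<times> bool list \<Rightarrow> real) \<Rightarrow>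
    'x measure \<Rightarrow> 'x measure \<Rightarrow> bool" where
  "subcoupling M E n f \<mu> \<nu> \<longleftrightarrow>
     (\<forall>s\<in>cell_indices n. \<forall>t\<in>cell_indices n. 0 \<le> f (s, t)) \<and>
     (\<forall>s\<in>cell_indices n. (\<Sum>t\<in>cell_indices n. f (s, t)) \<le> measure \<mu> (cell M E n s)) \<and>
     (\<forall>t\<in>cell_indices n. (\<Sum>s\<in>cell_indices n. f (s, t)) \<le> measure \<nu> (cell M E n t))"

text \<open>Measurable unions of cells. On rectangles with such sides the conditional measures
  inside the cells play no part, so the value is a sum of weights.\<close>

definition resolved :: "'x measure \<Rightarrow> (nat \<Rightarrow> 'x set) \<Rightarrow> nat \<Rightarrow> 'x set \<Rightarrow> bool" where
  "resolved M E n A \<longleftrightarrow> A \<in> sets M \<and> (\<forall>s. cell M E n s \<subseteq> A \<or> A \<inter> cell M E n s = {})"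

lemma finite_cell_indices [simp]: "finite (cell_indices n)"
  using finite_lists_length_eq[of "UNIV :: bool set" n] by (simp add: cell_indices_def)

lemma cell_indices_not_empty: "cell_indices n \<noteq> {}"
  using Ex_list_of_length[of n] by (auto simp: cell_indices_def)

lemma resolved_member: "i < n \<Longrightarrow> E i \<in> sets M \<Longrightarrow> resolved M E n (E i)"
  unfolding resolved_def cell_def by (auto dest: map_eq_conv[THEN iffD1])

lemma resolved_space: "resolved M E n (space M)"
  unfolding resolved_def cell_def by auto

section \<open>Step couplings: bounds, additivity, approximation\<close>

context
  fixes M :: "'x measure" and E :: "nat \<Rightarrow> 'x set"
  assumes E [measurable]: "\<And>i. E i \<in> sets M"
begin

lemma cell_measurable [measurable]: "cell M E n s \<in> sets M"
proof -
  have "cell M E n s = (if length s = n then {x \<in> space M. \<forall>i<n. (x \<in> E i) = s ! i} else {})"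
    by (auto simp: cell_def list_eq_iff_nth_eq)
  also have "\<dots> \<in> sets M" by simp
  finally show ?thesis .
qed

lemma sum_measure_cells:
  assumes "finite_measure \<mu>" and s: "sets \<mu> = sets M" and A: "A \<in> sets M"
  shows "(\<Sum>s\<in>cell_indices n. measure \<mu> (A \<inter> cell M E n s)) = measure \<mu> A"
proof -
  have "A = (\<Union>s\<in>cell_indices n. A \<inter> cell M E n s)"
    using sets.sets_into_space[OF A] by (auto simp: cell_def cell_indices_def)
  moreover have "disjoint_family_on (\<lambda>s. A \<inter> cell M E n s) (cell_indices n)"
    by (auto simp: disjoint_family_on_def cell_def)
  ultimately show ?thesis
    using finite_measure.finite_measure_finite_Union[OF assms(1), of "cell_indices n" "\<lambda>s. A \<inter> cell M E n s"] A s
    by (auto simp: image_subset_iff)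
qed

lemma step_coupling_swap: "step_coupling M E n f \<mu> \<nu> A C = step_coupling M E n (\<lambda>(s, t). f (t, s)) \<nu> \<mu> C A"
  unfolding step_coupling_def by (subst sum.swap) (simp add: mult_ac)

lemma subcoupling_swap: "subcoupling M E n f \<mu> \<nu> = subcoupling M E n (\<lambda>(s, t). f (t, s)) \<nu> \<mu>"
  unfolding subcoupling_def by auto

lemma step_coupling_bounds:
  assumes \<mu>: "finite_measure \<mu>" "sets \<mu> = sets M" and \<nu>: "finite_measure \<nu>" "sets \<nu> = sets M"
    and f: "subcoupling M E n f \<mu> \<nu>" and A: "A \<in> sets M" and C: "C \<in> sets M"
  shows "0 \<le> step_coupling M E n f \<mu> \<nu> A C" "step_coupling M E n f \<mu> \<nu> A C \<le> measure \<mu> A"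
proof -
  let ?I = "cell_indices n" and ?c = "cell M E n"
  let ?r = "\<lambda>s. measure \<mu> (A \<inter> ?c s) / measure \<mu> (?c s)" and ?q = "\<lambda>t. measure \<nu> (C \<inter> ?c t) / measure \<nu> (?c t)"
  show "0 \<le> step_coupling M E n f \<mu> \<nu> A C"
    unfolding step_coupling_def using f by (intro sum_nonneg mult_nonneg_nonneg) (auto simp: subcoupling_def)
  have q: "?q t \<le> 1" for t
    using finite_measure.finite_measure_mono[OF \<nu>(1), of "C \<inter> ?c t" "?c t"] \<nu>(2)
    by (auto simp: divide_le_eq_1 zero_less_measure_iff)
  have "step_coupling M E n f \<mu> \<nu> A C \<le> (\<Sum>s\<in>?I. \<Sum>t\<in>?I. f (s, t) * ?r s)"
    unfolding step_coupling_def
  proof (intro sum_mono)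
    fix s t assume "s \<in> ?I" "t \<in> ?I"
    then have "0 \<le> f (s, t) * ?r s" using f by (auto simp: subcoupling_def)
    then show "f (s, t) * ?r s * ?q t \<le> f (s, t) * ?r s"
      using mult_left_mono[OF q] by fastforce
  qed
  also have "\<dots> = (\<Sum>s\<in>?I. (\<Sum>t\<in>?I. f (s, t)) * ?r s)" by (simp only: sum_distrib_right)
  also have "\<dots> \<le> (\<Sum>s\<in>?I. measure \<mu> (?c s) * ?r s)"
    using f by (intro sum_mono mult_right_mono) (auto simp: subcoupling_def)
  \<comment> \<open>Termwise this is an equality unless the cell is null; then the quotient is 0 by
    the convention for division by zero, and the inequality still holds.\<close>
  also have "\<dots> \<le> (\<Sum>s\<in>?I. measure \<mu> (A \<inter> ?c s))"
    by (intro sum_mono) (auto simp: field_simps)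
  also have "\<dots> = measure \<mu> A" by (rule sum_measure_cells[OF \<mu> A])
  finally show "step_coupling M E n f \<mu> \<nu> A C \<le> measure \<mu> A" .
qed

lemma step_coupling_le_snd:
  assumes \<mu>: "finite_measure \<mu>" "sets \<mu> = sets M" and \<nu>: "finite_measure \<nu>" "sets \<nu> = sets M"
    and f: "subcoupling M E n f \<mu> \<nu>" and A: "A \<in> sets M" and C: "C \<in> sets M"
  shows "step_coupling M E n f \<mu> \<nu> A C \<le> measure \<nu> C"
  unfolding step_coupling_swap[of n f]
  using f subcoupling_swap by (intro step_coupling_bounds(2)[OF \<nu> \<mu> _ C A]) blast

lemma step_coupling_add:
  assumes \<mu>: "finite_measure \<mu>" "sets \<mu> = sets M" and A: "A \<in> sets M" "A' \<in> sets M" "A \<inter> A' = {}"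
  shows "step_coupling M E n f \<mu> \<nu> (A \<union> A') C = step_coupling M E n f \<mu> \<nu> A C + step_coupling M E n f \<mu> \<nu> A' C"
proof -
  have "measure \<mu> ((A \<union> A') \<inter> cell M E n s) = measure \<mu> (A \<inter> cell M E n s) + measure \<mu> (A' \<inter> cell M E n s)" for s
    unfolding Int_Un_distrib2 using A \<mu>(2) by (intro finite_measure.finite_measure_Union[OF \<mu>(1)]) auto
  then show ?thesis
    unfolding step_coupling_def sum.distrib[symmetric]
    by (intro sum.cong refl) (simp add: add_divide_distrib algebra_simps)
qed

lemma step_coupling_add_snd:
  assumes \<nu>: "finite_measure \<nu>" "sets \<nu> = sets M" and C: "C \<in> sets M" "C' \<in> sets M" "C \<inter> C' = {}"
  shows "step_coupling M E n f \<mu> \<nu> A (C \<union> C') = step_coupling M E n f \<mu> \<nu> A C + step_coupling M E n f \<mu> \<nu> A C'"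
  unfolding step_coupling_swap[of n f] by (rule step_coupling_add[OF \<nu> C])

text \<open>The masses of the cell rectangles are rounded down to rationals. Rounding down preserves
  the marginal inequalities, and the rounding errors add up to at most
  \<open>\<delta>\<close>.\<close>

lemma step_coupling_approx:
  assumes J: "prob_space J" and sJ: "sets J = sets (M \<Otimes>\<^sub>M M)"
    and \<mu>: "distr J M fst = \<mu>" and \<nu>: "distr J M snd = \<nu>" and \<delta>: "0 < \<delta>"
  shows "\<exists>f \<in> PiE (cell_indices n \<times> cell_indices n) (\<lambda>_. \<rat>). subcoupling M E n f \<mu> \<nu> \<and>
    (\<forall>A C. resolved M E n A \<longrightarrow> resolved M E n C \<longrightarrow>
      \<bar>step_coupling M E n f \<mu> \<nu> A C - measure J (A \<times> C)\<bar> \<le> \<delta>)"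
proof -
  interpret J: prob_space J by fact
  have [measurable_cong]: "sets J = sets (M \<Otimes>\<^sub>M M)" by (rule sJ)
  let ?I = "cell_indices n" and ?c = "cell M E n"
  have cM: "?c s \<subseteq> space M" for s by (auto simp: cell_def)
  have \<mu>A: "measure \<mu> A = measure J (A \<times> space M)" and \<nu>A: "measure \<nu> A = measure J (space M \<times> A)"
    if "A \<in> sets M" for A
    using measure_distr_fst[OF sJ that] measure_distr_snd[OF sJ that] by (simp_all add: \<mu> \<nu>)
  have split1: "(\<Sum>s\<in>?I. measure J ((A \<inter> ?c s) \<times> C)) = measure J (A \<times> C)" if A: "A \<in> sets M" and C: "C \<in> sets M" for A C
  proof -
    have "A \<times> C = (\<Union>s\<in>?I. (A \<inter> ?c s) \<times> C)"
      using sets.sets_into_space[OF A] by (auto simp: cell_def cell_indices_def)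
    moreover have "disjoint_family_on (\<lambda>s. (A \<inter> ?c s) \<times> C) ?I"
      by (auto simp: disjoint_family_on_def cell_def)
    ultimately show ?thesis
      using J.finite_measure_finite_Union[of ?I "\<lambda>s. (A \<inter> ?c s) \<times> C"] A C by (auto simp: image_subset_iff)
  qed
  have split2: "(\<Sum>t\<in>?I. measure J (A \<times> (C \<inter> ?c t))) = measure J (A \<times> C)" if A: "A \<in> sets M" and C: "C \<in> sets M" for A C
  proof -
    have "A \<times> C = (\<Union>t\<in>?I. A \<times> (C \<inter> ?c t))"
      using sets.sets_into_space[OF C] by (auto simp: cell_def cell_indices_def)
    moreover have "disjoint_family_on (\<lambda>t. A \<times> (C \<inter> ?c t)) ?I"
      by (auto simp: disjoint_family_on_def cell_def)
    ultimately show ?thesis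
      using J.finite_measure_finite_Union[of ?I "\<lambda>t. A \<times> (C \<inter> ?c t)"] A C by (auto simp: image_subset_iff)
  qed
  \<comment> \<open>The admissible error divided by the number of pairs of cells.\<close>
  define \<delta>' where "\<delta>' = \<delta> / (real (card ?I) * real (card ?I))"
  have cI: "0 < card ?I" by (simp add: card_gt_0_iff cell_indices_not_empty)
  have \<delta>': "0 < \<delta>'" using \<delta> cI by (simp add: \<delta>'_def)
  have "\<exists>q\<in>\<rat>. 0 \<le> q \<and> q \<le> x \<and> x - \<delta>' \<le> q" if "0 \<le> x" for x :: real
  proof (cases "x = 0")
    case True
    then show ?thesis using \<delta>' by (intro bexI[of _ 0]) auto
  next
    case False
    then have "max 0 (x - \<delta>') < x" using that \<delta>' by auto
    then obtain q where "q \<in> \<rat>" "max 0 (x - \<delta>') < q" "q < x" using Rats_dense_in_real by blast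
    then show ?thesis by (intro bexI[of _ q]) auto
  qed
  then obtain q where q: "\<And>x. 0 \<le> x \<Longrightarrow> q x \<in> \<rat>" "\<And>x. 0 \<le> x \<Longrightarrow> 0 \<le> q x" "\<And>x. 0 \<le> x \<Longrightarrow> q x \<le> x"
    "\<And>x. 0 \<le> x \<Longrightarrow> x - \<delta>' \<le> (q x :: real)" by metis
  define f where "f = restrict (\<lambda>(s, t). q (measure J (?c s \<times> ?c t))) (?I \<times> ?I)"
  have f: "f (s, t) = q (measure J (?c s \<times> ?c t))" if "s \<in> ?I" "t \<in> ?I" for s t
    using that by (simp add: f_def)
  have fJ: "0 \<le> f (s, t)" "f (s, t) \<le> measure J (?c s \<times> ?c t)" "measure J (?c s \<times> ?c t) - \<delta>' \<le> f (s, t)"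
    if "s \<in> ?I" "t \<in> ?I" for s t
    using that q by (simp_all add: f)
  have f_E: "f \<in> PiE (?I \<times> ?I) (\<lambda>_. \<rat>)"
    unfolding f_def using q(1) by auto
  have sub: "subcoupling M E n f \<mu> \<nu>"
    unfolding subcoupling_def
  proof (intro conjI ballI)
    fix s assume s: "s \<in> ?I"
    show "0 \<le> f (s, t)" if "t \<in> ?I" for t using fJ s that by blast
    have "(\<Sum>t\<in>?I. f (s, t)) \<le> (\<Sum>t\<in>?I. measure J (?c s \<times> (space M \<inter> ?c t)))"
      using fJ s cM by (intro sum_mono) (simp add: Int_absorb1)
    also have "\<dots> = measure \<mu> (?c s)"
      by (subst split2) (simp_all add: \<mu>A)
    finally show "(\<Sum>t\<in>?I. f (s, t)) \<le> measure \<mu> (?c s)" .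
    have "(\<Sum>t\<in>?I. f (t, s)) \<le> (\<Sum>t\<in>?I. measure J ((space M \<inter> ?c t) \<times> ?c s))"
      using fJ s cM by (intro sum_mono) (simp add: Int_absorb1)
    also have "\<dots> = measure \<nu> (?c s)"
      by (subst split1) (simp_all add: \<nu>A)
    finally show "(\<Sum>t\<in>?I. f (t, s)) \<le> measure \<nu> (?c s)" .
  qed
  have "\<bar>step_coupling M E n f \<mu> \<nu> A C - measure J (A \<times> C)\<bar> \<le> \<delta>"
    if A: "resolved M E n A" and C: "resolved M E n C" for A C
  proof -
    have AM: "A \<in> sets M" and CM: "C \<in> sets M" using A C by (auto simp: resolved_def)
    let ?t = "\<lambda>s t. f (s, t) * (measure \<mu> (A \<inter> ?c s) / measure \<mu> (?c s)) * (measure \<nu> (C \<inter> ?c t) / measure \<nu> (?c t))"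
    have "measure J (A \<times> C) = (\<Sum>s\<in>?I. \<Sum>t\<in>?I. measure J ((A \<inter> ?c s) \<times> (C \<inter> ?c t)))"
      using AM CM by (simp add: split1 split2)
    then have "\<bar>step_coupling M E n f \<mu> \<nu> A C - measure J (A \<times> C)\<bar> =
        \<bar>\<Sum>s\<in>?I. \<Sum>t\<in>?I. ?t s t - measure J ((A \<inter> ?c s) \<times> (C \<inter> ?c t))\<bar>"
      by (simp add: step_coupling_def sum_subtractf)
    also have "\<dots> \<le> (\<Sum>s\<in>?I. \<Sum>t\<in>?I. \<bar>?t s t - measure J ((A \<inter> ?c s) \<times> (C \<inter> ?c t))\<bar>)"
      by (intro order_trans[OF sum_abs] sum_mono) simp
    also have "\<dots> \<le> (\<Sum>s\<in>?I. \<Sum>t\<in>?I. \<delta>')"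
    proof (intro sum_mono)
      fix s t assume s: "s \<in> ?I" and t: "t \<in> ?I"
      consider "A \<inter> ?c s = {}" | "C \<inter> ?c t = {}" | "A \<inter> ?c s = ?c s" "C \<inter> ?c t = ?c t"
        using A C unfolding resolved_def by blast
      then show "\<bar>?t s t - measure J ((A \<inter> ?c s) \<times> (C \<inter> ?c t))\<bar> \<le> \<delta>'"
      proof cases
        case 3
        have "measure J (?c s \<times> ?c t) \<le> measure \<mu> (?c s)" "measure J (?c s \<times> ?c t) \<le> measure \<nu> (?c t)"
          using cM by (auto simp: \<mu>A \<nu>A intro!: J.finite_measure_mono)
        \<comment> \<open>A rectangle with a null side has \<open>J\<close>-mass 0, so its weight
          was rounded to 0. Hence the zero quotients of null cells do no damage.\<close>
        then have "f (s, t) = 0 \<or> measure \<mu> (?c s) \<noteq> 0 \<and> measure \<nu> (?c t) \<noteq> 0"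
          using fJ[OF s t] by force
        then have ts: "?t s t = f (s, t)" unfolding 3 by auto
        have "measure J ((A \<inter> ?c s) \<times> (C \<inter> ?c t)) = measure J (?c s \<times> ?c t)" unfolding 3 ..
        then show ?thesis unfolding ts using fJ[OF s t] by simp
      qed (use \<delta>' in auto)
    qed
    also have "\<dots> = \<delta>" using cI cell_indices_not_empty by (simp add: \<delta>'_def)
    finally show ?thesis .
  qed
  with f_E sub show ?thesis by blast
qed

end

section \<open>Countable tests for joinings\<close>

context decomposed_extension
begin

text \<open>Pullbacks of the generators of \<open>M\<close> test invariance; preimages of a sublevel
  set of \<open>K\<close> and of its complement test that both coordinates lie over the same point.
  The empty set allows the vanishing of a mass to be written as an equality of two rectangle
  masses.\<close>

definition test_family :: "'x set set" where
  "test_family = {{}, space M} \<union> (\<lambda>(g, r). T g -` sublevel M \<phi> r \<inter> space M) ` (carrier G \<times> UNIV) \<union>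
     range (\<lambda>r. \<pi> -` sublevel K \<zeta> r \<inter> space M) \<union> range (\<lambda>r. \<pi> -` (space K - sublevel K \<zeta> r) \<inter> space M)"

definition test_set :: "nat \<Rightarrow> 'x set" where
  "test_set = from_nat_into test_family"

text \<open>A coupling of two measures over \<open>K\<close> is a joining iff it gives equal mass to the two rectangles
  of each of these countably many tests.\<close>

definition tests :: "(nat \<times> nat \<times> nat \<times> nat) set" where
  "tests = {(i, j, k, l).
     (\<exists>g\<in>carrier G. test_set k = T g -` test_set i \<inter> space M \<and> test_set l = T g -` test_set j \<inter> space M) \<or>
     test_set k = {} \<and> (\<exists>r.
       test_set i = \<pi> -` sublevel K \<zeta> r \<inter> space M \<and> test_set j = \<pi> -` (space K - sublevel K \<zeta> r) \<inter> space M \<or>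
       test_set i = \<pi> -` (space K - sublevel K \<zeta> r) \<inter> space M \<and> test_set j = \<pi> -` sublevel K \<zeta> r \<inter> space M)}"

lemma test_family_sets: "test_family \<subseteq> sets M"
proof -
  note [measurable] = real_retractD(1)[OF rK] real_retractD(1)[OF rM]
  have "T g -` sublevel M \<phi> r \<inter> space M \<in> sets M" if "g \<in> carrier G" for g r
    by (rule measurable_sets[OF pmp_actionD(2)[OF M that]]) measurable
  moreover have "\<pi> -` sublevel K \<zeta> r \<inter> space M \<in> sets M" "\<pi> -` (space K - sublevel K \<zeta> r) \<inter> space M \<in> sets M" for r
    by measurable
  ultimately show ?thesis by (auto simp: test_family_def)
qed

lemma range_test_set: "range test_set = test_family"
proof -
  have "countable (carrier G \<times> (UNIV :: rat set))" using G(2) by simp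
  then have "countable test_family" unfolding test_family_def by (intro countable_Un countable_image) auto
  then show ?thesis unfolding test_set_def by (intro range_from_nat_into) (auto simp: test_family_def)
qed

lemma test_set_measurable [measurable]: "test_set i \<in> sets M"
  using range_test_set test_family_sets by auto

lemma ex_test_set: "A \<in> test_family \<Longrightarrow> \<exists>i. A = test_set i"
  using range_test_set by (metis imageE)

lemma sublevel_in_test_family: "sublevel M \<phi> r \<in> test_family"
proof -
  have "sublevel M \<phi> r = T \<one>\<^bsub>G\<^esub> -` sublevel M \<phi> r \<inter> space M"
    using pmp_actionD(4)[OF M] by (auto simp: sublevel_def)
  moreover have "T \<one>\<^bsub>G\<^esub> -` sublevel M \<phi> r \<inter> space M \<in> test_family"
    using group.is_monoid[OF G(1), THEN monoid.one_closed] by (auto simp: test_family_def)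
  ultimately show ?thesis by metis
qed

lemma joining_tests:
  assumes J: "joining_over G \<mu> T \<pi> \<nu> T \<pi> J" and s: "sets \<mu> = sets M" "sets \<nu> = sets M"
    and t: "(i, j, k, l) \<in> tests"
  shows "measure J (test_set i \<times> test_set j) = measure J (test_set k \<times> test_set l)"
proof -
  interpret J: prob_space J by (rule joining_overD(1)[OF J])
  have sJ [measurable_cong]: "sets J = sets (M \<Otimes>\<^sub>M M)"
    using joining_overD(2)[OF J] sets_pair_measure_cong[OF s] by simp
  note spJ = space_coupling[OF sJ]
  from t consider (inv) g where "g \<in> carrier G" "test_set k = T g -` test_set i \<inter> space M" "test_set l = T g -` test_set j \<inter> space M"
    | (graph) r where "test_set k = {}"
        "test_set i = \<pi> -` sublevel K \<zeta> r \<inter> space M \<and> test_set j = \<pi> -` (space K - sublevel K \<zeta> r) \<inter> space M \<or>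
         test_set i = \<pi> -` (space K - sublevel K \<zeta> r) \<inter> space M \<and> test_set j = \<pi> -` sublevel K \<zeta> r \<inter> space M"
    unfolding tests_def by blast
  then show ?thesis
  proof cases
    case inv
    note [measurable] = pmp_actionD(2)[OF M inv(1)]
    have [measurable]: "map_prod (T g) (T g) \<in> J \<rightarrow>\<^sub>M J" by (simp add: map_prod_def) measurable
    have "measure J (test_set i \<times> test_set j) = measure (distr J J (map_prod (T g) (T g))) (test_set i \<times> test_set j)"
      unfolding joining_overD(5)[OF J inv(1)] ..
    also have "\<dots> = measure J (test_set k \<times> test_set l)"
      by (subst measure_distr) (auto simp: sJ spJ inv(2,3) intro!: arg_cong[where f = "measure J"])
    finally show ?thesis .
  next
    case graph
    have "AE w in J. w \<notin> test_set i \<times> test_set j"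
      using joining_overD(6)[OF J] by eventually_elim (use graph(2) in auto)
    then have "measure J (test_set i \<times> test_set j) = 0"
      by (intro measure_eq_0_null_sets) (simp add: AE_iff_null_sets)
    then show ?thesis using graph(1) by simp
  qed
qed

text \<open>Invariance need only be checked on rectangles of sublevel sets, which determine a finite
  measure on the product. Two different points of \<open>K\<close> are separated by a rational level
  of \<open>\<zeta>\<close>, so off the graph condition lies a countable union of null
  rectangles.\<close>

lemma joining_if_tests:
  assumes J: "prob_space J" "sets J = sets (\<mu> \<Otimes>\<^sub>M \<nu>)" "distr J \<mu> fst = \<mu>" "distr J \<nu> snd = \<nu>"
    and s: "sets \<mu> = sets M" "sets \<nu> = sets M"
    and t: "\<And>i j k l. (i, j, k, l) \<in> tests \<Longrightarrow> measure J (test_set i \<times> test_set j) = measure J (test_set k \<times> test_set l)"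
  shows "joining_over G \<mu> T \<pi> \<nu> T \<pi> J"
proof -
  interpret J: prob_space J by fact
  note [measurable] = real_retractD(1)[OF rK] real_retractD(1)[OF rM]
  have sJ [measurable_cong]: "sets J = sets (M \<Otimes>\<^sub>M M)"
    using J(2) sets_pair_measure_cong[OF s] by simp
  note spJ = space_coupling[OF sJ]
  have "distr J J (map_prod (T g) (T g)) = J" if g: "g \<in> carrier G" for g
  proof -
    note [measurable] = pmp_actionD(2)[OF M g]
    have TT [measurable]: "map_prod (T g) (T g) \<in> J \<rightarrow>\<^sub>M J" by (simp add: map_prod_def) measurable
    interpret D: prob_space "distr J J (map_prod (T g) (T g))" by (rule J.prob_space_distr[OF TT])
    show ?thesis
    proof (rule measure_eqI_rect_sublevel[OF rM rM D.finite_measure_axioms J.finite_measure_axioms])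
      fix r q
      have fam: "T g -` sublevel M \<phi> r \<inter> space M \<in> test_family" for r
        using g by (auto simp: test_family_def)
      obtain i j k l where i: "sublevel M \<phi> r = test_set i" "sublevel M \<phi> q = test_set j"
        and k: "T g -` sublevel M \<phi> r \<inter> space M = test_set k" "T g -` sublevel M \<phi> q \<inter> space M = test_set l"
        using ex_test_set[OF sublevel_in_test_family] ex_test_set[OF fam] by metis
      have "test_set k = T g -` test_set i \<inter> space M" "test_set l = T g -` test_set j \<inter> space M"
        unfolding i[symmetric] k by auto
      then have "(i, j, k, l) \<in> tests" using g unfolding tests_def by blast
      have "measure (distr J J (map_prod (T g) (T g))) (sublevel M \<phi> r \<times> sublevel M \<phi> q) =
          measure J ((T g -` sublevel M \<phi> r \<inter> space M) \<times> (T g -` sublevel M \<phi> q \<inter> space M))"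
        by (subst measure_distr) (auto simp: sJ spJ intro!: arg_cong[where f = "measure J"])
      also have "\<dots> = measure J (sublevel M \<phi> r \<times> sublevel M \<phi> q)"
        unfolding k unfolding i using t[OF \<open>(i, j, k, l) \<in> tests\<close>] by simp
      finally show "emeasure (distr J J (map_prod (T g) (T g))) (sublevel M \<phi> r \<times> sublevel M \<phi> q) = emeasure J (sublevel M \<phi> r \<times> sublevel M \<phi> q)"
        by (simp add: D.emeasure_eq_measure J.emeasure_eq_measure)
    qed (simp_all add: sJ)
  qed
  moreover have "AE w in J. \<pi> (fst w) = \<pi> (snd w)"
  proof -
    let ?A = "\<lambda>r. \<pi> -` sublevel K \<zeta> r \<inter> space M" and ?C = "\<lambda>r. \<pi> -` (space K - sublevel K \<zeta> r) \<inter> space M"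
    have fam: "?A r \<in> test_family" "?C r \<in> test_family" "{} \<in> test_family" for r
      by (auto simp: test_family_def)
    have null: "AE w in J. w \<notin> S \<times> S'" if "(S, S') = (?A r, ?C r) \<or> (S, S') = (?C r, ?A r)" for S S' r
    proof -
      have "S \<in> test_family" "S' \<in> test_family" using that fam by auto
      then obtain i j where i: "S = test_set i" "S' = test_set j" using ex_test_set by blast
      obtain k where k: "{} = test_set k" using ex_test_set[OF fam(3)] by blast
      have "(i, j, k, k) \<in> tests" using that k[symmetric] unfolding tests_def i by blast
      from t[OF this] have "measure J (S \<times> S') = 0" by (simp add: k[symmetric] i)
      moreover have "S \<times> S' \<in> sets J" unfolding i by simp
      ultimately show ?thesis by (intro AE_not_in) (simp add: J.emeasure_eq_measure null_sets_def)
    qed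
    have "AE w in J. \<forall>r. w \<notin> ?A r \<times> ?C r \<and> w \<notin> ?C r \<times> ?A r"
      unfolding AE_all_countable using null by (intro allI AE_conjI) blast+
    then show ?thesis
      using AE_space
    proof eventually_elim
      case (elim w)
      let ?x = "\<pi> (fst w)" and ?y = "\<pi> (snd w)"
      have w: "fst w \<in> space M" "snd w \<in> space M" using elim(2) by (auto simp: spJ)
      then have xy: "?x \<in> space K" "?y \<in> space K" using measurable_space[OF \<pi>_measurable] by auto
      have "\<not> \<zeta> ?x < \<zeta> ?y"
      proof
        assume "\<zeta> ?x < \<zeta> ?y"
        then obtain r where "\<zeta> ?x < real_of_rat r" "real_of_rat r < \<zeta> ?y" using of_rat_dense by blast
        then have "w \<in> ?A r \<times> ?C r" using w xy by (cases w) (auto simp: sublevel_def)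
        with elim(1) show False by blast
      qed
      moreover have "\<not> \<zeta> ?y < \<zeta> ?x"
      proof
        assume "\<zeta> ?y < \<zeta> ?x"
        then obtain r where "\<zeta> ?y < real_of_rat r" "real_of_rat r < \<zeta> ?x" using of_rat_dense by blast
        then have "w \<in> ?C r \<times> ?A r" using w xy by (cases w) (auto simp: sublevel_def)
        with elim(1) show False by blast
      qed
      ultimately show ?case using xy real_retractD(3)[OF rK] by (metis linorder_neqE_linordered_idom)
    qed
  qed
  ultimately show ?thesis using J unfolding joining_over_def by (simp add: case_prod_beta)
qed

section \<open>Approximate joinings of two components\<close>

definition indep_mass :: "('b \<times> 'z \<Rightarrow> 'x measure) \<Rightarrow> 'b \<Rightarrow> 'b \<Rightarrow> 'x set \<Rightarrow> 'x set \<Rightarrow> real" where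
  "indep_mass m b1 b2 A C = (\<integral>z. measure (m (b1, z)) A * measure (m (b2, z)) C \<partial>K)"

abbreviation "comp_coupling n f b1 b2 \<equiv> step_coupling M test_set n f (c b1) (c b2)"

text \<open>Stage \<open>n\<close> imposes finitely many inequalities, each measurable in the pair
  of components, with error 1/(n+1). The last clause keeps a gap of fixed sign
  \<open>\<sigma>\<close> on one test rectangle; it is imposed only for \<open>i0\<close> and
  \<open>j0\<close> below \<open>n\<close>, when the cells of the stage resolve the sides of that
  rectangle.\<close>

definition near_joining ::
  "('b \<times> 'z \<Rightarrow> 'x measure) \<Rightarrow> real \<Rightarrow> real \<Rightarrow> nat \<Rightarrow> nat \<Rightarrow> nat \<Rightarrow> (bool list \<times> bool list \<Rightarrow> real) \<Rightarrow> 'b \<Rightarrow> 'b \<Rightarrow> bool" where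
  "near_joining m \<sigma> \<epsilon> i0 j0 n f b1 b2 \<longleftrightarrow>
     subcoupling M test_set n f (c b1) (c b2) \<and>
     1 - inverse (real (Suc n)) \<le> comp_coupling n f b1 b2 (space M) (space M) \<and>
     (\<forall>i<n. \<forall>j<n. \<forall>k<n. \<forall>l<n. (i, j, k, l) \<in> tests \<longrightarrow>
       \<bar>comp_coupling n f b1 b2 (test_set i) (test_set j) - comp_coupling n f b1 b2 (test_set k) (test_set l)\<bar>
         \<le> inverse (real (Suc n))) \<and>
     (i0 < n \<longrightarrow> j0 < n \<longrightarrow>
       \<epsilon> \<le> \<sigma> * (comp_coupling n f b1 b2 (test_set i0) (test_set j0) - indep_mass m b1 b2 (test_set i0) (test_set j0)))"

text \<open>The weights at each stage form a countable set. Enumerating it permits a measurable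
  choice by taking the least index that works.\<close>

definition weights :: "nat \<Rightarrow> nat \<Rightarrow> (bool list \<times> bool list \<Rightarrow> real)" where
  "weights n = from_nat_into (PiE (cell_indices n \<times> cell_indices n) (\<lambda>_. \<rat>))"

definition nontrivial_pairs ::
  "('b \<times> 'z \<Rightarrow> 'x measure) \<Rightarrow> real \<Rightarrow> real \<Rightarrow> nat \<Rightarrow> nat \<Rightarrow> ('b \<times> 'b) set" where
  "nontrivial_pairs m \<sigma> \<epsilon> i0 j0 =
     {w \<in> space (B \<Otimes>\<^sub>M B). \<forall>n. \<exists>i. near_joining m \<sigma> \<epsilon> i0 j0 n (weights n i) (fst w) (snd w)}"

lemma range_weights: "range (weights n) = PiE (cell_indices n \<times> cell_indices n) (\<lambda>_. \<rat>)"
  unfolding weights_def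
proof (rule range_from_nat_into)
  show "PiE (cell_indices n \<times> cell_indices n) (\<lambda>_. \<rat>) \<noteq> {}" by (auto simp: PiE_eq_empty_iff)
  show "countable (PiE (cell_indices n \<times> cell_indices n) (\<lambda>_. \<rat>))"
    by (intro countable_PiE) (auto simp: countable_rat)
qed

lemma step_coupling_measurable [measurable]:
  assumes "A \<in> sets M" "C \<in> sets M"
  shows "(\<lambda>w. comp_coupling n f (fst w) (snd w) A C) \<in> borel_measurable (B \<Otimes>\<^sub>M B)"
proof -
  note [measurable] = assms cell_measurable[of test_set M, OF test_set_measurable]
  show ?thesis unfolding step_coupling_def by measurable
qed

lemma indep_mass_measurable [measurable]:
  assumes [measurable]: "m \<in> B \<Otimes>\<^sub>M K \<rightarrow>\<^sub>M prob_algebra M" "A \<in> sets M" "C \<in> sets M"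
  shows "(\<lambda>w. indep_mass m (fst w) (snd w) A C) \<in> borel_measurable (B \<Otimes>\<^sub>M B)"
proof -
  interpret K: prob_space K by (rule K_prob)
  show ?thesis unfolding indep_mass_def by measurable
qed

lemma near_joining_measurable:
  assumes m: "m \<in> B \<Otimes>\<^sub>M K \<rightarrow>\<^sub>M prob_algebra M"
  shows "Measurable.pred (B \<Otimes>\<^sub>M B) (\<lambda>w. near_joining m \<sigma> \<epsilon> i0 j0 n f (fst w) (snd w))"
proof -
  note [measurable] = m cell_measurable[of test_set M, OF test_set_measurable]
  have [measurable]: "Measurable.pred (B \<Otimes>\<^sub>M B) (\<lambda>w. subcoupling M test_set n f (c (fst w)) (c (snd w)))"
    unfolding subcoupling_def by measurable
  show ?thesis unfolding near_joining_def by measurable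
qed

lemma nontrivial_pairs_measurable:
  assumes "m \<in> B \<Otimes>\<^sub>M K \<rightarrow>\<^sub>M prob_algebra M"
  shows "nontrivial_pairs m \<sigma> \<epsilon> i0 j0 \<in> sets (B \<Otimes>\<^sub>M B)"
proof -
  note [measurable] = near_joining_measurable[OF assms]
  show ?thesis unfolding nontrivial_pairs_def by measurable
qed

lemma joining_imp_nontrivial_pair:
  assumes J: "joining_over G (c b1) T \<pi> (c b2) T \<pi> J" and b: "b1 \<in> space B" "b2 \<in> space B"
    and \<sigma>: "\<bar>\<sigma>\<bar> = 1" and \<epsilon>: "0 < \<epsilon>"
    and gap: "2 * \<epsilon> \<le> \<sigma> * (measure J (test_set i0 \<times> test_set j0) - indep_mass m b1 b2 (test_set i0) (test_set j0))"
  shows "(b1, b2) \<in> nontrivial_pairs m \<sigma> \<epsilon> i0 j0"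
proof -
  interpret J: prob_space J by (rule joining_overD(1)[OF J])
  have sJ: "sets J = sets (M \<Otimes>\<^sub>M M)"
    using joining_overD(2)[OF J] sets_pair_measure_cong[OF sets_c[OF b(1)] sets_c[OF b(2)]] by simp
  note spJ = space_coupling[OF sJ]
  have marg: "distr J M fst = c b1" "distr J M snd = c b2"
    using joining_overD(3,4)[OF J] distr_cong[OF refl sets_c[OF b(1)], of J fst fst] distr_cong[OF refl sets_c[OF b(2)], of J snd snd] by auto
  have "\<exists>i. near_joining m \<sigma> \<epsilon> i0 j0 n (weights n i) b1 b2" for n
  proof -
    let ?e = "inverse (real (Suc n))"
    \<comment> \<open>A test compares two approximated masses, so each may use half of 1/(n+1). The
      bound by \<open>\<epsilon>\<close> leaves a gap of \<open>\<epsilon>\<close> out of the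
      assumed \<open>2 * \<epsilon>\<close>.\<close>
    define \<delta> where "\<delta> = min \<epsilon> (?e / 2)"
    have \<delta>: "0 < \<delta>" "\<delta> \<le> \<epsilon>" "2 * \<delta> \<le> ?e" using \<epsilon> by (auto simp: \<delta>_def min_def)
    obtain f where f: "f \<in> PiE (cell_indices n \<times> cell_indices n) (\<lambda>_. \<rat>)"
      and sub: "subcoupling M test_set n f (c b1) (c b2)"
      and apx: "\<And>A C. resolved M test_set n A \<Longrightarrow> resolved M test_set n C \<Longrightarrow>
        \<bar>comp_coupling n f b1 b2 A C - measure J (A \<times> C)\<bar> \<le> \<delta>"
      using step_coupling_approx[of test_set M, OF test_set_measurable J.prob_space_axioms sJ marg \<delta>(1), of n] by blast
    note apxE = apx[OF resolved_member[OF _ test_set_measurable] resolved_member[OF _ test_set_measurable]]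
    have "near_joining m \<sigma> \<epsilon> i0 j0 n f b1 b2"
      unfolding near_joining_def
    proof (intro conjI allI impI)
      show "1 - ?e \<le> comp_coupling n f b1 b2 (space M) (space M)"
      proof -
        have "measure J (space M \<times> space M) = 1" using J.prob_space by (simp add: spJ)
        then show ?thesis using apx[OF resolved_space resolved_space] \<delta> by linarith
      qed
      show "\<bar>comp_coupling n f b1 b2 (test_set i) (test_set j) - comp_coupling n f b1 b2 (test_set k) (test_set l)\<bar> \<le> ?e"
        if "i < n" "j < n" "k < n" "l < n" "(i, j, k, l) \<in> tests" for i j k l
        using apxE[of i j] apxE[of k l] joining_tests[OF J sets_c[OF b(1)] sets_c[OF b(2)] that(5)] that \<delta> by linarith
      show "\<epsilon> \<le> \<sigma> * (comp_coupling n f b1 b2 (test_set i0) (test_set j0) - indep_mass m b1 b2 (test_set i0) (test_set j0))"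
        if "i0 < n" "j0 < n"
      proof -
        have "\<sigma> = 1 \<or> \<sigma> = -1" using \<sigma> by linarith
        then show ?thesis using apxE[OF that] gap \<delta> by (elim disjE) (simp; linarith)+
      qed
    qed (fact sub)
    moreover obtain i where "f = weights n i" using f unfolding range_weights[symmetric] by auto
    ultimately show ?thesis by blast
  qed
  then show ?thesis using b by (simp add: nontrivial_pairs_def space_pair_measure)
qed

end

lemma joining_over_bimeasure:
  assumes J: "joining_over G \<mu> T \<pi> \<nu> T' \<pi>' J"
  shows "bimeasure \<mu> \<nu> (\<lambda>A C. measure J (A \<times> C))"
proof -
  interpret J: prob_space J by (rule joining_overD(1)[OF J])
  have sJ [measurable_cong]: "sets J = sets (\<mu> \<Otimes>\<^sub>M \<nu>)" by (rule joining_overD(2)[OF J])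
  note spJ = space_coupling[OF sJ]
  have 1: "measure J (A \<times> space \<nu>) = measure \<mu> A" if "A \<in> sets \<mu>" for A
    using measure_distr_fst[OF sJ that] by (simp add: joining_overD(3)[OF J])
  have 2: "measure J (space \<mu> \<times> C) = measure \<nu> C" if "C \<in> sets \<nu>" for C
    using measure_distr_snd[OF sJ that] by (simp add: joining_overD(4)[OF J])
  show ?thesis
    unfolding bimeasure_def
  proof (intro conjI ballI impI)
    fix A C assume A: "A \<in> sets \<mu>" and C: "C \<in> sets \<nu>"
    note sub = sets.sets_into_space[OF A] sets.sets_into_space[OF C]
    show "measure J (A \<times> C) \<le> measure \<mu> A"
      unfolding 1[OF A, symmetric] using A sub by (intro J.finite_measure_mono) auto
    show "measure J (A \<times> C) \<le> measure \<nu> C"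
      unfolding 2[OF C, symmetric] using C sub by (intro J.finite_measure_mono) auto
    show "measure J ((A \<union> A') \<times> C) = measure J (A \<times> C) + measure J (A' \<times> C)"
      if "A' \<in> sets \<mu>" "A \<inter> A' = {}" for A'
      unfolding Sigma_Un_distrib1 using A C that by (intro J.finite_measure_Union) auto
    show "measure J (A \<times> (C \<union> C')) = measure J (A \<times> C) + measure J (A \<times> C')"
      if "C' \<in> sets \<nu>" "C \<inter> C' = {}" for C'
      unfolding Sigma_Un_distrib2 using A C that by (intro J.finite_measure_Union) auto
  next
    show "measure J (space \<mu> \<times> space \<nu>) = 1" using J.prob_space by (simp add: spJ)
  qed simp
qed

lemma standard_nonatomic_unit_interval: "standard_nonatomic (restrict_space lborel {0..1::real})"
proof -
  let ?I = "restrict_space lborel {0..1::real}"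
  have "the_inv_into (space ?I) (\<lambda>x. x) \<in> ?I \<rightarrow>\<^sub>M ?I \<longleftrightarrow> (\<lambda>x. x) \<in> ?I \<rightarrow>\<^sub>M ?I"
    by (rule measurable_cong, rule the_inv_into_f_eq) (auto simp: inj_on_def)
  then have "measurable_iso (\<lambda>x. x) ?I ?I"
    by (auto simp: measurable_iso_def bij_betw_def inj_on_def)
  then show ?thesis unfolding standard_nonatomic_def by (intro exI[of _ "\<lambda>x. x"]) (simp add: distr_id)
qed

section \<open>From disjointness to disjoint pairs of components\<close>

context decomposed_extension
begin

definition good_component :: "('b \<times> 'z \<Rightarrow> 'x measure) \<Rightarrow> 'b \<Rightarrow> bool" where
  "good_component m b \<longleftrightarrow>
     b \<in> space B \<and> disintegration K (c b) \<pi> (\<lambda>z. m (b, z)) \<and> factor_map G K R (c b) T \<pi>"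

text \<open>The assumption speaks of systems on the real line, while a component is a measure on the
  space of \<open>M\<close>. Being an extension of the atomless \<open>K\<close>, the component has
  no atoms, and so it has an ergodic model on the unit interval to which the assumption
  applies.\<close>

lemma unique_joining_with_component:
  assumes hyp: "\<And>(N :: real measure) S \<rho>. system_over G K R N S \<rho> \<Longrightarrow> ergodic_action G N S \<Longrightarrow>
      disjoint_over G K M T \<pi> N S \<rho>"
    and K_std: "standard_nonatomic K" and b: "b \<in> space B" and fb: "factor_map G K R (c b) T \<pi>"
    and J: "joining_over G M T \<pi> (c b) T \<pi> J1" "joining_over G M T \<pi> (c b) T \<pi> J2"
  shows "J1 = J2"
proof -
  let ?N = "restrict_space lborel {0..1::real}"
  note cb = c_pmp[OF b] and rc = real_retract_c[OF b]
  interpret cb: prob_space "c b" by (rule pmp_actionD(1)[OF cb])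
  note [measurable] = real_retractD(1)[OF rc]
  have \<pi>c [measurable]: "\<pi> \<in> c b \<rightarrow>\<^sub>M K" and d: "distr (c b) K \<pi> = K" using fb by (auto simp: factor_map_def)
  obtain q where q [measurable]: "q \<in> borel_measurable K"
    and q0: "\<And>r::real. measure K {z \<in> space K. q z = r} = 0"
    using standard_nonatomic_null_level_sets[OF K_std K_prob] by blast
  have atomless: "measure (c b) {x \<in> space (c b). \<phi> x = r} = 0" for r
  proof (cases "{x \<in> space (c b). \<phi> x = r} = {}")
    case False
    then obtain x0 where x0: "x0 \<in> space (c b)" "\<phi> x0 = r" by auto
    \<comment> \<open>A level set of \<open>\<phi>\<close> contains at most one point, and that
      point lies above a null level set of \<open>q\<close>.\<close>
    let ?Z = "{z \<in> space K. q z = q (\<pi> x0)}"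
    have "x = x0" if "x \<in> space (c b)" "\<phi> x = r" for x
      using that x0 real_retractD(3)[OF rc] by metis
    then have "{x \<in> space (c b). \<phi> x = r} \<subseteq> \<pi> -` ?Z \<inter> space (c b)"
      using measurable_space[OF \<pi>c] by auto
    then have "measure (c b) {x \<in> space (c b). \<phi> x = r} \<le> measure (c b) (\<pi> -` ?Z \<inter> space (c b))"
      by (rule cb.finite_measure_mono) measurable
    also have "\<dots> = measure (distr (c b) K \<pi>) ?Z" by (rule measure_distr[symmetric]) measurable
    also have "\<dots> = 0" unfolding d by (rule q0)
    finally show ?thesis by (simp add: measure_le_0_iff)
  qed (metis measure_empty)
  obtain \<theta> h where \<theta>: "\<theta> \<in> c b \<rightarrow>\<^sub>M ?N" and h [measurable]: "h \<in> ?N \<rightarrow>\<^sub>M c b" and d\<theta>: "distr (c b) ?N \<theta> = ?N"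
    and h\<theta>: "AE x in c b. h (\<theta> x) = x"
    using unit_interval_model[OF cb.prob_space_axioms rc atomless] by blast
  obtain \<phi>N \<psi>N where rN: "real_retract ?N \<phi>N \<psi>N"
    using standard_nonatomic_imp_real_retract[OF standard_nonatomic_unit_interval] by blast
  obtain S where S: "pmp_action G ?N S" and ergS: "ergodic_action G ?N S"
    and fS: "factor_map G K R ?N S (\<lambda>t. \<pi> (h t))"
    and eqv: "\<And>g. g \<in> carrier G \<Longrightarrow> AE x in c b. \<theta> (T g x) = S g (\<theta> x)"
    using transport_action[OF G cb c_ergodic[OF b] rc rN fb \<theta> h d\<theta> h\<theta>] by blast
  have "disjoint_over G K M T \<pi> ?N S (\<lambda>t. \<pi> (h t))"
    by (rule hyp[OF _ ergS]) (use S fS standard_nonatomic_unit_interval in \<open>simp add: system_over_def system_def\<close>)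
  moreover have "AE x in c b. \<pi> (h (\<theta> x)) = \<pi> x" using h\<theta> by eventually_elim simp
  ultimately show ?thesis
    by (intro joinings_eq_if_disjoint_model[OF _ J rK \<pi>_measurable _ pmp_actionD(2)[OF M] pmp_actionD(2)[OF cb]
        pmp_actionD(2)[OF S] \<theta> d\<theta> eqv _ h h\<theta>]) measurable
qed

lemma component_joining:
  assumes b: "good_component m b1" "good_component m b2"
  defines "J \<equiv> relatively_independent_joining K (\<lambda>z. m (b1, z)) (\<lambda>z. m (b2, z))"
  shows "joining_over G (c b1) T \<pi> (c b2) T \<pi> J"
    and "\<And>A C. A \<in> sets M \<Longrightarrow> C \<in> sets M \<Longrightarrow> measure J (A \<times> C) = indep_mass m b1 b2 A C"
proof -
  have s: "b1 \<in> space B" "b2 \<in> space B" and d: "disintegration K (c b1) \<pi> (\<lambda>z. m (b1, z))" "disintegration K (c b2) \<pi> (\<lambda>z. m (b2, z))"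
    and f: "factor_map G K R (c b1) T \<pi>" "factor_map G K R (c b2) T \<pi>"
    using b by (auto simp: good_component_def)
  show "joining_over G (c b1) T \<pi> (c b2) T \<pi> J"
    unfolding J_def
    by (rule joining_rij_disintegration[OF G(1) K c_pmp[OF s(1)] c_pmp[OF s(2)] f rK real_retract_c[OF s(1)] real_retract_c[OF s(2)] d])
  show "measure J (A \<times> C) = indep_mass m b1 b2 A C" if "A \<in> sets M" "C \<in> sets M" for A C
    unfolding J_def indep_mass_def
  proof (rule measure_rij[OF K_prob])
    show "(\<lambda>z. m (b1, z)) \<in> K \<rightarrow>\<^sub>M prob_algebra (c b1)" "(\<lambda>z. m (b2, z)) \<in> K \<rightarrow>\<^sub>M prob_algebra (c b2)"
      using d unfolding disintegration_def by blast+
  qed (use that s sets_c in auto)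
qed

text \<open>If the sections of the nontrivial pairs were not null, then choosing near joinings measurably in the
  first component, averaging over it, and passing to a limit would yield a joining of the whole system
  with \<open>c b'\<close> that is not relatively independent.\<close>

lemma null_section_nontrivial_pairs:
  assumes hyp: "\<And>(N :: real measure) S \<rho>. system_over G K R N S \<rho> \<Longrightarrow> ergodic_action G N S \<Longrightarrow>
      disjoint_over G K M T \<pi> N S \<rho>"
    and K_std: "standard_nonatomic K"
    and m: "conditional_law (B \<Otimes>\<^sub>M K) M M (\<lambda>x. (p x, \<pi> x)) (\<lambda>x. x) m"
    and good: "AE b in B. good_component m b" and b': "good_component m b'"
    and \<sigma>: "\<bar>\<sigma>\<bar> = 1" and \<epsilon>: "0 < \<epsilon>"
  shows "emeasure B ((\<lambda>b. (b, b')) -` nontrivial_pairs m \<sigma> \<epsilon> i0 j0) = 0"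
proof (rule ccontr)
  interpret K: prob_space K by (rule K_prob)
  interpret B: prob_space B by (rule B_prob)
  interpret BK: pair_prob_space B K ..
  have b's: "b' \<in> space B" and b'd: "disintegration K (c b') \<pi> (\<lambda>z. m (b', z))" and b'f: "factor_map G K R (c b') T \<pi>"
    using b' by (auto simp: good_component_def)
  interpret cb': prob_space "c b'" by (rule pmp_actionD(1)[OF c_pmp[OF b's]])
  have mk [measurable]: "m \<in> B \<Otimes>\<^sub>M K \<rightarrow>\<^sub>M prob_algebra M" using m by (simp add: conditional_law_def)
  have sec [measurable]: "(\<lambda>b. (b, b')) \<in> B \<rightarrow>\<^sub>M B \<Otimes>\<^sub>M B" using b's by measurable
  define W where "W = (\<lambda>b. (b, b')) -` nontrivial_pairs m \<sigma> \<epsilon> i0 j0"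
  have Wm [measurable]: "W \<in> sets B"
    unfolding W_def by (rule sets_Pair2[OF nontrivial_pairs_measurable[OF mk]])
  assume "emeasure B ((\<lambda>b. (b, b')) -` nontrivial_pairs m \<sigma> \<epsilon> i0 j0) \<noteq> 0"
  then have W0: "0 < measure B W"
    unfolding W_def[symmetric] by (simp add: B.emeasure_eq_measure zero_less_measure_iff)
  have nj_m: "Measurable.pred B (\<lambda>b. near_joining m \<sigma> \<epsilon> i0 j0 n f b b')" for n f
    using measurable_compose[OF sec near_joining_measurable[OF mk, of \<sigma> \<epsilon> i0 j0 n f]] by simp
  \<comment> \<open>Membership in \<open>W\<close> guarantees that some index works; the least one
    depends measurably on \<open>b\<close>.\<close>
  define \<iota> where "\<iota> n b = (LEAST i. near_joining m \<sigma> \<epsilon> i0 j0 n (weights n i) b b')" for n b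
  have \<iota>_m: "\<iota> n \<in> B \<rightarrow>\<^sub>M count_space UNIV" for n
    unfolding \<iota>_def by (rule measurable_Least) (rule nj_m)
  have nj: "near_joining m \<sigma> \<epsilon> i0 j0 n (weights n (\<iota> n b)) b b'" if "b \<in> W" for n b
    unfolding \<iota>_def by (rule LeastI_ex) (use that in \<open>auto simp: W_def nontrivial_pairs_def\<close>)
  \<comment> \<open>Off \<open>W\<close> the relatively independent mass is inserted: it passes all
    tests exactly, has the right marginals and contributes nothing to the gap.\<close>
  define \<beta> where "\<beta> n b A C = (if b \<in> W then comp_coupling n (weights n (\<iota> n b)) b b' A C else indep_mass m b b' A C)" for n b A C
  have \<beta>_m [measurable]: "(\<lambda>b. \<beta> n b A C) \<in> borel_measurable B" if [measurable]: "A \<in> sets M" "C \<in> sets M" for n A C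
  proof -
    have "(\<lambda>b. comp_coupling n (weights n i) b b' A C) \<in> borel_measurable B" for i
      using measurable_compose[OF sec step_coupling_measurable[OF that, of n "weights n i"]] by simp
    then have [measurable]: "(\<lambda>b. comp_coupling n (weights n (\<iota> n b)) b b' A C) \<in> borel_measurable B"
      by (rule measurable_compose_countable[OF _ \<iota>_m])
    have [measurable]: "(\<lambda>b. indep_mass m b b' A C) \<in> borel_measurable B"
      using measurable_compose[OF sec indep_mass_measurable[OF mk that]] by simp
    show ?thesis unfolding \<beta>_def by measurable
  qed
  have im_m [measurable]: "(\<lambda>b. indep_mass m b b' A C) \<in> borel_measurable B" if "A \<in> sets M" "C \<in> sets M" for A C
    using measurable_compose[OF sec indep_mass_measurable[OF mk that]] by simp
  let ?e = "\<lambda>n. inverse (real (Suc n))"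
  have props: "0 \<le> \<beta> n b A C \<and> \<beta> n b A C \<le> measure (c b) A \<and> \<beta> n b A C \<le> measure (c b') C \<and>
      (\<forall>A'\<in>sets M. A \<inter> A' = {} \<longrightarrow> \<beta> n b (A \<union> A') C = \<beta> n b A C + \<beta> n b A' C) \<and>
      (\<forall>C'\<in>sets M. C \<inter> C' = {} \<longrightarrow> \<beta> n b A (C \<union> C') = \<beta> n b A C + \<beta> n b A C')"
    if b: "good_component m b" and A: "A \<in> sets M" and C: "C \<in> sets M" for n b A C
  proof (cases "b \<in> W")
    case True
    have bs: "b \<in> space B" using b by (simp add: good_component_def)
    interpret cb: prob_space "c b" by (rule pmp_actionD(1)[OF c_pmp[OF bs]])
    have sub: "subcoupling M test_set n (weights n (\<iota> n b)) (c b) (c b')"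
      using nj[OF True] by (simp add: near_joining_def)
    note fin = cb.finite_measure_axioms sets_c[OF bs] cb'.finite_measure_axioms sets_c[OF b's]
    note E = test_set_measurable
    show ?thesis
      using True A C step_coupling_bounds[of test_set M, OF E fin sub A C] step_coupling_le_snd[of test_set M, OF E fin sub A C]
        step_coupling_add[of test_set M, OF E fin(1,2) A] step_coupling_add_snd[of test_set M, OF E fin(3,4) C]
      by (simp add: \<beta>_def)
  next
    case False
    have bs: "b \<in> space B" using b by (simp add: good_component_def)
    note J = joining_over_bimeasure[OF component_joining(1)[OF b b']]
    note im = component_joining(2)[OF b b', symmetric]
    have A': "A \<in> sets (c b)" and C': "C \<in> sets (c b')" using A C sets_c[OF bs] sets_c[OF b's] by auto
    show ?thesis
      using False A C bimeasureD[OF J A' C'] sets_c[OF bs] sets_c[OF b's] by (simp add: \<beta>_def im)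
  qed
  have indep01: "0 \<le> indep_mass m b b' A C" "indep_mass m b b' A C \<le> 1"
    if b: "good_component m b" and A: "A \<in> sets M" and C: "C \<in> sets M" for b A C
  proof -
    interpret J: prob_space "relatively_independent_joining K (\<lambda>z. m (b, z)) (\<lambda>z. m (b', z))"
      by (rule joining_overD(1)[OF component_joining(1)[OF b b']])
    show "0 \<le> indep_mass m b b' A C" "indep_mass m b b' A C \<le> 1"
      using component_joining(2)[OF b b' A C] J.prob_le_1 measure_nonneg by metis+
  qed
  have \<beta>1: "\<beta> n b A C \<le> 1" if "good_component m b" "A \<in> sets M" "C \<in> sets M" for n b A C
    using props[OF that, of n] prob_space.prob_le_1[OF pmp_actionD(1)[OF c_pmp]] that(1)
    by (meson good_component_def order_trans)
  have \<beta>_int: "integrable B (\<lambda>b. \<beta> n b A C)" if AC: "A \<in> sets M" "C \<in> sets M" for n A C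
  proof (rule B.integrable_const_bound[where B=1])
    show "AE b in B. norm (\<beta> n b A C) \<le> 1"
      using good by eventually_elim (use props[OF _ AC] \<beta>1[OF _ AC] in simp)
  qed (rule \<beta>_m[OF AC])
  have im_int: "integrable B (\<lambda>b. indep_mass m b b' A C)" if AC: "A \<in> sets M" "C \<in> sets M" for A C
  proof (rule B.integrable_const_bound[where B=1])
    show "AE b in B. norm (indep_mass m b b' A C) \<le> 1"
      using good by eventually_elim (use indep01[OF _ AC] in simp)
  qed (rule im_m[OF AC])
  define \<alpha> where "\<alpha> n A C = (\<integral>b. \<beta> n b A C \<partial>B)" for n A C
  have \<alpha>0: "0 \<le> \<alpha> n A C" if AC: "A \<in> sets M" "C \<in> sets M" for n A C
    unfolding \<alpha>_def
  proof (rule integral_nonneg_AE)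
    show "AE b in B. 0 \<le> \<beta> n b A C" using good by eventually_elim (use props[OF _ AC] in blast)
  qed
  have \<alpha>M: "\<alpha> n A C \<le> measure M A" if AC: "A \<in> sets M" "C \<in> sets M" for n A C
  proof -
    have "\<alpha> n A C \<le> (\<integral>b. measure (c b) A \<partial>B)"
      unfolding \<alpha>_def
    proof (rule integral_mono_AE[OF \<beta>_int[OF AC] integrable_kernel(1)[OF B.finite_measure_axioms c_kernel sets.top AC(1)]])
      show "AE b in B. \<beta> n b A C \<le> measure (c b) A" using good by eventually_elim (use props[OF _ AC] in blast)
    qed
    also have "\<dots> = measure (B \<bind> c) A" by (rule measure_bind_kernel[OF B_prob c_kernel AC(1), symmetric])
    also have "B \<bind> c = M" using c_disintegration by (simp add: disintegration_def)
    finally show ?thesis .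
  qed
  have \<alpha>N: "\<alpha> n A C \<le> measure (c b') C" if AC: "A \<in> sets M" "C \<in> sets M" for n A C
  proof -
    have "\<alpha> n A C \<le> (\<integral>b. measure (c b') C \<partial>B)"
      unfolding \<alpha>_def
    proof (rule integral_mono_AE[OF \<beta>_int[OF AC]])
      show "AE b in B. \<beta> n b A C \<le> measure (c b') C" using good by eventually_elim (use props[OF _ AC] in blast)
    qed simp
    then show ?thesis by (simp add: B.prob_space)
  qed
  have \<alpha>_add1: "\<alpha> n (A \<union> A') C = \<alpha> n A C + \<alpha> n A' C"
    if AC: "A \<in> sets M" "C \<in> sets M" and A': "A' \<in> sets M" "A \<inter> A' = {}" for n A A' C
  proof -
    have "\<alpha> n (A \<union> A') C = (\<integral>b. \<beta> n b A C + \<beta> n b A' C \<partial>B)"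
      unfolding \<alpha>_def
    proof (rule integral_cong_AE)
      show "AE b in B. \<beta> n b (A \<union> A') C = \<beta> n b A C + \<beta> n b A' C"
        using good by eventually_elim (use props[OF _ AC] A' in blast)
    qed (use AC A' in measurable)
    then show ?thesis unfolding \<alpha>_def using \<beta>_int AC A' by simp
  qed
  have \<alpha>_add2: "\<alpha> n A (C \<union> C') = \<alpha> n A C + \<alpha> n A C'"
    if AC: "A \<in> sets M" "C \<in> sets M" and C': "C' \<in> sets M" "C \<inter> C' = {}" for n A C C'
  proof -
    have "\<alpha> n A (C \<union> C') = (\<integral>b. \<beta> n b A C + \<beta> n b A C' \<partial>B)"
      unfolding \<alpha>_def
    proof (rule integral_cong_AE)
      show "AE b in B. \<beta> n b A (C \<union> C') = \<beta> n b A C + \<beta> n b A C'"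
        using good by eventually_elim (use props[OF _ AC] C' in blast)
    qed (use AC C' in measurable)
    then show ?thesis unfolding \<alpha>_def using \<beta>_int AC C' by simp
  qed
  have \<alpha>_mass: "1 - ?e n \<le> \<alpha> n (space M) (space M)" for n
  proof -
    have "(\<integral>b. 1 - ?e n \<partial>B) \<le> \<alpha> n (space M) (space M)"
      unfolding \<alpha>_def
    proof (rule integral_mono_AE[OF _ \<beta>_int])
      show "AE b in B. 1 - ?e n \<le> \<beta> n b (space M) (space M)"
        using good
      proof eventually_elim
        case (elim b)
        show ?case
        proof (cases "b \<in> W")
          case True
          then show ?thesis using nj[OF True, of n] by (simp add: near_joining_def \<beta>_def)
        next
          case False
          have "b \<in> space B" using elim by (simp add: good_component_def)
          then have "space (c b) = space M" "space (c b') = space M"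
            using prob_kernelD(3)[OF c_kernel] b's by auto
          then have "indep_mass m b b' (space M) (space M) = 1"
            using joining_over_bimeasure[OF component_joining(1)[OF elim b']] component_joining(2)[OF elim b', of "space M" "space M"]
            by (simp add: bimeasure_def)
          then show ?thesis using False by (simp add: \<beta>_def)
        qed
      qed
    qed simp_all
    then show ?thesis by (simp add: B.prob_space)
  qed
  have \<alpha>_tests: "\<bar>\<alpha> n (test_set i) (test_set j) - \<alpha> n (test_set k) (test_set l)\<bar> \<le> ?e n"
    if t: "(i, j, k, l) \<in> tests" and n: "i < n" "j < n" "k < n" "l < n" for n i j k l
  proof -
    have eq: "\<alpha> n (test_set i) (test_set j) - \<alpha> n (test_set k) (test_set l) =
        (\<integral>b. \<beta> n b (test_set i) (test_set j) - \<beta> n b (test_set k) (test_set l) \<partial>B)"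
      unfolding \<alpha>_def using \<beta>_int by simp
    have "\<bar>\<alpha> n (test_set i) (test_set j) - \<alpha> n (test_set k) (test_set l)\<bar> \<le>
        (\<integral>b. \<bar>\<beta> n b (test_set i) (test_set j) - \<beta> n b (test_set k) (test_set l)\<bar> \<partial>B)"
      unfolding eq by (rule integral_abs_bound)
    also have "\<dots> \<le> (\<integral>b. ?e n \<partial>B)"
    proof (rule integral_mono_AE)
      show "AE b in B. \<bar>\<beta> n b (test_set i) (test_set j) - \<beta> n b (test_set k) (test_set l)\<bar> \<le> ?e n"
        using good
      proof eventually_elim
        case (elim b)
        have bs: "b \<in> space B" using elim by (simp add: good_component_def)
        show ?case
        proof (cases "b \<in> W")
          case True
          let ?f = "weights n (\<iota> n b)"
          have "\<bar>comp_coupling n ?f b b' (test_set i) (test_set j) - comp_coupling n ?f b b' (test_set k) (test_set l)\<bar> \<le> ?e n"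
            using nj[OF True, of n] t n unfolding near_joining_def by blast
          then show ?thesis unfolding \<beta>_def using True by presburger
        next
          case False
          have "indep_mass m b b' (test_set i) (test_set j) = indep_mass m b b' (test_set k) (test_set l)"
            using joining_tests[OF component_joining(1)[OF elim b'] sets_c[OF bs] sets_c[OF b's] t]
            by (simp add: component_joining(2)[OF elim b'])
          then show ?thesis using False by (simp add: \<beta>_def)
        qed
      qed
    qed (use \<beta>_int in simp_all)
    finally show ?thesis by (simp add: B.prob_space)
  qed
  \<comment> \<open>The value that the relatively independent joining of the whole system with
    \<open>c b'\<close> gives to the chosen rectangle, as computed at the end by Fubini.\<close>
  define I where "I = (\<integral>b. indep_mass m b b' (test_set i0) (test_set j0) \<partial>B)"
  have \<alpha>_gap: "\<epsilon> * measure B W \<le> \<sigma> * (\<alpha> n (test_set i0) (test_set j0) - I)" if n: "i0 < n" "j0 < n" for n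
  proof -
    have W_int: "integrable B (indicat_real W)"
      by (rule integrable_real_indicator[OF Wm]) (simp add: B.emeasure_eq_measure)
    have "\<epsilon> * measure B W = (\<integral>b. \<epsilon> * indicator W b \<partial>B)" by simp
    also have "\<dots> \<le> (\<integral>b. \<sigma> * (\<beta> n b (test_set i0) (test_set j0) - indep_mass m b b' (test_set i0) (test_set j0)) \<partial>B)"
    \<comment> \<open>On \<open>W\<close> the integrand is at least \<open>\<epsilon>\<close> and
      off \<open>W\<close> it is 0. Because \<open>\<sigma>\<close> does not depend on
      \<open>b\<close>, the gaps add up.\<close>
    proof (rule integral_mono)
      fix b
      show "\<epsilon> * indicator W b \<le> \<sigma> * (\<beta> n b (test_set i0) (test_set j0) - indep_mass m b b' (test_set i0) (test_set j0))"
        using nj[of b n] n by (cases "b \<in> W") (simp_all add: near_joining_def \<beta>_def)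
    qed (use \<beta>_int im_int W_int in simp_all)
    also have "\<dots> = \<sigma> * (\<alpha> n (test_set i0) (test_set j0) - I)"
      unfolding \<alpha>_def I_def using \<beta>_int im_int by simp
    finally show ?thesis .
  qed
  \<comment> \<open>The compactness lemma asks for bounds at every index, so the values are set to 0
    on pairs that are not both measurable.\<close>
  define \<alpha>' where "\<alpha>' n w = (if fst w \<in> sets M \<and> snd w \<in> sets M then \<alpha> n (fst w) (snd w) else 0)" for n w
  have "0 \<le> \<alpha>' n w" "\<alpha>' n w \<le> 1" for n w
    using \<alpha>0[of "fst w" "snd w" n] \<alpha>M[of "fst w" "snd w" n] prob_space.prob_le_1[OF M_prob, of "fst w"]
    by (auto simp: \<alpha>'_def)
  then obtain H where H: "H \<noteq> bot" "H \<le> sequentially" and "\<And>w. \<exists>l. ((\<lambda>n. \<alpha>' n w) \<longlongrightarrow> l) H"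
    using exists_limit_filter[of \<alpha>'] by blast
  then obtain a' where a': "\<And>w. ((\<lambda>n. \<alpha>' n w) \<longlongrightarrow> a' w) H" by metis
  define a where "a A C = a' (A, C)" for A C
  have lim: "((\<lambda>n. \<alpha> n A C) \<longlongrightarrow> a A C) H" if "A \<in> sets M" "C \<in> sets M" for A C
    using a'[of "(A, C)"] that by (simp add: \<alpha>'_def a_def)
  have e0: "(?e \<longlongrightarrow> 0) H" using LIMSEQ_inverse_real_of_nat tendsto_mono[OF H(2)] by blast
  have evH: "eventually (\<lambda>n. k < n) H" for k :: nat
    using filter_leD[OF H(2) eventually_gt_at_top[of k]] .
  note scb' = sets_c[OF b's] and spcb' = prob_kernelD(3)[OF c_kernel b's]
  have "bimeasure M (c b') a"
    unfolding bimeasure_def scb'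
  proof (intro conjI ballI impI)
    fix A C assume AC: "A \<in> sets M" "C \<in> sets M"
    show "0 \<le> a A C" by (rule tendsto_lowerbound[OF lim[OF AC] _ H(1)]) (simp add: \<alpha>0[OF AC])
    show "a A C \<le> measure M A" by (rule tendsto_upperbound[OF lim[OF AC] _ H(1)]) (simp add: \<alpha>M[OF AC])
    show "a A C \<le> measure (c b') C" by (rule tendsto_upperbound[OF lim[OF AC] _ H(1)]) (simp add: \<alpha>N[OF AC])
    show "a (A \<union> A') C = a A C + a A' C" if A': "A' \<in> sets M" "A \<inter> A' = {}" for A'
    proof (rule tendsto_unique[OF H(1) lim])
      show "((\<lambda>n. \<alpha> n (A \<union> A') C) \<longlongrightarrow> a A C + a A' C) H"
        unfolding \<alpha>_add1[OF AC A'] by (intro tendsto_add lim AC A')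
    qed (use AC A' in auto)
    show "a A (C \<union> C') = a A C + a A C'" if C': "C' \<in> sets M" "C \<inter> C' = {}" for C'
    proof (rule tendsto_unique[OF H(1) lim])
      show "((\<lambda>n. \<alpha> n A (C \<union> C')) \<longlongrightarrow> a A C + a A C') H"
        unfolding \<alpha>_add2[OF AC C'] by (intro tendsto_add lim AC C')
    qed (use AC C' in auto)
  next
    \<comment> \<open>The mass lost by rounding is at most 1/(n+1), so the limit has full mass. This
      makes its marginals exact.\<close>
    have "1 - 0 \<le> a (space M) (space M)"
      by (rule tendsto_le[OF H(1) lim tendsto_diff[OF tendsto_const e0]]) (use \<alpha>_mass in \<open>simp_all add: always_eventually\<close>)
    moreover have "a (space M) (space M) \<le> 1"
    proof (rule tendsto_upperbound[OF lim _ H(1)])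
      show "\<forall>\<^sub>F n in H. \<alpha> n (space M) (space M) \<le> 1"
        using \<alpha>M[of "space M" "space M"] prob_space.prob_space[OF M_prob] by simp
    qed simp_all
    ultimately show "a (space M) (space (c b')) = 1" by (simp add: spcb')
  qed
  note a = this
  obtain J where J: "prob_space J" "sets J = sets (M \<Otimes>\<^sub>M c b')"
    and Ja: "\<And>A C. A \<in> sets M \<Longrightarrow> C \<in> sets M \<Longrightarrow> measure J (A \<times> C) = a A C"
    using bimeasure_imp_measure[OF real_retract_c[OF b's] M_prob cb'.prob_space_axioms a] scb' by auto
  interpret J: prob_space J by (rule J(1))
  note [measurable_cong] = J(2)
  note marg = bimeasure_marginals[OF a M_prob cb'.prob_space_axioms]
  have dfst: "distr J M fst = M"
    by (rule distr_fst_eqI[OF J(2,1) M_prob]) (use marg(1) in \<open>simp add: Ja spcb'\<close>)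
  have dsnd: "distr J (c b') snd = c b'"
    by (rule distr_snd_eqI[OF J(2,1) cb'.prob_space_axioms]) (use marg(2) in \<open>simp add: Ja scb'\<close>)
  have "joining_over G M T \<pi> (c b') T \<pi> J"
  proof (rule joining_if_tests[OF J dfst dsnd refl scb'])
    fix i j k l assume t: "(i, j, k, l) \<in> tests"
    have "((\<lambda>n. \<alpha> n (test_set i) (test_set j) - \<alpha> n (test_set k) (test_set l)) \<longlongrightarrow> 0) H"
    proof (rule Lim_null_comparison[OF _ e0])
      show "\<forall>\<^sub>F n in H. norm (\<alpha> n (test_set i) (test_set j) - \<alpha> n (test_set k) (test_set l)) \<le> ?e n"
        using evH[of i] evH[of j] evH[of k] evH[of l] by eventually_elim (use \<alpha>_tests[OF t] in simp)
    qed
    moreover have "((\<lambda>n. \<alpha> n (test_set i) (test_set j) - \<alpha> n (test_set k) (test_set l)) \<longlongrightarrow>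
        a (test_set i) (test_set j) - a (test_set k) (test_set l)) H"
      by (intro tendsto_diff lim test_set_measurable)
    ultimately have "a (test_set i) (test_set j) - a (test_set k) (test_set l) = 0"
      using tendsto_unique[OF H(1)] by blast
    then show "measure J (test_set i \<times> test_set j) = measure J (test_set k \<times> test_set l)"
      by (simp add: Ja)
  qed
  moreover define mm where "mm z = B \<bind> (\<lambda>b. m (b, z))" for z
  have mm_law: "conditional_law K M M \<pi> (\<lambda>x. x) mm"
    unfolding mm_def[abs_def] by (rule conditional_law_marginal[OF B_prob K_prob M_prob _ _ _ m]) auto
  then have mm: "disintegration K M \<pi> mm"
    using disintegration_iff_conditional_law[OF rK M_prob \<pi>_measurable \<pi>_distr] by simp
  have mm_k: "mm \<in> K \<rightarrow>\<^sub>M prob_algebra M" using mm_law by (simp add: conditional_law_def)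
  have n_k: "(\<lambda>z. m (b', z)) \<in> K \<rightarrow>\<^sub>M prob_algebra M" using b's by measurable
  moreover have "joining_over G M T \<pi> (c b') T \<pi> (relatively_independent_joining K mm (\<lambda>z. m (b', z)))"
    by (rule joining_rij_disintegration[OF G(1) K M c_pmp[OF b's] f\<pi> b'f rK rM real_retract_c[OF b's] mm b'd])
  ultimately have Jeq: "J = relatively_independent_joining K mm (\<lambda>z. m (b', z))"
    using unique_joining_with_component[OF hyp K_std b's b'f] by blast
  let ?A = "test_set i0" and ?C = "test_set j0"
  have "measure J (?A \<times> ?C) = (\<integral>z. measure (mm z) ?A * measure (m (b', z)) ?C \<partial>K)"
    unfolding Jeq by (rule measure_rij[OF K_prob mm_k n_k]) measurable
  also have "\<dots> = (\<integral>z. \<integral>b. measure (m (b, z)) ?A * measure (m (b', z)) ?C \<partial>B \<partial>K)"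
  proof (intro Bochner_Integration.integral_cong refl)
    fix z assume "z \<in> space K"
    then have mz: "(\<lambda>b. m (b, z)) \<in> B \<rightarrow>\<^sub>M prob_algebra M" by measurable
    have "measure (mm z) ?A = (\<integral>b. measure (m (b, z)) ?A \<partial>B)"
      unfolding mm_def by (rule measure_bind_kernel[OF B_prob mz test_set_measurable])
    then show "measure (mm z) ?A * measure (m (b', z)) ?C = (\<integral>b. measure (m (b, z)) ?A * measure (m (b', z)) ?C \<partial>B)"
      by (simp only: Bochner_Integration.integral_mult_left_zero)
  qed
  also have "\<dots> = (\<integral>b. \<integral>z. measure (m (b, z)) ?A * measure (m (b', z)) ?C \<partial>K \<partial>B)"
  proof (rule BK.Fubini_integral)
    have "measure (m w) A \<le> 1" if "w \<in> space (B \<Otimes>\<^sub>M K)" for w A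
      by (rule prob_space.prob_le_1[OF prob_kernelD(1)[OF mk that]])
    then show "integrable (B \<Otimes>\<^sub>M K) (\<lambda>(b, z). measure (m (b, z)) ?A * measure (m (b', z)) ?C)"
      using b's n_k by (intro BK.integrable_const_bound[where B=1])
        (auto simp: space_pair_measure abs_mult case_prod_beta' intro!: AE_I2 mult_le_one)
  qed
  also have "\<dots> = I" by (simp add: I_def indep_mass_def)
  finally have aI: "a ?A ?C = I" by (simp add: Ja)
  \<comment> \<open>The gap on the rectangle survives the limit, whereas uniqueness of the joining
    has just forced it to be 0.\<close>
  have "\<epsilon> * measure B W \<le> \<sigma> * (a ?A ?C - I)"
  proof (rule tendsto_lowerbound[OF _ _ H(1)])
    show "((\<lambda>n. \<sigma> * (\<alpha> n ?A ?C - I)) \<longlongrightarrow> \<sigma> * (a ?A ?C - I)) H"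
      by (intro tendsto_intros lim test_set_measurable)
    show "\<forall>\<^sub>F n in H. \<epsilon> * measure B W \<le> \<sigma> * (\<alpha> n ?A ?C - I)"
      using evH[of i0] evH[of j0] by eventually_elim (rule \<alpha>_gap)
  qed
  then show False using aI W0 \<epsilon> by (simp add: mult_le_0_iff)
qed

text \<open>The non-disjoint pairs are covered by countably many sets: the pairs with a bad
  component, and the measurable sets \<open>nontrivial_pairs\<close> for each sign, each gap 1/(k+1)
  and each test rectangle. The latter are null because almost all their sections are.\<close>

lemma AE_disjoint_pairs_if_disjoint:
  assumes hyp: "\<And>(N :: real measure) S \<rho>. system_over G K R N S \<rho> \<Longrightarrow> ergodic_action G N S \<Longrightarrow>
      disjoint_over G K M T \<pi> N S \<rho>"
    and K_std: "standard_nonatomic K"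
  shows "AE w in B \<Otimes>\<^sub>M B. w \<in> disjoint_component_pairs G K T \<pi> B c"
proof -
  interpret B: prob_space B by (rule B_prob)
  interpret BB: pair_prob_space B B ..
  obtain m where m: "conditional_law (B \<Otimes>\<^sub>M K) M M (\<lambda>x. (p x, \<pi> x)) (\<lambda>x. x) m"
    and m_dis: "AE b in B. disintegration K (c b) \<pi> (\<lambda>z. m (b, z))"
    using joint_disintegration by blast
  have mk: "m \<in> B \<Otimes>\<^sub>M K \<rightarrow>\<^sub>M prob_algebra M" using m by (simp add: conditional_law_def)
  have good: "AE b in B. good_component m b"
    using m_dis AE_factor_map_c AE_space by eventually_elim (simp add: good_component_def)
  have null: "AE w in B \<Otimes>\<^sub>M B. w \<notin> nontrivial_pairs m \<sigma> \<epsilon> i j" if "\<bar>\<sigma>\<bar> = 1" "0 < \<epsilon>" for \<sigma> \<epsilon> i j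
  proof (rule AE_not_in)
    let ?W = "nontrivial_pairs m \<sigma> \<epsilon> i j"
    have "emeasure (B \<Otimes>\<^sub>M B) ?W = (\<integral>\<^sup>+b'. emeasure B ((\<lambda>b. (b, b')) -` ?W) \<partial>B)"
      by (rule BB.emeasure_pair_measure_alt2[OF nontrivial_pairs_measurable[OF mk]])
    also have "\<dots> = (\<integral>\<^sup>+b'. 0 \<partial>B)"
    proof (rule nn_integral_cong_AE)
      show "AE b' in B. emeasure B ((\<lambda>b. (b, b')) -` ?W) = 0"
        using good by eventually_elim (rule null_section_nontrivial_pairs[OF hyp K_std m good _ that])
    qed
    finally show "?W \<in> null_sets (B \<Otimes>\<^sub>M B)"
      using nontrivial_pairs_measurable[OF mk] by (simp add: null_sets_def)
  qed
  have "AE w in B \<Otimes>\<^sub>M B. \<forall>\<sigma>\<in>{1, -1}. \<forall>k i j. w \<notin> nontrivial_pairs m \<sigma> (inverse (real (Suc k))) i j"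
    by (simp add: AE_all_countable AE_ball_countable null)
  then show ?thesis
    using AE_pair_both[OF B_prob good]
  proof eventually_elim
    case (elim w)
    obtain b1 b2 where w: "w = (b1, b2)" by (cases w)
    have g: "good_component m b1" "good_component m b2" using elim(2) w by auto
    have s: "b1 \<in> space B" "b2 \<in> space B" and d: "disintegration K (c b1) \<pi> (\<lambda>z. m (b1, z))" "disintegration K (c b2) \<pi> (\<lambda>z. m (b2, z))"
      using g by (auto simp: good_component_def)
    let ?J = "relatively_independent_joining K (\<lambda>z. m (b1, z)) (\<lambda>z. m (b2, z))"
    note J0 = component_joining(1)[OF g]
    interpret J0: prob_space ?J by (rule joining_overD(1)[OF J0])
    have sets_J: "sets J = sets (M \<Otimes>\<^sub>M M)" if "joining_over G (c b1) T \<pi> (c b2) T \<pi> J" for J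
      using joining_overD(2)[OF that] sets_pair_measure_cong[OF sets_c[OF s(1)] sets_c[OF s(2)]] by simp
    have "J = ?J" if J: "joining_over G (c b1) T \<pi> (c b2) T \<pi> J" for J
    proof -
      interpret J: prob_space J by (rule joining_overD(1)[OF J])
      show ?thesis
      proof (rule measure_eqI_rect_sublevel[OF rM rM J.finite_measure_axioms J0.finite_measure_axioms sets_J[OF J] sets_J[OF J0]])
        fix r q
        obtain i j where ij: "sublevel M \<phi> r = test_set i" "sublevel M \<phi> q = test_set j"
          using ex_test_set[OF sublevel_in_test_family] by metis
        let ?d = "measure J (test_set i \<times> test_set j) - indep_mass m b1 b2 (test_set i) (test_set j)"
        have "?d = 0"
        proof (rule ccontr)
          assume "?d \<noteq> 0"
          \<comment> \<open>Half of the deviation, since \<open>joining_imp_nontrivial_pair\<close>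
            spends one half of the gap on rounding; \<open>\<sigma>\<close> is the sign of the
            deviation.\<close>
          then obtain k where k: "inverse (real (Suc k)) < \<bar>?d\<bar> / 2"
            using reals_Archimedean[of "\<bar>?d\<bar> / 2"] by auto
          define \<sigma> :: real where "\<sigma> = (if 0 < ?d then 1 else -1)"
          have "x < y / 2 \<Longrightarrow> 2 * x \<le> y" for x y :: real by simp
          from this[OF k] have "2 * inverse (real (Suc k)) \<le> \<bar>?d\<bar>" .
          also have "\<dots> = \<sigma> * ?d" by (simp add: \<sigma>_def)
          finally have "2 * inverse (real (Suc k)) \<le> \<sigma> * ?d" .
          then have "(b1, b2) \<in> nontrivial_pairs m \<sigma> (inverse (real (Suc k))) i j"
            by (intro joining_imp_nontrivial_pair[OF J s]) (simp_all add: \<sigma>_def)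
          moreover have "\<sigma> \<in> {1, -1}" by (simp add: \<sigma>_def)
          ultimately show False using elim(1) w by blast
        qed
        then show "emeasure J (sublevel M \<phi> r \<times> sublevel M \<phi> q) = emeasure ?J (sublevel M \<phi> r \<times> sublevel M \<phi> q)"
          by (simp add: ij J.emeasure_eq_measure J0.emeasure_eq_measure component_joining(2)[OF g])
      qed
    qed
    then have "{J. joining_over G (c b1) T \<pi> (c b2) T \<pi> J} = {?J}" using J0 by blast
    then show ?case
      using s d w unfolding disjoint_component_pairs_def disjoint_over_def by auto
  qed
qed

end

text \<open>The completion gives a meaning to the measure of a set that is only known to contain a
  conull measurable set. Since \<open>emeasure\<close> is 0 on non-measurable sets, the value 1
  already entails measurability in the completion.\<close>

lemma AE_iff_emeasure_completion_eq_1: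
  assumes M: "prob_space M" and A: "A \<subseteq> space M"
  shows "emeasure (completion M) A = 1 \<longleftrightarrow> (AE x in M. x \<in> A)"
proof -
  interpret C: prob_space "completion M" by (rule prob_space.prob_space_completion[OF M])
  show ?thesis
  proof
    assume 1: "emeasure (completion M) A = 1"
    then have "A \<in> sets (completion M)" using emeasure_notin_sets by fastforce
    then have "AE x in completion M. x \<in> A"
      using 1 C.AE_in_set_eq_1 by (simp add: C.emeasure_eq_measure)
    then show "AE x in M. x \<in> A" by (simp add: AE_completion_iff)
  next
    assume "AE x in M. x \<in> A"
    then obtain N where N: "N \<in> null_sets M" "{x \<in> space M. x \<notin> A} \<subseteq> N"
      unfolding eventually_ae_filter by auto
    have "space M - A \<in> null_sets (completion M)"
      by (rule null_sets_completion_subset[OF _ null_sets_completionI[OF N(1)]]) (use N(2) in auto)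
    then have "space (completion M) - (space M - A) \<in> sets (completion M)" by blast
    then have "A \<in> sets (completion M)" using A by (simp add: double_diff)
    moreover have "AE x in completion M. x \<in> A"
      using \<open>AE x in M. x \<in> A\<close> by (rule AE_completion)
    ultimately show "emeasure (completion M) A = 1"
      using C.AE_in_set_eq_1 by (simp add: C.emeasure_eq_measure)
  qed
qed

theorem theorem4p1:
  fixes G :: "('g, 'm) monoid_scheme"
    and K :: "'z measure" and R :: "'g \<Rightarrow> 'z \<Rightarrow> 'z"
    and M :: "'x measure" and T :: "'g \<Rightarrow> 'x \<Rightarrow> 'x" and \<pi> :: "'x \<Rightarrow> 'z"
    and B :: "'b measure" and p :: "'x \<Rightarrow> 'b" and c :: "'b \<Rightarrow> 'x measure"
  assumes "group G" and "countable (carrier G)"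
    and "system G K R" and "ergodic_action G K R"
    and "system_over G K R M T \<pi>"
    and "infinite_to_one K M \<pi>"
    and "ergodic_decomposition G M T B p c"
  shows "((\<forall>(N :: real measure) S \<rho>.
             system_over G K R N S \<rho> \<longrightarrow> ergodic_action G N S \<longrightarrow>
             disjoint_over G K M T \<pi> N S \<rho>) \<longrightarrow>
          emeasure (completion (B \<Otimes>\<^sub>M B)) (disjoint_component_pairs G K T \<pi> B c) = 1)
       \<and> (emeasure (completion (B \<Otimes>\<^sub>M B)) (disjoint_component_pairs G K T \<pi> B c) = 1 \<longrightarrow>
          (\<forall>(N :: 'y measure) S \<rho>.
             system_over G K R N S \<rho> \<longrightarrow> ergodic_action G N S \<longrightarrow>
             disjoint_over G K M T \<pi> N S \<rho>))"
proof -
  have K_std: "standard_nonatomic K" and M_std: "standard_nonatomic M"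
    and sys: "pmp_action G K R" "pmp_action G M T" and f\<pi>: "factor_map G K R M T \<pi>"
    using assms(3,5) by (auto simp: system_def system_over_def)
  have B: "prob_space B" "standard_borel B" using assms(7) by (auto simp: ergodic_decomposition_def)
  obtain \<zeta> \<theta> where rK: "real_retract K \<zeta> \<theta>" using standard_nonatomic_imp_real_retract[OF K_std] by blast
  obtain \<phi> \<psi> where rM: "real_retract M \<phi> \<psi>" using standard_nonatomic_imp_real_retract[OF M_std] by blast
  obtain S \<beta> where "S \<in> sets (borel :: real measure)" "measurable_iso \<beta> B (restrict_space borel S)"
    using B(2) by (auto simp: standard_borel_def)
  then obtain \<gamma> where rB: "real_retract B \<beta> \<gamma>"
    using measurable_iso_imp_real_retract prob_space.not_empty[OF B(1)] by metis
  interpret decomposed_extension G K R M T \<pi> B p c \<zeta> \<theta> \<phi> \<psi> \<beta> \<gamma>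
    by (rule decomposed_extension.intro) (fact assms(1,2,4,7) sys f\<pi> rK rM rB)+
  interpret B: prob_space B by (rule B)
  interpret BB: pair_prob_space B B ..
  have "disjoint_component_pairs G K T \<pi> B c \<subseteq> space (B \<Otimes>\<^sub>M B)"
    by (auto simp: disjoint_component_pairs_def space_pair_measure)
  note full = AE_iff_emeasure_completion_eq_1[OF BB.prob_space_axioms this]
  show ?thesis
    unfolding full
  proof (intro conjI impI allI)
    show "AE w in B \<Otimes>\<^sub>M B. w \<in> disjoint_component_pairs G K T \<pi> B c"
      if "\<forall>(N :: real measure) S \<rho>. system_over G K R N S \<rho> \<longrightarrow> ergodic_action G N S \<longrightarrow>
        disjoint_over G K M T \<pi> N S \<rho>"
      using that by (intro AE_disjoint_pairs_if_disjoint[OF _ K_std]) blast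
  next
    fix N :: "'y measure" and S \<rho>
    assume D: "AE w in B \<Otimes>\<^sub>M B. w \<in> disjoint_component_pairs G K T \<pi> B c"
      and N: "system_over G K R N S \<rho>" and erg: "ergodic_action G N S"
    obtain \<phi>' \<psi>' where rN: "real_retract N \<phi>' \<psi>'"
      using N standard_nonatomic_imp_real_retract[of N] by (auto simp: system_over_def system_def)
    show "disjoint_over G K M T \<pi> N S \<rho>"
      by (rule disjoint_over_if_AE_disjoint_pairs[OF _ erg _ rN D])
        (use N in \<open>auto simp: system_over_def system_def\<close>)
  qed
qed

end
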